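(* Let $L$ be a first-order language with equality whose signature contains only relation symbols, and let $T$ be a consistent theory over $L$. Then the syntactic category $\mathrm{Syn}(T)$ is a small consistent coherent category.
   Context: LANGUAGE AND CALCULUS. $L$ has variables $x_k$, $k\in\mathbb Z$; relation symbols of arity $0$ are allowed. Primitive logical symbols are $\neg,\vee,\exists$; $\varphi\wedge\psi:=\neg(\neg\varphi\vee\neg\psi)$, $\varphi\to\psi:=\neg\varphi\vee\psi$, $\varphi\leftrightarrow\psi:=(\varphi\to\psi)\wedge(\psi\to\varphi)$, $\forall X:=\neg\exists X\neg$. Formulas are considered up to alpha-equivalence (renaming of bound variables). $\varphi[Y_i/X_i]$ denotes capture-avoiding simultaneous substitution of $Y_i$ for the distinct variables $X_i$. $E:=\neg\exists x_0[x_0=x_0]$. A sequent $\Gamma\Rightarrow\varphi$ consists of a finite set $\Gamma$ of formulas and a formula $\varphi$; it is derivable if it is obtainable by finitely many applications of the rules: $\Gamma\Rightarrow\varphi$ if $\varphi\in\Gamma$; $\Rightarrow X=X$; from $\Gamma\Rightarrow\varphi$ infer $\Gamma'\Rightarrow\varphi$ if $\Gamma\subset\Gamma'$; from $\Gamma,\psi\Rightarrow\varphi$ and $\Gamma,\neg\psi\Rightarrow\varphi$ infer $\Gamma\Rightarrow\varphi$; from $\Gamma,\neg\varphi\Rightarrow\psi$ and $\Gamma,\neg\varphi\Rightarrow\neg\psi$ infer $\Gamma\Rightarrow\varphi$; from $\Gamma,\varphi\Rightarrow\chi$ and $\Gamma,\psi\Rightarrow\chi$ infer $\Gamma,\varphi\vee\psi\Rightarrow\chi$;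 from $\Gamma\Rightarrow\varphi$ infer $\Gamma\Rightarrow\varphi\vee\psi$ and $\Gamma\Rightarrow\psi\vee\varphi$; from $\Gamma,\varphi[Y/X]\Rightarrow\psi$ infer $\Gamma,\exists X\varphi\Rightarrow\psi$ if $Y$ is not free in the conclusion sequent; from $\Gamma\Rightarrow\varphi[Y/X]$ infer $\Gamma,\neg E\Rightarrow\exists X\varphi$; from $\Gamma,\psi[Y/X]\Rightarrow\varphi[Y'/X']$ infer $\Gamma,\exists X\psi\Rightarrow\exists X'\varphi$ if $Y$ is not free in the conclusion sequent; from $\Gamma\Rightarrow\varphi[Y/X]$ infer $\Gamma,Y=Y'\Rightarrow\varphi[Y'/X]$. A set $S$ of sentences proves $\varphi$ if $\Gamma\Rightarrow\varphi$ is derivable for some finite $\Gamma\subset S$; $\varphi$ $S$-provably implies $\varphi'$ if $\Gamma,\varphi\Rightarrow\varphi'$ is derivable for some finite $\Gamma\subset S$; $S$-provable equivalence means implication both ways. A theory $T$ is a set of sentences; it is consistent if for no formula $\psi$ does $T$ prove both $\psi$ and $\neg\psi$. THE CATEGORY $\mathrm{Syn}(T)$. A nonsentence is a formula with at least one free variable. Writing a nonsentence as $\varphi(X_i)$ means that $X_1,\dots,X_n$ enumerates its free variables in increasing index order; then $\varphi(B_i):=\varphi[B_i/X_i]$. Indices: $i$ runs over $1..n$, $j$ over $1..m$, $k$ over $1..l$; $\forall x_{-i}$ abbreviates $\forall x_{-1}\cdots\forall x_{-n}$, etc. Objects are formulas of $L$. Premorphisms ($s,s',\dots$ are sentences, $\alpha,\beta,\gamma$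 nonsentences): Type 1, $\alpha(X_i)\to\beta(Y_j)$: a formula $\theta$ with free variables among $x_{-i},x_j$ such that $T$ proves F1: $\forall x_{-i}\forall x_j[\theta\to\alpha(x_{-i})\wedge\beta(x_j)]$; F2: $\forall x_{-i}[\alpha(x_{-i})\to\exists x_j\theta]$; F3: $\forall x_{-i}\forall x_j\forall x_{m+j}[\theta\wedge\theta[x_{m+j}/x_j]\to\bigwedge_j x_j=x_{m+j}]$. Type 2, $\alpha(X_i)\to s$: a single formal object, existing iff $T$ proves $\forall x_{-i}[\alpha(x_{-i})\to s]$. Type 3, $s\to\beta(Y_j)$: a formula $\theta$ with free variables among $x_j$ such that $T$ proves $\forall x_j[\theta\to s\wedge\beta(x_j)]$, $s\to\exists x_j\theta$ and $\forall x_j\forall x_{m+j}[\theta\wedge\theta[x_{m+j}/x_j]\to\bigwedge_j x_j=x_{m+j}]$. Type 4, $s\to s'$: a single formal object, existing iff $T$ proves $s\to s'$. $\theta(A_i,B_j)$ means substituting $A_i$ for $x_{-i}$ and $B_j$ for $x_j$. Morphisms: with sentence target, the premorphisms; with nonsentence target, premorphisms modulo $T\cup\{\neg E\}$-provable equivalence. Composition is induced by: for $\theta_1:\alpha(X_i)\to\beta(Y_j)$, $\theta_2:\beta\to\gamma(Z_k)$, $\theta_2\circ\theta_1=\exists T_j[\theta_1(x_{-i},T_j)\wedge\theta_2(T_j,x_k)]$ with $T_j$ new variables in increasing order; the same without $x_{-i}$ if the source is a sentence; the composite of $\alpha(X_i)\to s$ with $\theta_2:s\to\gamma(Z_k)$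 is $\alpha(x_{-i})\wedge\theta_2(x_k)$; the composite of $s\to s'$ with $\theta_2:s'\to\gamma$ is $s\wedge\theta_2(x_k)$; any composite with sentence target is the unique formal object. The identity of $\varphi(X_i)$ is $\varphi(x_{-i})\wedge\bigwedge_i x_i=x_{-i}$; that of a sentence $s$ is the formal $s\to s$. COHERENCE. In a category with pullbacks, a morphism $g:X\to Y$ is an effective epimorphism if it is a coequalizer of the two projections $X\times_Y X\rightrightarrows X$. $\mathrm{Sub}(X)$ is the poset of monomorphisms into $X$ up to isomorphism over $X$, ordered by factorization. A category $\mathcal C$ is coherent if: (1) it has finite limits, including a final object; (2) every morphism factors as an effective epimorphism followed by a monomorphism; (3) every $\mathrm{Sub}(X)$ is a join semilattice (has all finite joins, including a least element); (4) pullbacks of effective epimorphisms along any morphism are effective epimorphisms; (5) for every $X\to Y$ the pullback map $\mathrm{Sub}(Y)\to\mathrm{Sub}(X)$ is a homomorphism of join semilattices (preserving finite joins, including the least element). A coherent category is consistent if $\mathrm{Sub}$ of the final object has more than one element. *)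

theory Defs
  imports "HOL-Algebra.Order"
begin

section \<open>Formulas\<close>

text \<open>
  Formulas up to renaming of bound variables are represented in locally nameless style: the
  variable \<open>x\<^sub>k\<close> is \<open>Free k\<close>, and an occurrence of a variable bound by the \<open>i\<close>-th enclosing
  quantifier is \<open>Bound i\<close>. Each alpha-equivalence class has exactly one such representation, so
  equality of HOL terms is equality up to alpha-equivalence, and replacing free variables by free
  variables never captures. The quantifier that binds a named variable is \<open>ExV X \<phi>\<close> below; the
  constructor \<open>ExB\<close> is auxiliary.
\<close>

datatype var = Free int | Bound nat

datatype 'r fm =
    Rel 'r "var list"
  | Eq var var
  | Neg "'r fm"
  | Or "'r fm" "'r fm"
  | ExB "'r fm"

text \<open>
  A signature is a partial map \<open>L\<close>: its domain is the set of relation symbols (possibly empty)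
  and its values are their arities (possibly \<open>0\<close>).
\<close>

type_synonym 'r signature = "'r \<rightharpoonup> nat"

primrec var_ok :: "nat \<Rightarrow> var \<Rightarrow> bool" where
  "var_ok k (Free x) = True"
| "var_ok k (Bound i) = (i < k)"

primrec wff :: "'r signature \<Rightarrow> nat \<Rightarrow> 'r fm \<Rightarrow> bool" where
  "wff L k (Rel R vs) = (L R = Some (length vs) \<and> (\<forall>v\<in>set vs. var_ok k v))"
| "wff L k (Eq u v) = (var_ok k u \<and> var_ok k v)"
| "wff L k (Neg \<phi>) = wff L k \<phi>"
| "wff L k (Or \<phi> \<psi>) = (wff L k \<phi> \<and> wff L k \<psi>)"
| "wff L k (ExB \<phi>) = wff L (Suc k) \<phi>"

definition formulas :: "'r signature \<Rightarrow> 'r fm set" where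
  "formulas L = {\<phi>. wff L 0 \<phi>}"

primrec fv_var :: "var \<Rightarrow> int set" where
  "fv_var (Free x) = {x}"
| "fv_var (Bound i) = {}"

primrec fv :: "'r fm \<Rightarrow> int set" where
  "fv (Rel R vs) = (\<Union>v\<in>set vs. fv_var v)"
| "fv (Eq u v) = fv_var u \<union> fv_var v"
| "fv (Neg \<phi>) = fv \<phi>"
| "fv (Or \<phi> \<psi>) = fv \<phi> \<union> fv \<psi>"
| "fv (ExB \<phi>) = fv \<phi>"

definition sentences :: "'r signature \<Rightarrow> 'r fm set" where
  "sentences L = {\<phi> \<in> formulas L. fv \<phi> = {}}"

definition nonsentences :: "'r signature \<Rightarrow> 'r fm set" where
  "nonsentences L = {\<phi> \<in> formulas L. fv \<phi> \<noteq> {}}"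

primrec subst_var :: "(int \<Rightarrow> int) \<Rightarrow> var \<Rightarrow> var" where
  "subst_var \<sigma> (Free x) = Free (\<sigma> x)"
| "subst_var \<sigma> (Bound i) = Bound i"

primrec subst :: "(int \<Rightarrow> int) \<Rightarrow> 'r fm \<Rightarrow> 'r fm" where
  "subst \<sigma> (Rel R vs) = Rel R (map (subst_var \<sigma>) vs)"
| "subst \<sigma> (Eq u v) = Eq (subst_var \<sigma> u) (subst_var \<sigma> v)"
| "subst \<sigma> (Neg \<phi>) = Neg (subst \<sigma> \<phi>)"
| "subst \<sigma> (Or \<phi> \<psi>) = Or (subst \<sigma> \<phi>) (subst \<sigma> \<psi>)"
| "subst \<sigma> (ExB \<phi>) = ExB (subst \<sigma> \<phi>)"

primrec bind_var :: "nat \<Rightarrow> int \<Rightarrow> var \<Rightarrow> var" where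
  "bind_var k X (Free x) = (if x = X then Bound k else Free x)"
| "bind_var k X (Bound i) = Bound i"

primrec bind :: "nat \<Rightarrow> int \<Rightarrow> 'r fm \<Rightarrow> 'r fm" where
  "bind k X (Rel R vs) = Rel R (map (bind_var k X) vs)"
| "bind k X (Eq u v) = Eq (bind_var k X u) (bind_var k X v)"
| "bind k X (Neg \<phi>) = Neg (bind k X \<phi>)"
| "bind k X (Or \<phi> \<psi>) = Or (bind k X \<phi>) (bind k X \<psi>)"
| "bind k X (ExB \<phi>) = ExB (bind (Suc k) X \<phi>)"

definition ExV :: "int \<Rightarrow> 'r fm \<Rightarrow> 'r fm" where
  "ExV X \<phi> = ExB (bind 0 X \<phi>)"

definition And :: "'r fm \<Rightarrow> 'r fm \<Rightarrow> 'r fm" where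
  "And \<phi> \<psi> = Neg (Or (Neg \<phi>) (Neg \<psi>))"

definition Imp :: "'r fm \<Rightarrow> 'r fm \<Rightarrow> 'r fm" where
  "Imp \<phi> \<psi> = Or (Neg \<phi>) \<psi>"

definition AllV :: "int \<Rightarrow> 'r fm \<Rightarrow> 'r fm" where
  "AllV X \<phi> = Neg (ExV X (Neg \<phi>))"

definition EqV :: "int \<Rightarrow> int \<Rightarrow> 'r fm" where
  "EqV X Y = Eq (Free X) (Free Y)"

text \<open>The sentence \<open>E\<close>, saying that the universe is empty.\<close>

definition Emp :: "'r fm" where
  "Emp = Neg (ExV 0 (EqV 0 0))"

definition subst1 :: "'r fm \<Rightarrow> int \<Rightarrow> int \<Rightarrow> 'r fm" ("_[_'/'/_]" [1000, 0, 0] 1000) where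
  "\<phi>[Y//X] = subst (id(X := Y)) \<phi>"

text \<open>
  \<open>substs \<phi> Xs Ys\<close> substitutes simultaneously the members of \<open>Ys\<close> for those of \<open>Xs\<close>; the list
  \<open>Xs\<close> is always distinct and of the length of \<open>Ys\<close>.
\<close>

definition substs :: "'r fm \<Rightarrow> int list \<Rightarrow> int list \<Rightarrow> 'r fm" where
  "substs \<phi> Xs Ys = subst (\<lambda>x. case map_of (zip Xs Ys) x of None \<Rightarrow> x | Some y \<Rightarrow> y) \<phi>"

definition Exs :: "int list \<Rightarrow> 'r fm \<Rightarrow> 'r fm" where
  "Exs Xs \<phi> = foldr ExV Xs \<phi>"

definition Alls :: "int list \<Rightarrow> 'r fm \<Rightarrow> 'r fm" where
  "Alls Xs \<phi> = foldr AllV Xs \<phi>"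

text \<open>The value on the empty list is a dummy; only nonempty conjunctions are used below.\<close>

fun Ands :: "'r fm list \<Rightarrow> 'r fm" where
  "Ands [] = Neg (And Emp (Neg Emp))"
| "Ands [\<phi>] = \<phi>"
| "Ands (\<phi> # \<psi> # \<phi>s) = And \<phi> (Ands (\<psi> # \<phi>s))"

definition Eqs :: "int list \<Rightarrow> int list \<Rightarrow> 'r fm" where
  "Eqs Xs Ys = Ands (map2 EqV Xs Ys)"


subsection \<open>Adequacy of the representation\<close>

lemma finite_fv: "finite (fv \<phi>)"
proof -
  have "finite (fv_var v)" for v by (cases v) auto
  then show ?thesis by (induction \<phi>) auto
qed

lemma subst_id: "subst (\<lambda>x. x) \<phi> = \<phi>"
proof -
  have "subst_var (\<lambda>x. x) = id" by (rule ext, case_tac x) auto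
  then show ?thesis by (induction \<phi>) auto
qed

lemma fv_ExV: "fv (ExV X \<phi>) = fv \<phi> - {X}"
proof -
  have v: "fv_var (bind_var k X v) = fv_var v - {X}" for k v by (cases v) auto
  have "fv (bind k X \<phi>) = fv \<phi> - {X}" for k
    by (induction \<phi> arbitrary: k) (auto simp: v)
  then show ?thesis by (simp add: ExV_def)
qed

lemma wff_ExV: "ExV X \<phi> \<in> formulas L" if "\<phi> \<in> formulas L"
proof -
  have v: "var_ok (Suc k) (bind_var k X v)" if "var_ok k v" for k v
    using that by (cases v) auto
  have "wff L (Suc k) (bind k X \<phi>)" if "wff L k \<phi>" for k
    using that by (induction \<phi> arbitrary: k) (auto simp: v)
  with that show ?thesis by (simp add: formulas_def ExV_def)
qed

text \<open>Every formula of the form \<open>ExB \<phi>\<close> quantifies a named variable.\<close>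

lemma ExB_eq_ExV:
  assumes "ExB \<phi> \<in> formulas L" and X: "X \<notin> fv \<phi>"
  shows "\<exists>\<psi>\<in>formulas L. ExB \<phi> = ExV X \<psi>"
proof -
  have v: "\<exists>w. var_ok k w \<and> v = bind_var k X w"
    if "var_ok (Suc k) v" "X \<notin> fv_var v" for k v
  proof (cases v)
    case (Free x) then show ?thesis using that by (intro exI[of _ v]) auto
  next
    case (Bound i)
    then show ?thesis using that
      by (intro exI[of _ "if i = k then Free X else v"]) auto
  qed
  have vs: "\<exists>ws. (\<forall>w\<in>set ws. var_ok k w) \<and> vs = map (bind_var k X) ws"
    if "\<forall>v\<in>set vs. var_ok (Suc k) v" "X \<notin> (\<Union>v\<in>set vs. fv_var v)" for k vs
    using that
  proof (induction vs)
    case Nil then show ?case by simp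
  next
    case (Cons a vs)
    then obtain ws where "\<forall>w\<in>set ws. var_ok k w" "vs = map (bind_var k X) ws" by auto
    moreover obtain w where "var_ok k w" "a = bind_var k X w" using v[of k a] Cons.prems by auto
    ultimately show ?case by (intro exI[of _ "w # ws"]) auto
  qed
  have "\<exists>\<psi>. wff L k \<psi> \<and> \<phi> = bind k X \<psi>" if "wff L (Suc k) \<phi>" "X \<notin> fv \<phi>" for k
    using that
  proof (induction \<phi> arbitrary: k)
    case (Rel R us)
    then obtain ws where "\<forall>w\<in>set ws. var_ok k w" "us = map (bind_var k X) ws"
      using vs[of us k] by auto
    then show ?case using Rel by (intro exI[of _ "Rel R ws"]) auto
  next
    case (Eq a b)
    then obtain a' b' where "var_ok k a'" "a = bind_var k X a'" "var_ok k b'" "b = bind_var k X b'"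
      using v[of k a] v[of k b] by auto
    then show ?case by (intro exI[of _ "Eq a' b'"]) auto
  next
    case (Neg \<phi>)
    then obtain \<psi> where "wff L k \<psi>" "\<phi> = bind k X \<psi>" by fastforce
    then show ?case by (intro exI[of _ "Neg \<psi>"]) auto
  next
    case (Or \<phi>1 \<phi>2)
    then obtain \<psi>1 \<psi>2 where "wff L k \<psi>1" "\<phi>1 = bind k X \<psi>1" "wff L k \<psi>2" "\<phi>2 = bind k X \<psi>2"
      by fastforce
    then show ?case by (intro exI[of _ "Or \<psi>1 \<psi>2"]) auto
  next
    case (ExB \<phi>)
    then obtain \<psi> where "wff L (Suc k) \<psi>" "\<phi> = bind (Suc k) X \<psi>" by fastforce
    then show ?case by (intro exI[of _ "ExB \<psi>"]) auto
  qed
  then show ?thesis using assms by (auto simp: formulas_def ExV_def)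
qed

text \<open>
  Substitution is capture-avoiding: the bound variable is first renamed to one that is not
  introduced by the substitution. The case \<open>\<sigma> = id\<close> is the renaming of a bound variable.
\<close>

lemma subst_ExV:
  assumes "Y \<notin> \<sigma> ` (fv \<phi> - {X})"
  shows "subst \<sigma> (ExV X \<phi>) = ExV Y (subst (\<sigma>(X := Y)) \<phi>)"
proof -
  have v: "subst_var \<sigma> (bind_var k X v) = bind_var k Y (subst_var (\<sigma>(X := Y)) v)"
    if "Y \<notin> \<sigma> ` (fv_var v - {X})" for k v
    using that by (cases v) auto
  have "subst \<sigma> (bind k X \<phi>) = bind k Y (subst (\<sigma>(X := Y)) \<phi>)" for k
    using assms by (induction \<phi> arbitrary: k) (auto intro!: v)
  then show ?thesis by (simp add: ExV_def)
qed

corollary ExV_rename: "Y \<notin> fv \<phi> - {X} \<Longrightarrow> ExV X \<phi> = ExV Y (\<phi>[Y//X])"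
  using subst_ExV[of Y "\<lambda>x. x" \<phi> X] by (simp add: subst_id subst1_def id_def)


section \<open>Derivability\<close>

inductive derivable :: "'r signature \<Rightarrow> 'r fm set \<Rightarrow> 'r fm \<Rightarrow> bool" for L where
  assm: "finite \<Gamma> \<Longrightarrow> \<Gamma> \<subseteq> formulas L \<Longrightarrow> \<phi> \<in> \<Gamma> \<Longrightarrow> derivable L \<Gamma> \<phi>"
| eq_refl: "derivable L {} (EqV X X)"
| weaken: "derivable L \<Gamma> \<phi> \<Longrightarrow> finite \<Gamma>' \<Longrightarrow> \<Gamma>' \<subseteq> formulas L \<Longrightarrow> \<Gamma> \<subseteq> \<Gamma>' \<Longrightarrow> derivable L \<Gamma>' \<phi>"
| by_cases: "derivable L (insert \<psi> \<Gamma>) \<phi> \<Longrightarrow> derivable L (insert (Neg \<psi>) \<Gamma>) \<phi> \<Longrightarrow> derivable L \<Gamma> \<phi>"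
| contradiction:
    "derivable L (insert (Neg \<phi>) \<Gamma>) \<psi> \<Longrightarrow> derivable L (insert (Neg \<phi>) \<Gamma>) (Neg \<psi>)
      \<Longrightarrow> derivable L \<Gamma> \<phi>"
| or_left:
    "derivable L (insert \<phi> \<Gamma>) \<chi> \<Longrightarrow> derivable L (insert \<psi> \<Gamma>) \<chi>
      \<Longrightarrow> derivable L (insert (Or \<phi> \<psi>) \<Gamma>) \<chi>"
| or_right1: "derivable L \<Gamma> \<phi> \<Longrightarrow> \<psi> \<in> formulas L \<Longrightarrow> derivable L \<Gamma> (Or \<phi> \<psi>)"
| or_right2: "derivable L \<Gamma> \<phi> \<Longrightarrow> \<psi> \<in> formulas L \<Longrightarrow> derivable L \<Gamma> (Or \<psi> \<phi>)"
| ex_left: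
    "derivable L (insert (\<phi>[Y//X]) \<Gamma>) \<psi>
      \<Longrightarrow> Y \<notin> (\<Union>\<chi>\<in>insert (ExV X \<phi>) \<Gamma>. fv \<chi>) \<Longrightarrow> Y \<notin> fv \<psi>
      \<Longrightarrow> derivable L (insert (ExV X \<phi>) \<Gamma>) \<psi>"
| ex_right: "derivable L \<Gamma> (\<phi>[Y//X]) \<Longrightarrow> derivable L (insert (Neg Emp) \<Gamma>) (ExV X \<phi>)"
| ex_ex:
    "derivable L (insert (\<psi>[Y//X]) \<Gamma>) (\<phi>[Y'//X'])
      \<Longrightarrow> Y \<notin> (\<Union>\<chi>\<in>insert (ExV X \<psi>) \<Gamma>. fv \<chi>) \<Longrightarrow> Y \<notin> fv (ExV X' \<phi>)
      \<Longrightarrow> derivable L (insert (ExV X \<psi>) \<Gamma>) (ExV X' \<phi>)"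
| eq_subst: "derivable L \<Gamma> (\<phi>[Y//X]) \<Longrightarrow> derivable L (insert (EqV Y Y') \<Gamma>) (\<phi>[Y'//X])"

lemma derivable_sequent:
  assumes "derivable L \<Gamma> \<phi>"
  shows "finite \<Gamma> \<and> \<Gamma> \<subseteq> formulas L \<and> \<phi> \<in> formulas L"
proof -
  have v: "var_ok k (subst_var \<sigma> v) = var_ok k v" for k \<sigma> v by (cases v) auto
  have w: "wff L k (subst \<sigma> \<phi>) = wff L k \<phi>" for k \<sigma> and \<phi> :: "'a fm"
    by (induction \<phi> arbitrary: k) (auto simp: v)
  have s: "\<phi>[Y//X] \<in> formulas L \<longleftrightarrow> \<phi> \<in> formulas L" for \<phi> X Y
    by (simp add: subst1_def formulas_def w)
  have e: "EqV X Y \<in> formulas L" for X Y by (simp add: formulas_def EqV_def)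
  have n: "Neg \<phi> \<in> formulas L \<longleftrightarrow> \<phi> \<in> formulas L" for \<phi> by (simp add: formulas_def)
  have o: "Or \<phi> \<psi> \<in> formulas L \<longleftrightarrow> \<phi> \<in> formulas L \<and> \<psi> \<in> formulas L" for \<phi> \<psi>
    by (simp add: formulas_def)
  show ?thesis
    using assms by induction (auto simp: s e n o wff_ExV Emp_def)
qed

definition proves :: "'r signature \<Rightarrow> 'r fm set \<Rightarrow> 'r fm \<Rightarrow> bool" where
  "proves L S \<phi> \<longleftrightarrow> (\<exists>\<Gamma>. finite \<Gamma> \<and> \<Gamma> \<subseteq> S \<and> derivable L \<Gamma> \<phi>)"

definition prov_implies :: "'r signature \<Rightarrow> 'r fm set \<Rightarrow> 'r fm \<Rightarrow> 'r fm \<Rightarrow> bool" where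
  "prov_implies L S \<phi> \<phi>' \<longleftrightarrow> (\<exists>\<Gamma>. finite \<Gamma> \<and> \<Gamma> \<subseteq> S \<and> derivable L (insert \<phi> \<Gamma>) \<phi>')"

definition prov_equiv :: "'r signature \<Rightarrow> 'r fm set \<Rightarrow> 'r fm \<Rightarrow> 'r fm \<Rightarrow> bool" where
  "prov_equiv L S \<phi> \<phi>' \<longleftrightarrow> prov_implies L S \<phi> \<phi>' \<and> prov_implies L S \<phi>' \<phi>"

definition is_theory :: "'r signature \<Rightarrow> 'r fm set \<Rightarrow> bool" where
  "is_theory L T \<longleftrightarrow> T \<subseteq> sentences L"

definition consistent_theory :: "'r signature \<Rightarrow> 'r fm set \<Rightarrow> bool" where
  "consistent_theory L T \<longleftrightarrow> (\<nexists>\<psi>. \<psi> \<in> formulas L \<and> proves L T \<psi> \<and> proves L T (Neg \<psi>))"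


section \<open>Categories\<close>

text \<open>
  The objects and the morphisms of a category are given by sets, so that the categories considered
  here are small by construction.
\<close>

record ('o, 'm) cat =
  Ob :: "'o set"
  Mor :: "'m set"
  Dom :: "'m \<Rightarrow> 'o"
  Cod :: "'m \<Rightarrow> 'o"
  Ident :: "'o \<Rightarrow> 'm"
  Cmp :: "'m \<Rightarrow> 'm \<Rightarrow> 'm"  (infixl "\<cdot>\<index>" 70)

definition hom_set :: "('o, 'm) cat \<Rightarrow> 'o \<Rightarrow> 'o \<Rightarrow> 'm set" where
  "hom_set C a b = {f \<in> Mor C. Dom C f = a \<and> Cod C f = b}"

locale small_category =
  fixes C :: "('o, 'm) cat" (structure)
  assumes Dom_in: "f \<in> Mor C \<Longrightarrow> Dom C f \<in> Ob C"
    and Cod_in: "f \<in> Mor C \<Longrightarrow> Cod C f \<in> Ob C"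
    and Ident_in: "a \<in> Ob C \<Longrightarrow> Ident C a \<in> hom_set C a a"
    and Cmp_in: "f \<in> hom_set C a b \<Longrightarrow> g \<in> hom_set C b c \<Longrightarrow> g \<cdot> f \<in> hom_set C a c"
    and Ident_left: "f \<in> hom_set C a b \<Longrightarrow> Ident C b \<cdot> f = f"
    and Ident_right: "f \<in> hom_set C a b \<Longrightarrow> f \<cdot> Ident C a = f"
    and Cmp_assoc: "f \<in> hom_set C a b \<Longrightarrow> g \<in> hom_set C b c \<Longrightarrow> h \<in> hom_set C c d
          \<Longrightarrow> (h \<cdot> g) \<cdot> f = h \<cdot> (g \<cdot> f)"

definition is_mono :: "('o, 'm) cat \<Rightarrow> 'm \<Rightarrow> bool" where
  "is_mono C m \<longleftrightarrow> m \<in> Mor C \<and>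
     (\<forall>a. \<forall>f\<in>hom_set C a (Dom C m). \<forall>g\<in>hom_set C a (Dom C m).
        m \<cdot>\<^bsub>C\<^esub> f = m \<cdot>\<^bsub>C\<^esub> g \<longrightarrow> f = g)"

definition is_iso :: "('o, 'm) cat \<Rightarrow> 'm \<Rightarrow> bool" where
  "is_iso C h \<longleftrightarrow> h \<in> Mor C \<and>
     (\<exists>k\<in>hom_set C (Cod C h) (Dom C h).
        k \<cdot>\<^bsub>C\<^esub> h = Ident C (Dom C h) \<and> h \<cdot>\<^bsub>C\<^esub> k = Ident C (Cod C h))"

definition is_final :: "('o, 'm) cat \<Rightarrow> 'o \<Rightarrow> bool" where
  "is_final C t \<longleftrightarrow> t \<in> Ob C \<and> (\<forall>a\<in>Ob C. \<exists>!f. f \<in> hom_set C a t)"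


subsection \<open>Finite limits\<close>

definition is_functor ::
  "('i, 'u) cat \<Rightarrow> ('o, 'm) cat \<Rightarrow> ('i \<Rightarrow> 'o) \<Rightarrow> ('u \<Rightarrow> 'm) \<Rightarrow> bool" where
  "is_functor J C FO FM \<longleftrightarrow>
     (\<forall>i\<in>Ob J. FO i \<in> Ob C) \<and>
     (\<forall>i j. \<forall>u\<in>hom_set J i j. FM u \<in> hom_set C (FO i) (FO j)) \<and>
     (\<forall>i\<in>Ob J. FM (Ident J i) = Ident C (FO i)) \<and>
     (\<forall>i j k. \<forall>u\<in>hom_set J i j. \<forall>v\<in>hom_set J j k. FM (v \<cdot>\<^bsub>J\<^esub> u) = FM v \<cdot>\<^bsub>C\<^esub> FM u)"

definition is_cone ::
  "('i, 'u) cat \<Rightarrow> ('o, 'm) cat \<Rightarrow> ('i \<Rightarrow> 'o) \<Rightarrow> ('u \<Rightarrow> 'm) \<Rightarrow> 'o \<Rightarrow> ('i \<Rightarrow> 'm) \<Rightarrow> bool" where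
  "is_cone J C FO FM a p \<longleftrightarrow> a \<in> Ob C \<and>
     (\<forall>i\<in>Ob J. p i \<in> hom_set C a (FO i)) \<and>
     (\<forall>i j. \<forall>u\<in>hom_set J i j. FM u \<cdot>\<^bsub>C\<^esub> p i = p j)"

definition is_limit ::
  "('i, 'u) cat \<Rightarrow> ('o, 'm) cat \<Rightarrow> ('i \<Rightarrow> 'o) \<Rightarrow> ('u \<Rightarrow> 'm) \<Rightarrow> 'o \<Rightarrow> ('i \<Rightarrow> 'm) \<Rightarrow> bool" where
  "is_limit J C FO FM a p \<longleftrightarrow> is_cone J C FO FM a p \<and>
     (\<forall>b q. is_cone J C FO FM b q \<longrightarrow>
        (\<exists>!h. h \<in> hom_set C b a \<and> (\<forall>i\<in>Ob J. p i \<cdot>\<^bsub>C\<^esub> h = q i)))"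

text \<open>
  Every finite category is isomorphic to one whose objects and morphisms are natural numbers. The
  empty category is included, which yields a final object.
\<close>

definition has_finite_limits :: "('o, 'm) cat \<Rightarrow> bool" where
  "has_finite_limits C \<longleftrightarrow>
     (\<forall>(J :: (nat, nat) cat) FO FM.
        small_category J \<and> finite (Ob J) \<and> finite (Mor J) \<and> is_functor J C FO FM \<longrightarrow>
        (\<exists>a p. is_limit J C FO FM a p))"


subsection \<open>Pullbacks and effective epimorphisms\<close>

text \<open>
  \<open>is_pullback C f g p q\<close>: the square \<open>f \<cdot> p = g \<cdot> q\<close> is a pullback; \<open>p\<close> is then a pullback of
  \<open>g\<close> along \<open>f\<close>.
\<close>

definition is_pullback :: "('o, 'm) cat \<Rightarrow> 'm \<Rightarrow> 'm \<Rightarrow> 'm \<Rightarrow> 'm \<Rightarrow> bool" where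
  "is_pullback C f g p q \<longleftrightarrow>
     f \<in> Mor C \<and> g \<in> Mor C \<and> Cod C f = Cod C g \<and>
     p \<in> hom_set C (Dom C p) (Dom C f) \<and> q \<in> hom_set C (Dom C p) (Dom C g) \<and>
     f \<cdot>\<^bsub>C\<^esub> p = g \<cdot>\<^bsub>C\<^esub> q \<and>
     (\<forall>a. \<forall>u\<in>hom_set C a (Dom C f). \<forall>v\<in>hom_set C a (Dom C g).
        f \<cdot>\<^bsub>C\<^esub> u = g \<cdot>\<^bsub>C\<^esub> v \<longrightarrow>
        (\<exists>!h. h \<in> hom_set C a (Dom C p) \<and> p \<cdot>\<^bsub>C\<^esub> h = u \<and> q \<cdot>\<^bsub>C\<^esub> h = v))"

definition is_coequalizer :: "('o, 'm) cat \<Rightarrow> 'm \<Rightarrow> 'm \<Rightarrow> 'm \<Rightarrow> bool" where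
  "is_coequalizer C p q g \<longleftrightarrow>
     p \<in> Mor C \<and> q \<in> hom_set C (Dom C p) (Cod C p) \<and> g \<in> hom_set C (Cod C p) (Cod C g) \<and>
     g \<cdot>\<^bsub>C\<^esub> p = g \<cdot>\<^bsub>C\<^esub> q \<and>
     (\<forall>b. \<forall>k\<in>hom_set C (Cod C p) b. k \<cdot>\<^bsub>C\<^esub> p = k \<cdot>\<^bsub>C\<^esub> q \<longrightarrow>
        (\<exists>!h. h \<in> hom_set C (Cod C g) b \<and> h \<cdot>\<^bsub>C\<^esub> g = k))"

definition is_effective_epi :: "('o, 'm) cat \<Rightarrow> 'm \<Rightarrow> bool" where
  "is_effective_epi C g \<longleftrightarrow> (\<exists>p q. is_pullback C g g p q \<and> is_coequalizer C p q g)"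


subsection \<open>Subobjects\<close>

definition monos_into :: "('o, 'm) cat \<Rightarrow> 'o \<Rightarrow> 'm set" where
  "monos_into C X = {m. is_mono C m \<and> Cod C m = X}"

definition iso_over :: "('o, 'm) cat \<Rightarrow> 'o \<Rightarrow> ('m \<times> 'm) set" where
  "iso_over C X = {(m, m'). m \<in> monos_into C X \<and> m' \<in> monos_into C X \<and>
     (\<exists>h\<in>hom_set C (Dom C m) (Dom C m'). is_iso C h \<and> m' \<cdot>\<^bsub>C\<^esub> h = m)}"

definition factors_through :: "('o, 'm) cat \<Rightarrow> 'm \<Rightarrow> 'm \<Rightarrow> bool" where
  "factors_through C m m' \<longleftrightarrow> (\<exists>h\<in>hom_set C (Dom C m) (Dom C m'). m' \<cdot>\<^bsub>C\<^esub> h = m)"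

definition Sub :: "('o, 'm) cat \<Rightarrow> 'o \<Rightarrow> 'm set gorder" where
  "Sub C X = \<lparr>carrier = monos_into C X // iso_over C X, eq = (=),
     le = (\<lambda>A B. \<exists>m\<in>A. \<exists>m'\<in>B. factors_through C m m')\<rparr>"

text \<open>The empty join is the least element.\<close>

definition is_join :: "'a gorder \<Rightarrow> 'a set \<Rightarrow> 'a \<Rightarrow> bool" where
  "is_join P A s \<longleftrightarrow> least P s (Upper P A)"

definition join_semilattice :: "'a gorder \<Rightarrow> bool" where
  "join_semilattice P \<longleftrightarrow> partial_order P \<and>
     (\<forall>A. finite A \<and> A \<subseteq> carrier P \<longrightarrow> (\<exists>s. is_join P A s))"

definition join_hom :: "'a gorder \<Rightarrow> 'b gorder \<Rightarrow> ('a \<Rightarrow> 'b) \<Rightarrow> bool" where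
  "join_hom P Q F \<longleftrightarrow> F \<in> carrier P \<rightarrow> carrier Q \<and>
     (\<forall>A s. finite A \<and> A \<subseteq> carrier P \<and> is_join P A s \<longrightarrow> is_join Q (F ` A) (F s))"

text \<open>
  The pullback map on subobjects along \<open>f\<close>: all pullbacks along \<open>f\<close> of the monomorphisms in the
  class \<open>A\<close>. If pullbacks exist, they form one class of monomorphisms into the source of \<open>f\<close>.
\<close>

definition Sub_pullback :: "('o, 'm) cat \<Rightarrow> 'm \<Rightarrow> 'm set \<Rightarrow> 'm set" where
  "Sub_pullback C f A = {p. \<exists>m\<in>A. \<exists>q. is_pullback C f m p q}"


subsection \<open>Coherent categories\<close>

definition coherent_category :: "('o, 'm) cat \<Rightarrow> bool" where
  "coherent_category C \<longleftrightarrow> small_category C \<and>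
     has_finite_limits C \<and>
     (\<forall>f\<in>Mor C. \<exists>e m. is_effective_epi C e \<and> is_mono C m \<and> Cod C e = Dom C m \<and> m \<cdot>\<^bsub>C\<^esub> e = f) \<and>
     (\<forall>X\<in>Ob C. join_semilattice (Sub C X)) \<and>
     (\<forall>f g p q. is_effective_epi C g \<and> is_pullback C f g p q \<longrightarrow> is_effective_epi C p) \<and>
     (\<forall>f\<in>Mor C. join_hom (Sub C (Cod C f)) (Sub C (Dom C f)) (Sub_pullback C f))"

definition consistent_category :: "('o, 'm) cat \<Rightarrow> bool" where
  "consistent_category C \<longleftrightarrow> coherent_category C \<and>
     (\<exists>t. is_final C t \<and> (\<exists>A\<in>carrier (Sub C t). \<exists>B\<in>carrier (Sub C t). A \<noteq> B))"


section \<open>The syntactic category\<close>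

definition nfv :: "'r fm \<Rightarrow> nat" where
  "nfv \<phi> = card (fv \<phi>)"

text \<open>\<open>inst \<phi> Bs\<close> is \<open>\<phi>(B\<^sub>i)\<close>; it is \<open>\<phi>\<close> for a sentence \<open>\<phi>\<close> and \<open>Bs = []\<close>.\<close>

definition inst :: "'r fm \<Rightarrow> int list \<Rightarrow> 'r fm" where
  "inst \<phi> Bs = substs \<phi> (sorted_list_of_set (fv \<phi>)) Bs"

text \<open>The lists \<open>x\<^sub>-\<^sub>1, \<dots>, x\<^sub>-\<^sub>n\<close> and \<open>x\<^sub>k\<^sub>+\<^sub>1, \<dots>, x\<^sub>k\<^sub>+\<^sub>n\<close>.\<close>

definition neg_vars :: "nat \<Rightarrow> int list" where
  "neg_vars n = map (\<lambda>i. - int i) [1..<Suc n]"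

definition pos_vars :: "nat \<Rightarrow> nat \<Rightarrow> int list" where
  "pos_vars k n = map (\<lambda>i. int (k + i)) [1..<Suc n]"

text \<open>
  Premorphisms with nonsentence target \<open>\<beta>\<close>. If \<open>\<alpha>\<close> is a sentence, then \<open>n = 0\<close>, the variables
  \<open>x\<^sub>-\<^sub>i\<close> disappear, and one gets the premorphisms from a sentence to a nonsentence.
\<close>

definition premorphism ::
  "'r signature \<Rightarrow> 'r fm set \<Rightarrow> 'r fm \<Rightarrow> 'r fm \<Rightarrow> 'r fm \<Rightarrow> bool" where
  "premorphism L T \<alpha> \<beta> \<theta> \<longleftrightarrow>
     (let n = nfv \<alpha>; m = nfv \<beta>; xs = neg_vars n; ys = pos_vars 0 m; ys' = pos_vars m m in
        \<theta> \<in> formulas L \<and> fv \<theta> \<subseteq> set xs \<union> set ys \<and>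
        proves L T (Alls xs (Alls ys (Imp \<theta> (And (inst \<alpha> xs) (inst \<beta> ys))))) \<and>
        proves L T (Alls xs (Imp (inst \<alpha> xs) (Exs ys \<theta>))) \<and>
        proves L T (Alls xs (Alls ys (Alls ys' (Imp (And \<theta> (substs \<theta> ys ys')) (Eqs ys ys'))))))"

text \<open>Existence of the formal morphism with sentence target \<open>s\<close>.\<close>

definition formal_exists :: "'r signature \<Rightarrow> 'r fm set \<Rightarrow> 'r fm \<Rightarrow> 'r fm \<Rightarrow> bool" where
  "formal_exists L T \<alpha> s \<longleftrightarrow>
     (let xs = neg_vars (nfv \<alpha>) in proves L T (Alls xs (Imp (inst \<alpha> xs) s)))"

definition premor_class ::
  "'r signature \<Rightarrow> 'r fm set \<Rightarrow> 'r fm \<Rightarrow> 'r fm \<Rightarrow> 'r fm \<Rightarrow> 'r fm set" where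
  "premor_class L T \<alpha> \<beta> \<theta> =
     {\<theta>'. premorphism L T \<alpha> \<beta> \<theta>' \<and> prov_equiv L (T \<union> {Neg Emp}) \<theta> \<theta>'}"

datatype 'r arrow =
    Formal (arr_dom: "'r fm") (arr_cod: "'r fm")
  | Class (arr_dom: "'r fm") (arr_cod: "'r fm") "'r fm set"

text \<open>
  Composition on representatives. The bound variables \<open>T\<^sub>j\<close> are taken to be \<open>x\<^sub>l\<^sub>+\<^sub>j\<close>; any other
  choice of new variables gives the same formula up to alpha-equivalence.
\<close>

definition premor_comp :: "'r fm \<Rightarrow> 'r fm \<Rightarrow> 'r fm \<Rightarrow> 'r fm \<Rightarrow> 'r fm" where
  "premor_comp \<beta> \<gamma> \<theta>1 \<theta>2 =
     (let m = nfv \<beta>; l = nfv \<gamma>; ts = pos_vars l m in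
        Exs ts (And (substs \<theta>1 (pos_vars 0 m) ts) (substs \<theta>2 (neg_vars m) ts)))"

definition formal_comp :: "'r fm \<Rightarrow> 'r fm \<Rightarrow> 'r fm" where
  "formal_comp \<alpha> \<theta>2 = And (inst \<alpha> (neg_vars (nfv \<alpha>))) \<theta>2"

fun syn_comp :: "'r signature \<Rightarrow> 'r fm set \<Rightarrow> 'r arrow \<Rightarrow> 'r arrow \<Rightarrow> 'r arrow" where
  "syn_comp L T (Formal \<beta> s) f = Formal (arr_dom f) s"
| "syn_comp L T (Class \<beta> \<gamma> \<Theta>2) (Class \<alpha> \<beta>' \<Theta>1) =
     Class \<alpha> \<gamma> (\<Union>\<theta>1\<in>\<Theta>1. \<Union>\<theta>2\<in>\<Theta>2. premor_class L T \<alpha> \<gamma> (premor_comp \<beta> \<gamma> \<theta>1 \<theta>2))"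
| "syn_comp L T (Class s \<gamma> \<Theta>2) (Formal \<alpha> s') =
     Class \<alpha> \<gamma> (\<Union>\<theta>2\<in>\<Theta>2. premor_class L T \<alpha> \<gamma> (formal_comp \<alpha> \<theta>2))"

definition syn_ident :: "'r signature \<Rightarrow> 'r fm set \<Rightarrow> 'r fm \<Rightarrow> 'r arrow" where
  "syn_ident L T \<phi> =
     (if fv \<phi> = {} then Formal \<phi> \<phi>
      else let xs = neg_vars (nfv \<phi>); ys = pos_vars 0 (nfv \<phi>) in
        Class \<phi> \<phi> (premor_class L T \<phi> \<phi> (And (inst \<phi> xs) (Eqs ys xs))))"

definition Syn :: "'r signature \<Rightarrow> 'r fm set \<Rightarrow> ('r fm, 'r arrow) cat" where
  "Syn L T =
     \<lparr>Ob = formulas L,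
      Mor = {Formal \<alpha> s |\<alpha> s. \<alpha> \<in> formulas L \<and> s \<in> sentences L \<and> formal_exists L T \<alpha> s} \<union>
            {Class \<alpha> \<beta> (premor_class L T \<alpha> \<beta> \<theta>) |\<alpha> \<beta> \<theta>.
               \<alpha> \<in> formulas L \<and> \<beta> \<in> nonsentences L \<and> premorphism L T \<alpha> \<beta> \<theta>},
      Dom = arr_dom, Cod = arr_cod, Ident = syn_ident L T, Cmp = syn_comp L T\<rparr>"

end

theory Submission
  imports Defs "HOL-Library.Countable_Set"
begin

text \<open>
The calculus is sound and complete for a semantics with possibly empty universes, and through this
semantics \<open>Syn L T\<close> becomes a category of sets and functions, in which coherence can be read off.

A formula with \<open>n\<close> free variables defines, in every model of \<open>T\<close>, a set of \<open>n\<close>-tuples; a sentence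
defines the set of its truth, a subset of the one-element set of \<open>0\<close>-tuples. By completeness, the
conditions on a premorphism say exactly that it defines the graph of a function in every model
(\<open>premorphism_iff\<close>), and two premorphisms are identified exactly if they have the same graph in every
model (\<open>prov_equiv_iff\<close>). The formal morphisms into sentences fit into this picture, because a subset of a
one-element set receives at most one function.

So \<open>Syn L T\<close> is the category of definable functions between definable sets, taken over all models
simultaneously. Definable relations are closed under composition, converse, union and intersection,
and every definable relation \<open>R\<close> between \<open>\<alpha>\<close> and \<open>\<beta>\<close> is itself an object, whose two projections
tabulate it (\<open>Syn_tabulation\<close>). These few closure properties, collected in the locale
\<open>relational_category\<close>, suffice: pullbacks, equalizers, images and unions are tabulations of relations
built by these operations, and they are computed model by model as in the category of sets. Monomorphisms
are the injective arrows (\<open>mono_iff\<close>), effective epimorphisms the surjective ones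
(\<open>effective_epi_iff\<close>), and subobjects are definable subsets (\<open>Sub_le_iff\<close>), their pullback being
the inverse image (\<open>Sub_pullback\<close>). Stability of surjections and of unions under
pullback is then a fact about sets.

Compactness is built into the notion of truth in all models. A statement counts as true over \<open>T\<close> if
it is true in all models of some finite part of \<open>T\<close>, that is, eventually along the filter \<open>Models T\<close>.
Finitely many such statements can be combined by the usual filter rules, and completeness is needed only
for finite sequents; hence only finitely many symbols occur, the Henkin construction enumerates
countably many formulas, and universes can be taken to be sets of integers, the indices of variables.
The filter is proper exactly because \<open>T\<close> is consistent, which separates the least from the greatest
subobject of the final object.
\<close>

section \<open>Functional relations\<close>

definition is_fun :: "'a set \<Rightarrow> 'b set \<Rightarrow> ('a \<times> 'b) set \<Rightarrow> bool" where
  "is_fun A B R \<longleftrightarrow> R \<subseteq> A \<times> B \<and> A \<subseteq> Domain R \<and> single_valued R"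

definition inj_rel :: "('a \<times> 'b) set \<Rightarrow> bool" where
  "inj_rel R \<longleftrightarrow> single_valued (R\<inverse>)"

text \<open>
A span of functions \<open>P\<close>, \<open>Q\<close> tabulates \<open>R\<close> if \<open>t \<mapsto> (P t, Q t)\<close> is a bijection from the common source
onto \<open>R\<close>.
\<close>

definition tabulates :: "('t \<times> 'a) set \<Rightarrow> ('t \<times> 'b) set \<Rightarrow> ('a \<times> 'b) set \<Rightarrow> bool" where
  "tabulates P Q R \<longleftrightarrow> P\<inverse> O Q = R \<and>
     (\<forall>x y a b. (x, a) \<in> P \<longrightarrow> (y, a) \<in> P \<longrightarrow> (x, b) \<in> Q \<longrightarrow> (y, b) \<in> Q \<longrightarrow> x = y)"

lemma is_funE:
  assumes "is_fun A B R"
  obtains f where "\<And>a. a \<in> A \<Longrightarrow> f a \<in> B" "\<And>a b. (a, b) \<in> R \<longleftrightarrow> a \<in> A \<and> b = f a"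
proof -
  have "\<forall>a\<in>A. \<exists>b. (a, b) \<in> R" using assms by (auto simp: is_fun_def)
  then obtain f where f: "\<forall>a\<in>A. (a, f a) \<in> R" by metis
  show ?thesis
  proof (rule that[of f])
    show "f a \<in> B" if "a \<in> A" for a using f assms that by (auto simp: is_fun_def)
    show "(a, b) \<in> R \<longleftrightarrow> a \<in> A \<and> b = f a" for a b
      using f assms by (auto simp: is_fun_def dest: single_valuedD)
  qed
qed

lemma is_fun_Id_on:
  assumes "is_fun A B R"
  shows "Id_on A O R = R" "R O Id_on B = R" "R\<inverse> O R = Id_on (Range R)"
  using assms unfolding is_fun_def single_valued_def by blast+

text \<open>
Arguments about relations between functional relations are reduced, by this and the next lemma, to
equations between values of functions.
\<close>

lemma relcomp_fun_iff:
  assumes "\<And>a b. (a, b) \<in> R \<longleftrightarrow> a \<in> A \<and> b = f a" "\<And>a. a \<in> A \<Longrightarrow> f a \<in> B"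
    "\<And>a b. (a, b) \<in> R' \<longleftrightarrow> a \<in> B \<and> b = g a"
  shows "(a, c) \<in> R O R' \<longleftrightarrow> a \<in> A \<and> c = g (f a)"
  unfolding relcomp_unfold using assms by auto

lemma tabulates_fun_iff:
  assumes "\<And>a b. (a, b) \<in> P \<longleftrightarrow> a \<in> T \<and> b = p a" "\<And>a b. (a, b) \<in> Q \<longleftrightarrow> a \<in> T \<and> b = q a"
  shows "tabulates P Q R \<longleftrightarrow> (\<forall>x y. (x, y) \<in> R \<longleftrightarrow> (\<exists>t\<in>T. x = p t \<and> y = q t)) \<and>
    (\<forall>s\<in>T. \<forall>t\<in>T. p s = p t \<longrightarrow> q s = q t \<longrightarrow> s = t)"
proof -
  have "P\<inverse> O Q = R \<longleftrightarrow> (\<forall>x y. (x, y) \<in> R \<longleftrightarrow> (x, y) \<in> P\<inverse> O Q)" by auto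
  also have "\<dots> \<longleftrightarrow> (\<forall>x y. (x, y) \<in> R \<longleftrightarrow> (\<exists>t\<in>T. x = p t \<and> y = q t))"
    unfolding relcomp_unfold converse_unfold using assms by auto
  finally show ?thesis unfolding tabulates_def assms by blast
qed

text \<open>
The universal property of a tabulation. The mediating function sends \<open>x\<close> to the unique \<open>t\<close> lying over
\<open>(U x, V x)\<close>; its graph is obtained from the given ones by composition, converse and intersection, so
it stays within any class of relations closed under these operations.
\<close>

lemma tabulation_mediates:
  assumes "is_fun T A P" "is_fun T B Q" "tabulates P Q R"
    and "is_fun X A U" "is_fun X B V" "U\<inverse> O V \<subseteq> R"
  shows "is_fun X T (U O P\<inverse> \<inter> V O Q\<inverse>) \<and>
    (U O P\<inverse> \<inter> V O Q\<inverse>) O P = U \<and> (U O P\<inverse> \<inter> V O Q\<inverse>) O Q = V"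
proof -
  obtain p where p: "\<And>a. a \<in> T \<Longrightarrow> p a \<in> A" "\<And>a b. (a, b) \<in> P \<longleftrightarrow> a \<in> T \<and> b = p a"
    using assms(1) by (rule is_funE) blast
  obtain q where q: "\<And>a. a \<in> T \<Longrightarrow> q a \<in> B" "\<And>a b. (a, b) \<in> Q \<longleftrightarrow> a \<in> T \<and> b = q a"
    using assms(2) by (rule is_funE) blast
  obtain u where u: "\<And>a. a \<in> X \<Longrightarrow> u a \<in> A" "\<And>a b. (a, b) \<in> U \<longleftrightarrow> a \<in> X \<and> b = u a"
    using assms(4) by (rule is_funE) blast
  obtain v where v: "\<And>a. a \<in> X \<Longrightarrow> v a \<in> B" "\<And>a b. (a, b) \<in> V \<longleftrightarrow> a \<in> X \<and> b = v a"
    using assms(5) by (rule is_funE) blast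
  note tab = assms(3)[unfolded tabulates_fun_iff[OF p(2) q(2)]]
  have "(u x, v x) \<in> R" if "x \<in> X" for x using assms(6) u(2) v(2) that by blast
  then have "\<forall>x\<in>X. \<exists>t\<in>T. p t = u x \<and> q t = v x" using tab by metis
  then obtain h where h: "\<forall>x\<in>X. h x \<in> T \<and> p (h x) = u x \<and> q (h x) = v x" by metis
  then have hT: "\<And>x. x \<in> X \<Longrightarrow> h x \<in> T" by blast
  have H: "(x, t) \<in> U O P\<inverse> \<inter> V O Q\<inverse> \<longleftrightarrow> x \<in> X \<and> t = h x" for x t
    unfolding relcomp_unfold converse_unfold using h tab p(2) q(2) u(2) v(2) by auto
  have "is_fun X T (U O P\<inverse> \<inter> V O Q\<inverse>)"
    unfolding is_fun_def single_valued_def Domain_unfold subset_iff using h H by auto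
  moreover have "(U O P\<inverse> \<inter> V O Q\<inverse>) O P = U"
    
  proof -
    have "(x, c) \<in> (U O P\<inverse> \<inter> V O Q\<inverse>) O P \<longleftrightarrow> (x, c) \<in> U" for x c
      using relcomp_fun_iff[OF H hT p(2), of x c] u(2)[of x c] h by metis
    then show ?thesis by (simp only: set_eq_iff split_paired_All) simp
  qed
  moreover have "(U O P\<inverse> \<inter> V O Q\<inverse>) O Q = V"
    
  proof -
    have "(x, c) \<in> (U O P\<inverse> \<inter> V O Q\<inverse>) O Q \<longleftrightarrow> (x, c) \<in> V" for x c
      using relcomp_fun_iff[OF H hT q(2), of x c] v(2)[of x c] h by metis
    then show ?thesis by (simp only: set_eq_iff split_paired_All) simp
  qed
  ultimately show ?thesis by blast
qed

lemma tabulation_unique: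
  assumes "is_fun T A P" "is_fun T B Q" "tabulates P Q R"
    and "is_fun X T H" "is_fun X T H'" "H O P = H' O P" "H O Q = H' O Q"
  shows "H = H'"
proof -
  obtain p where p: "\<And>a. a \<in> T \<Longrightarrow> p a \<in> A" "\<And>a b. (a, b) \<in> P \<longleftrightarrow> a \<in> T \<and> b = p a"
    using assms(1) by (rule is_funE) blast
  obtain q where q: "\<And>a. a \<in> T \<Longrightarrow> q a \<in> B" "\<And>a b. (a, b) \<in> Q \<longleftrightarrow> a \<in> T \<and> b = q a"
    using assms(2) by (rule is_funE) blast
  obtain h where h: "\<And>a. a \<in> X \<Longrightarrow> h a \<in> T" "\<And>a b. (a, b) \<in> H \<longleftrightarrow> a \<in> X \<and> b = h a"
    using assms(4) by (rule is_funE) blast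
  obtain h' where h': "\<And>a. a \<in> X \<Longrightarrow> h' a \<in> T" "\<And>a b. (a, b) \<in> H' \<longleftrightarrow> a \<in> X \<and> b = h' a"
    using assms(5) by (rule is_funE) blast
  note tab = assms(3)[unfolded tabulates_fun_iff[OF p(2) q(2)]]
  have "h x = h' x" if "x \<in> X" for x
  proof -
    have "p (h x) = p (h' x)"
      using relcomp_fun_iff[OF h(2) h(1) p(2), of x "p (h x)"]
        relcomp_fun_iff[OF h'(2) h'(1) p(2), of x "p (h x)"] assms(6) that by simp
    moreover have "q (h x) = q (h' x)"
      using relcomp_fun_iff[OF h(2) h(1) q(2), of x "q (h x)"]
        relcomp_fun_iff[OF h'(2) h'(1) q(2), of x "q (h x)"] assms(7) that by simp
    ultimately show ?thesis using tab h(1)[OF that] h'(1)[OF that] by blast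
  qed
  then show ?thesis by (intro Set.set_eqI) (auto simp: h(2) h'(2))
qed

text \<open>
Commutativity of a square of functions, in the form in which a tabulation of
\<open>R O R'\<inverse>\<close> makes it automatic.
\<close>

lemma commute_iff:
  assumes "is_fun X A U" "is_fun X B V" "is_fun A C R" "is_fun B C R'"
  shows "U O R = V O R' \<longleftrightarrow> U\<inverse> O V \<subseteq> R O R'\<inverse>"
proof -
  obtain u where u: "\<And>a. a \<in> X \<Longrightarrow> u a \<in> A" "\<And>a b. (a, b) \<in> U \<longleftrightarrow> a \<in> X \<and> b = u a"
    using assms(1) by (rule is_funE) blast
  obtain v where v: "\<And>a. a \<in> X \<Longrightarrow> v a \<in> B" "\<And>a b. (a, b) \<in> V \<longleftrightarrow> a \<in> X \<and> b = v a"
    using assms(2) by (rule is_funE) blast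
  obtain r where r: "\<And>a. a \<in> A \<Longrightarrow> r a \<in> C" "\<And>a b. (a, b) \<in> R \<longleftrightarrow> a \<in> A \<and> b = r a"
    using assms(3) by (rule is_funE) blast
  obtain r' where r': "\<And>a. a \<in> B \<Longrightarrow> r' a \<in> C" "\<And>a b. (a, b) \<in> R' \<longleftrightarrow> a \<in> B \<and> b = r' a"
    using assms(4) by (rule is_funE) blast
  have "U O R = V O R' \<longleftrightarrow> (\<forall>x c. (x, c) \<in> U O R \<longleftrightarrow> (x, c) \<in> V O R')" by (simp add: set_eq_iff)
  also have "\<dots> \<longleftrightarrow> (\<forall>x\<in>X. r (u x) = r' (v x))"
    using relcomp_fun_iff[OF u(2,1) r(2)] relcomp_fun_iff[OF v(2,1) r'(2)] by auto
  also have "\<dots> \<longleftrightarrow> (\<forall>a b. (a, b) \<in> U\<inverse> O V \<longrightarrow> (a, b) \<in> R O R'\<inverse>)"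
  proof -
    have "(a, b) \<in> U\<inverse> O V \<longleftrightarrow> (\<exists>x\<in>X. a = u x \<and> b = v x)" for a b
      unfolding relcomp_unfold converse_unfold using u(2) v(2) by auto
    moreover have "(a, b) \<in> R O R'\<inverse> \<longleftrightarrow> a \<in> A \<and> b \<in> B \<and> r a = r' b" for a b
      unfolding relcomp_unfold converse_unfold using r(2) r'(2) by auto
    ultimately show ?thesis using u(1) v(1) by simp blast
  qed
  also have "\<dots> \<longleftrightarrow> U\<inverse> O V \<subseteq> R O R'\<inverse>" by auto
  finally show ?thesis .
qed

text \<open>
Since \<open>K\<close> and \<open>H\<close> are single-valued and carry the legs to each other, either span can be traversed inside
the other one, so both define \<open>R\<close>. Joint injectivity is inherited because \<open>H\<close> recovers a point of \<open>T\<close>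
from its value under \<open>K\<close>.
\<close>

lemma tabulates_transfer:
  assumes tab: "tabulates P' Q' R" and K: "is_fun T T' K" and H: "is_fun T' T H"
    and KH: "K O H = Id_on T" and e: "P = K O P'" "Q = K O Q'" "P' = H O P" "Q' = H O Q"
  shows "tabulates P Q R"
proof -
  have svK: "y = z" if "(x, y) \<in> K" "(x, z) \<in> K" for x y z
    using K that unfolding is_fun_def by (blast dest: single_valuedD)
  have svH: "y = z" if "(x, y) \<in> H" "(x, z) \<in> H" for x y z
    using H that unfolding is_fun_def by (blast dest: single_valuedD)
  have KK: "K\<inverse> O K \<subseteq> Id" and HH: "H\<inverse> O H \<subseteq> Id" using svK svH by auto
  have "P\<inverse> O Q = P'\<inverse> O (K\<inverse> O K) O Q'" unfolding e(1,2) by (simp add: converse_relcomp O_assoc)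
  also have "\<dots> \<subseteq> P'\<inverse> O Id O Q'" using KK by (intro relcomp_mono subset_refl)
  finally have le: "P\<inverse> O Q \<subseteq> P'\<inverse> O Q'" by simp
  have "P'\<inverse> O Q' = P\<inverse> O (H\<inverse> O H) O Q" unfolding e(3,4) by (simp add: converse_relcomp O_assoc)
  also have "\<dots> \<subseteq> P\<inverse> O Id O Q" using HH by (intro relcomp_mono subset_refl)
  finally have ge: "P'\<inverse> O Q' \<subseteq> P\<inverse> O Q" by simp
  have "x = y" if xy: "(x, a) \<in> P" "(y, a) \<in> P" "(x, b) \<in> Q" "(y, b) \<in> Q" for x y a b
  proof -
    obtain x' where x': "(x, x') \<in> K" "(x', a) \<in> P'" using xy e(1) by blast
    obtain y' where y': "(y, y') \<in> K" "(y', a) \<in> P'" using xy e(1) by blast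
    obtain x'' where x'': "(x, x'') \<in> K" "(x'', b) \<in> Q'" using xy e(2) by blast
    obtain y'' where y'': "(y, y'') \<in> K" "(y'', b) \<in> Q'" using xy e(2) by blast
    have "x' = x''" "y' = y''" using svK x' x'' y' y'' by auto
    then have xy': "x' = y'" using tab x' y' x'' y'' unfolding tabulates_def by blast
    have "x' \<in> T'" using K x' unfolding is_fun_def by blast
    then obtain z where "(x', z) \<in> H" using H unfolding is_fun_def by blast
    then have "(x, z) \<in> Id_on T" "(y, z) \<in> Id_on T" using x' y' xy' KH by blast+
    then show ?thesis by blast
  qed
  then show ?thesis using tab le ge unfolding tabulates_def by (simp add: subset_antisym)
qed

section \<open>Categories of functional relations\<close>

text \<open>
An index \<open>w\<close> stands for a model, \<open>S a w\<close> for the interpretation of the object \<open>a\<close> in it, \<open>G f w\<close> for the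
graph of the arrow \<open>f\<close>, and \<open>Rel a b\<close> for the definable families of relations. Everything holds
eventually along the filter \<open>F\<close>: an arrow is determined by its graph, and each definable family that is
eventually functional comes from an arrow. The axioms contain neither limits nor images; apart from a
one-point object, new objects are obtained only by tabulating a relation.
\<close>

locale relational_category =
  fixes C :: "('o, 'm) cat" (structure)
    and F :: "'w filter"
    and S :: "'o \<Rightarrow> 'w \<Rightarrow> 'a set"
    and G :: "'m \<Rightarrow> 'w \<Rightarrow> ('a \<times> 'a) set"
    and Rel :: "'o \<Rightarrow> 'o \<Rightarrow> ('w \<Rightarrow> ('a \<times> 'a) set) set"
  assumes Dom_in: "f \<in> Mor C \<Longrightarrow> Dom C f \<in> Ob C"
    and Cod_in: "f \<in> Mor C \<Longrightarrow> Cod C f \<in> Ob C"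
    and Ident_in: "a \<in> Ob C \<Longrightarrow> Ident C a \<in> hom_set C a a"
    and Cmp_in: "f \<in> hom_set C a b \<Longrightarrow> g \<in> hom_set C b c \<Longrightarrow> g \<cdot> f \<in> hom_set C a c"
    and G_fun: "f \<in> hom_set C a b \<Longrightarrow> \<forall>\<^sub>F w in F. is_fun (S a w) (S b w) (G f w)"
    and G_Ident: "a \<in> Ob C \<Longrightarrow> \<forall>\<^sub>F w in F. G (Ident C a) w = Id_on (S a w)"
    and G_Cmp: "f \<in> hom_set C a b \<Longrightarrow> g \<in> hom_set C b c
          \<Longrightarrow> \<forall>\<^sub>F w in F. G (g \<cdot> f) w = G f w O G g w"
    and faithful: "f \<in> hom_set C a b \<Longrightarrow> g \<in> hom_set C a b \<Longrightarrow> \<forall>\<^sub>F w in F. G f w = G g w \<Longrightarrow> f = g"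
    and full: "a \<in> Ob C \<Longrightarrow> b \<in> Ob C \<Longrightarrow> R \<in> Rel a b
          \<Longrightarrow> \<forall>\<^sub>F w in F. is_fun (S a w) (S b w) (R w)
          \<Longrightarrow> \<exists>f\<in>hom_set C a b. \<forall>\<^sub>F w in F. G f w = R w"
    and Rel_G: "f \<in> hom_set C a b \<Longrightarrow> G f \<in> Rel a b"
    and Rel_converse: "a \<in> Ob C \<Longrightarrow> b \<in> Ob C \<Longrightarrow> R \<in> Rel a b \<Longrightarrow> (\<lambda>w. (R w)\<inverse>) \<in> Rel b a"
    and Rel_comp: "a \<in> Ob C \<Longrightarrow> b \<in> Ob C \<Longrightarrow> c \<in> Ob C \<Longrightarrow> R \<in> Rel a b \<Longrightarrow> R' \<in> Rel b c
          \<Longrightarrow> (\<lambda>w. R w O R' w) \<in> Rel a c"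
    and Rel_Int: "a \<in> Ob C \<Longrightarrow> b \<in> Ob C \<Longrightarrow> R \<in> Rel a b \<Longrightarrow> R' \<in> Rel a b
          \<Longrightarrow> (\<lambda>w. R w \<inter> R' w) \<in> Rel a b"
    and Rel_Un: "a \<in> Ob C \<Longrightarrow> b \<in> Ob C \<Longrightarrow> R \<in> Rel a b \<Longrightarrow> R' \<in> Rel a b
          \<Longrightarrow> (\<lambda>w. R w \<union> R' w) \<in> Rel a b"
    and Rel_empty: "a \<in> Ob C \<Longrightarrow> b \<in> Ob C \<Longrightarrow> (\<lambda>w. {}) \<in> Rel a b"
    and Rel_top: "a \<in> Ob C \<Longrightarrow> b \<in> Ob C \<Longrightarrow> (\<lambda>w. S a w \<times> S b w) \<in> Rel a b"
    and tabulation: "a \<in> Ob C \<Longrightarrow> b \<in> Ob C \<Longrightarrow> R \<in> Rel a b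
          \<Longrightarrow> \<forall>\<^sub>F w in F. R w \<subseteq> S a w \<times> S b w
          \<Longrightarrow> \<exists>t p q. p \<in> hom_set C t a \<and> q \<in> hom_set C t b \<and>
                (\<forall>\<^sub>F w in F. tabulates (G p w) (G q w) (R w))"
    and unit_object: "\<exists>t\<in>Ob C. \<forall>\<^sub>F w in F. \<exists>x. S t w = {x}"
begin

abbreviation hom :: "'o \<Rightarrow> 'o \<Rightarrow> 'm set" where
  "hom \<equiv> hom_set C"

lemma hom_Ob: "f \<in> hom a b \<Longrightarrow> a \<in> Ob C \<and> b \<in> Ob C"
  using Dom_in Cod_in by (auto simp: hom_set_def)

lemma Mor_hom: "f \<in> Mor C \<longleftrightarrow> f \<in> hom (Dom C f) (Cod C f)"
  by (simp add: hom_set_def)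

lemma homD: "f \<in> hom a b \<Longrightarrow> f \<in> Mor C \<and> Dom C f = a \<and> Cod C f = b"
  by (simp add: hom_set_def)

lemma is_small_category: "small_category C"
proof
  fix f a b assume f: "f \<in> hom a b"
  then have a: "a \<in> Ob C" and b: "b \<in> Ob C" using hom_Ob by auto
  show "Ident C b \<cdot> f = f"
  proof (rule faithful[OF Cmp_in[OF f Ident_in[OF b]] f])
    show "\<forall>\<^sub>F w in F. G (Ident C b \<cdot> f) w = G f w"
      using G_Cmp[OF f Ident_in[OF b]] G_Ident[OF b] G_fun[OF f]
      by eventually_elim (metis is_fun_Id_on)
  qed
  show "f \<cdot> Ident C a = f"
  proof (rule faithful[OF Cmp_in[OF Ident_in[OF a] f] f])
    show "\<forall>\<^sub>F w in F. G (f \<cdot> Ident C a) w = G f w"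
      using G_Cmp[OF Ident_in[OF a] f] G_Ident[OF a] G_fun[OF f]
      by eventually_elim (metis is_fun_Id_on)
  qed
next
  fix f a b g c h d
  assume f: "f \<in> hom a b" and g: "g \<in> hom b c" and h: "h \<in> hom c d"
  show "(h \<cdot> g) \<cdot> f = h \<cdot> (g \<cdot> f)"
  proof (rule faithful)
    show "(h \<cdot> g) \<cdot> f \<in> hom a d" "h \<cdot> (g \<cdot> f) \<in> hom a d"
      using f g h by (blast intro: Cmp_in)+
    show "\<forall>\<^sub>F w in F. G ((h \<cdot> g) \<cdot> f) w = G (h \<cdot> (g \<cdot> f)) w"
      using G_Cmp[OF f g] G_Cmp[OF g h] G_Cmp[OF f Cmp_in[OF g h]] G_Cmp[OF Cmp_in[OF f g] h]
      by eventually_elim (simp add: O_assoc)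
  qed
qed (use Dom_in Cod_in Ident_in Cmp_in in auto)

sublocale small_category C by (rule is_small_category)

definition tab :: "'m \<Rightarrow> 'm \<Rightarrow> ('w \<Rightarrow> ('a \<times> 'a) set) \<Rightarrow> bool" where
  "tab p q R \<longleftrightarrow> (\<forall>\<^sub>F w in F. tabulates (G p w) (G q w) (R w))"

text \<open>
Pullbacks, binary products and factorizations through monomorphisms are all instances of this universal
property, for different relations \<open>R\<close>.
\<close>

lemma tab_universal:
  assumes p: "p \<in> hom t a" and q: "q \<in> hom t b" and tab: "tab p q R"
    and u: "u \<in> hom d a" and v: "v \<in> hom d b"
    and R: "\<forall>\<^sub>F w in F. (G u w)\<inverse> O G v w \<subseteq> R w"
  shows "\<exists>!h. h \<in> hom d t \<and> p \<cdot> h = u \<and> q \<cdot> h = v"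
proof (rule ex_ex1I)
  have o: "a \<in> Ob C" "b \<in> Ob C" "t \<in> Ob C" "d \<in> Ob C" using hom_Ob p q u by auto
  let ?H = "\<lambda>w. G u w O (G p w)\<inverse> \<inter> G v w O (G q w)\<inverse>"
  have r: "?H \<in> Rel d t"
    using o by (intro Rel_Int Rel_comp[of d a t] Rel_comp[of d b t] Rel_converse Rel_G p q u v)
  have H: "\<forall>\<^sub>F w in F. is_fun (S d w) (S t w) (?H w) \<and> ?H w O G p w = G u w \<and> ?H w O G q w = G v w"
    using G_fun[OF p] G_fun[OF q] G_fun[OF u] G_fun[OF v] tab[unfolded tab_def] R
    by eventually_elim (simp add: tabulation_mediates)
  then have "\<forall>\<^sub>F w in F. is_fun (S d w) (S t w) (?H w)" by (rule eventually_mono) simp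
  then obtain h where h: "h \<in> hom d t" "\<forall>\<^sub>F w in F. G h w = ?H w"
    using full[OF o(4,3) r] by blast
  have "p \<cdot> h = u"
  proof (rule faithful[OF Cmp_in[OF h(1) p] u])
    show "\<forall>\<^sub>F w in F. G (p \<cdot> h) w = G u w"
      using G_Cmp[OF h(1) p] h(2) H by eventually_elim simp
  qed
  moreover have "q \<cdot> h = v"
  proof (rule faithful[OF Cmp_in[OF h(1) q] v])
    show "\<forall>\<^sub>F w in F. G (q \<cdot> h) w = G v w"
      using G_Cmp[OF h(1) q] h(2) H by eventually_elim simp
  qed
  ultimately show "\<exists>h. h \<in> hom d t \<and> p \<cdot> h = u \<and> q \<cdot> h = v" using h by blast
next
  fix h h' assume "h \<in> hom d t \<and> p \<cdot> h = u \<and> q \<cdot> h = v"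
    "h' \<in> hom d t \<and> p \<cdot> h' = u \<and> q \<cdot> h' = v"
  then have h: "h \<in> hom d t" and h': "h' \<in> hom d t"
    and e: "p \<cdot> h = p \<cdot> h'" "q \<cdot> h = q \<cdot> h'" by auto
  show "h = h'"
  proof (rule faithful[OF h h'])
    show "\<forall>\<^sub>F w in F. G h w = G h' w"
      using G_fun[OF p] G_fun[OF q] tab[unfolded tab_def] G_fun[OF h] G_fun[OF h']
        G_Cmp[OF h p] G_Cmp[OF h q] G_Cmp[OF h' p] G_Cmp[OF h' q]
      by eventually_elim (rule tabulation_unique, assumption+, simp_all add: e)
  qed
qed

lemma comp_eq_iff:
  assumes "u \<in> hom d a" "f \<in> hom a c" "v \<in> hom d b" "g \<in> hom b c"
  shows "f \<cdot> u = g \<cdot> v \<longleftrightarrow> (\<forall>\<^sub>F w in F. G u w O G f w = G v w O G g w)"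
proof
  assume e: "f \<cdot> u = g \<cdot> v"
  show "\<forall>\<^sub>F w in F. G u w O G f w = G v w O G g w"
    using G_Cmp[OF assms(1,2)] G_Cmp[OF assms(3,4)] by eventually_elim (metis e)
next
  assume h: "\<forall>\<^sub>F w in F. G u w O G f w = G v w O G g w"
  show "f \<cdot> u = g \<cdot> v"
  proof (rule faithful[OF Cmp_in[OF assms(1,2)] Cmp_in[OF assms(3,4)]])
    show "\<forall>\<^sub>F w in F. G (f \<cdot> u) w = G (g \<cdot> v) w"
      using h G_Cmp[OF assms(1,2)] G_Cmp[OF assms(3,4)] by eventually_elim simp
  qed
qed

lemma comp_eq_iff_tab:
  assumes "u \<in> hom d a" "f \<in> hom a c" "v \<in> hom d b" "g \<in> hom b c"
  shows "f \<cdot> u = g \<cdot> v \<longleftrightarrow> (\<forall>\<^sub>F w in F. (G u w)\<inverse> O G v w \<subseteq> G f w O (G g w)\<inverse>)"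
proof -
  have "\<forall>\<^sub>F w in F. (G u w O G f w = G v w O G g w) = ((G u w)\<inverse> O G v w \<subseteq> G f w O (G g w)\<inverse>)"
    using G_fun[OF assms(1)] G_fun[OF assms(2)] G_fun[OF assms(3)] G_fun[OF assms(4)]
    by eventually_elim (rule commute_iff)
  then show ?thesis unfolding comp_eq_iff[OF assms] by (rule eventually_subst)
qed

subsection \<open>Pullbacks\<close>

lemma tab_pullback:
  assumes f: "f \<in> hom a c" and g: "g \<in> hom b c"
    and p: "p \<in> hom t a" and q: "q \<in> hom t b"
    and tab: "tab p q (\<lambda>w. G f w O (G g w)\<inverse>)"
  shows "is_pullback C f g p q"
proof -
  have c: "f \<cdot> p = g \<cdot> q"
    unfolding comp_eq_iff_tab[OF p f q g] using tab unfolding tab_def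
    by (rule eventually_mono) (simp add: tabulates_def)
  have u: "\<exists>!h. h \<in> hom d t \<and> p \<cdot> h = u \<and> q \<cdot> h = v"
    if "u \<in> hom d a" "v \<in> hom d b" "f \<cdot> u = g \<cdot> v" for d u v
    by (rule tab_universal[OF p q tab that(1,2)]) (use comp_eq_iff_tab[OF that(1) f that(2) g] that in auto)
  show ?thesis
    unfolding is_pullback_def using c u homD[OF f] homD[OF g] homD[OF p] p q by auto
qed

lemma tab_exists:
  assumes f: "f \<in> hom a c" and g: "g \<in> hom b c"
  obtains t p q where "p \<in> hom t a" "q \<in> hom t b" "tab p q (\<lambda>w. G f w O (G g w)\<inverse>)"
proof -
  have o: "a \<in> Ob C" "b \<in> Ob C" "c \<in> Ob C" using hom_Ob f g by auto
  have r: "(\<lambda>w. G f w O (G g w)\<inverse>) \<in> Rel a b"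
    using o by (intro Rel_comp[of a c b] Rel_converse Rel_G f g)
  have b: "\<forall>\<^sub>F w in F. G f w O (G g w)\<inverse> \<subseteq> S a w \<times> S b w"
    using G_fun[OF f] G_fun[OF g] by eventually_elim (auto simp: is_fun_def)
  show ?thesis using tabulation[OF o(1,2) r b] that unfolding tab_def by blast
qed

lemma tab_iso:
  assumes tab: "tab p' q' R" and p': "p' \<in> hom t' a" and q': "q' \<in> hom t' b"
    and h: "h \<in> hom t' t" and k: "k \<in> hom t t'"
    and hk: "h \<cdot> k = Ident C t" and p: "p' \<cdot> k \<cdot> h = p'" and q: "q' \<cdot> k \<cdot> h = q'"
  shows "tab (p' \<cdot> k) (q' \<cdot> k) R"
  unfolding tab_def
  using tab[unfolded tab_def] G_fun[OF k] G_fun[OF h] G_Cmp[OF k h]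
    G_Ident[OF conjunct2[OF hom_Ob[OF h]]]
    G_Cmp[OF k p'] G_Cmp[OF k q'] G_Cmp[OF h Cmp_in[OF k p']] G_Cmp[OF h Cmp_in[OF k q']]
  unfolding hk p q
proof eventually_elim
  case (elim w)
  have "G k w O G h w = Id_on (S t w)" using elim(4,5) by simp
  then show ?case by (rule tabulates_transfer[OF elim(1-3) _ elim(6-9)])
qed

text \<open>
Pullbacks are unique up to isomorphism, and one of them is a tabulation.
\<close>

lemma pullback_tab:
  assumes pb: "is_pullback C f g p q"
  shows "tab p q (\<lambda>w. G f w O (G g w)\<inverse>)"
proof -
  obtain a b c t where f: "f \<in> hom a c" and g: "g \<in> hom b c"
    and p: "p \<in> hom t a" and q: "q \<in> hom t b"
    using pb unfolding is_pullback_def by (auto simp: hom_set_def)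
  obtain t' p' q' where p': "p' \<in> hom t' a" and q': "q' \<in> hom t' b"
    and tab: "tab p' q' (\<lambda>w. G f w O (G g w)\<inverse>)" using tab_exists[OF f g] .
  have pb': "is_pullback C f g p' q'" using tab_pullback[OF f g p' q' tab] .
  have D: "Dom C f = a" "Dom C g = b" "Dom C p = t" "Dom C p' = t'"
    using homD f g p p' by auto
  have c: "f \<cdot> p = g \<cdot> q" and c': "f \<cdot> p' = g \<cdot> q'" using pb pb' unfolding is_pullback_def by auto
  have un: "\<exists>!h. h \<in> hom d t \<and> p \<cdot> h = u \<and> q \<cdot> h = v"
    if "u \<in> hom d a" "v \<in> hom d b" "f \<cdot> u = g \<cdot> v" for d u v
    using pb that unfolding is_pullback_def D by blast
  obtain h where h: "h \<in> hom t' t" "p \<cdot> h = p'" "q \<cdot> h = q'" using un[OF p' q' c'] by blast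
  obtain k where k: "k \<in> hom t t'" "p' \<cdot> k = p" "q' \<cdot> k = q"
    using pb' p q c unfolding is_pullback_def D by blast
  have t: "t \<in> Ob C" using hom_Ob p by blast
  have hk: "h \<cdot> k = Ident C t"
  proof -
    have "p \<cdot> (h \<cdot> k) = p" "q \<cdot> (h \<cdot> k) = q"
      using Cmp_assoc[OF k(1) h(1) p] Cmp_assoc[OF k(1) h(1) q] h k by auto
    moreover have "p \<cdot> Ident C t = p" "q \<cdot> Ident C t = q" using Ident_right p q by auto
    ultimately show ?thesis using un[OF p q c] Cmp_in[OF k(1) h(1)] Ident_in[OF t] by blast
  qed
  then show ?thesis using tab_iso[OF tab p' q' h(1) k(1)] h k by simp
qed

subsection \<open>Monomorphisms and subobjects\<close>

text \<open>
If \<open>m\<close> is monic, then the two projections of its kernel pair, the tabulation of \<open>m\<close> followed by its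
converse, coincide; hence this relation is contained in the identity.
\<close>

lemma mono_iff:
  assumes m: "m \<in> hom a b"
  shows "is_mono C m \<longleftrightarrow> (\<forall>\<^sub>F w in F. inj_rel (G m w))"
proof
  assume mono: "is_mono C m"
  obtain t p q where p: "p \<in> hom t a" and q: "q \<in> hom t a"
    and tab: "tab p q (\<lambda>w. G m w O (G m w)\<inverse>)" using tab_exists[OF m m] .
  have "m \<cdot> p = m \<cdot> q"
    using tab_pullback[OF m m p q tab] unfolding is_pullback_def by auto
  then have pq: "p = q" using mono p q homD[OF m] unfolding is_mono_def by auto
  show "\<forall>\<^sub>F w in F. inj_rel (G m w)"
    using tab[unfolded tab_def] G_fun[OF p]
  proof eventually_elim
    case (elim w)
    then have "G m w O (G m w)\<inverse> = (G p w)\<inverse> O G p w" unfolding pq tabulates_def by simp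
    also have "\<dots> \<subseteq> Id" using elim(2) by (auto simp: is_fun_def dest: single_valuedD)
    finally show ?case by (auto simp: inj_rel_def single_valued_def)
  qed
next
  assume i: "\<forall>\<^sub>F w in F. inj_rel (G m w)"
  have "f = g" if f: "f \<in> hom c a" and g: "g \<in> hom c a" and e: "m \<cdot> f = m \<cdot> g" for c f g
  proof (rule faithful[OF f g])
    show "\<forall>\<^sub>F w in F. G f w = G g w"
      using i e[unfolded comp_eq_iff[OF f m g m]] G_fun[OF f] G_fun[OF g] G_fun[OF m]
    proof eventually_elim
      case (elim w)
      have "G h w = G h w O G m w O (G m w)\<inverse>" if "is_fun (S c w) (S a w) (G h w)" for h
      proof -
        have "G m w O (G m w)\<inverse> = Id_on (S a w)"
          using elim(1,5) by (auto simp: inj_rel_def is_fun_def single_valued_def)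
        then show ?thesis using that by (auto simp: is_fun_def)
      qed
      then show ?case using elim by (metis O_assoc)
    qed
  qed
  then show "is_mono C m" unfolding is_mono_def using homD[OF m] by auto
qed

definition image :: "'m \<Rightarrow> 'w \<Rightarrow> 'a set" where
  "image f w = Range (G f w)"

lemma image_subset: "f \<in> hom a b \<Longrightarrow> \<forall>\<^sub>F w in F. image f w \<subseteq> S b w"
  by (drule G_fun, erule eventually_mono) (auto simp: image_def is_fun_def)

text \<open>
An injective \<open>m\<close> tabulates the identity relation of its image, so the factorization is a case of
\<open>tab_universal\<close>.
\<close>

lemma factors_through_iff:
  assumes f: "f \<in> hom a b" and m: "m \<in> hom t b" and i: "is_mono C m"
  shows "factors_through C f m \<longleftrightarrow> (\<forall>\<^sub>F w in F. image f w \<subseteq> image m w)"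
proof
  assume "factors_through C f m"
  then obtain h where h: "h \<in> hom a t" "m \<cdot> h = f"
    unfolding factors_through_def using homD[OF f] homD[OF m] by auto
  show "\<forall>\<^sub>F w in F. image f w \<subseteq> image m w"
    using G_Cmp[OF h(1) m] unfolding h(2) by eventually_elim (auto simp: image_def)
next
  assume s: "\<forall>\<^sub>F w in F. image f w \<subseteq> image m w"
  have "tab m m (\<lambda>w. Id_on (image m w))"
    using i[unfolded mono_iff[OF m]] G_fun[OF m] unfolding tab_def
    by eventually_elim
      (auto simp: tabulates_def image_def is_fun_def inj_rel_def dest: single_valuedD)
  moreover have "\<forall>\<^sub>F w in F. (G f w)\<inverse> O G f w \<subseteq> Id_on (image m w)"
    using s G_fun[OF f] by eventually_elim (simp add: is_fun_Id_on image_def Id_on_def, blast)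
  ultimately obtain h where "h \<in> hom a t" "m \<cdot> h = f"
    using tab_universal[OF m m _ f f] by blast
  then show "factors_through C f m"
    unfolding factors_through_def using homD[OF f] homD[OF m] by auto
qed

text \<open>
A definable subset \<open>Q\<close> enters as the relation \<open>Id_on Q\<close>. The two legs of a tabulation of it agree, and
each of them is the inclusion of \<open>Q\<close>.
\<close>

lemma subobject_exists:
  assumes b: "b \<in> Ob C" and R: "R \<in> Rel b b" and le: "\<forall>\<^sub>F w in F. R w = Id_on (Q w) \<and> Q w \<subseteq> S b w"
  obtains t m where "m \<in> hom t b" "is_mono C m" "\<forall>\<^sub>F w in F. image m w = Q w"
proof -
  have "\<forall>\<^sub>F w in F. R w \<subseteq> S b w \<times> S b w" using le by eventually_elim auto
  then obtain t p q where p: "p \<in> hom t b" and q: "q \<in> hom t b"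
    and tab: "\<forall>\<^sub>F w in F. tabulates (G p w) (G q w) (R w)"
    using tabulation[OF b b R] by blast
  have "p = q"
  proof (rule faithful[OF p q])
    show "\<forall>\<^sub>F w in F. G p w = G q w" using tab le G_fun[OF p] G_fun[OF q]
    proof eventually_elim
      case (elim w)
      have i: "x = y" if "(t, x) \<in> G p w" "(t, y) \<in> G q w" for t x y
      proof -
        have "(x, y) \<in> (G p w)\<inverse> O G q w" using that by blast
        then have "(x, y) \<in> Id_on (Q w)" using elim(1,2) unfolding tabulates_def by simp
        then show ?thesis by auto
      qed
      have d: "Domain (G p w) = Domain (G q w)" using elim(3,4) by (auto simp: is_fun_def)
      show ?case
      proof (intro Set.set_eqI iffI; clarify)
        fix t x assume tx: "(t, x) \<in> G p w"
        then obtain y where "(t, y) \<in> G q w" using d by blast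
        then show "(t, x) \<in> G q w" using i[OF tx] by blast
      next
        fix t x assume tx: "(t, x) \<in> G q w"
        then obtain y where "(t, y) \<in> G p w" using d by blast
        then show "(t, x) \<in> G p w" using i[OF _ tx] by blast
      qed
    qed
  qed
  have "\<forall>\<^sub>F w in F. inj_rel (G p w) \<and> image p w = Q w" using tab le
  proof eventually_elim
    case (elim w)
    let ?P = "G p w"
    have c: "?P\<inverse> O ?P = Id_on (Q w)" using elim \<open>p = q\<close> unfolding tabulates_def by simp
    have "x \<in> Range ?P \<longleftrightarrow> (x, x) \<in> ?P\<inverse> O ?P" for x by blast
    then have "x \<in> Range ?P \<longleftrightarrow> x \<in> Q w" for x unfolding c by (simp add: Id_on_iff)
    then have "Range ?P = Q w" by (rule Set.set_eqI)
    moreover have "inj_rel ?P"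
      using elim(1)[folded \<open>p = q\<close>] unfolding tabulates_def inj_rel_def single_valued_def converse_iff by metis
    ultimately show ?case by (simp add: image_def)
  qed
  then show ?thesis using that p mono_iff[OF p] by (simp add: eventually_conj_iff)
qed


subsection \<open>Finite limits\<close>

lemma mono_hom:
  assumes "is_mono C m" "m \<in> hom t a"
    and "h \<in> hom d t" "h' \<in> hom d t" "m \<cdot> h = m \<cdot> h'"
  shows "h = h'"
  using assms homD[OF assms(2)] unfolding is_mono_def by auto

lemma final_exists: "\<exists>t. is_final C t \<and> (\<forall>\<^sub>F w in F. \<exists>x. S t w = {x})"
proof -
  obtain t where t: "t \<in> Ob C" and e: "\<forall>\<^sub>F w in F. \<exists>x. S t w = {x}" using unit_object by blast
  have "\<exists>!f. f \<in> hom a t" if a: "a \<in> Ob C" for a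
  proof (rule ex_ex1I)
    have "\<forall>\<^sub>F w in F. is_fun (S a w) (S t w) (S a w \<times> S t w)"
      using e by eventually_elim (auto simp: is_fun_def single_valued_def)
    then show "\<exists>f. f \<in> hom a t" using full[OF a t Rel_top[OF a t]] by blast
    fix f g assume f: "f \<in> hom a t" and g: "g \<in> hom a t"
    show "f = g"
    proof (rule faithful[OF f g])
      show "\<forall>\<^sub>F w in F. G f w = G g w"
        using e G_fun[OF f] G_fun[OF g]
      proof eventually_elim
        case (elim w)
        then obtain x where x: "S t w = {x}" by blast
        have "R = S a w \<times> {x}" if "is_fun (S a w) (S t w) R" for R
          using that unfolding is_fun_def x by blast
        from this[OF elim(2)] this[OF elim(3)] show ?case by simp
      qed
    qed
  qed
  then show ?thesis using t e unfolding is_final_def by blast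
qed

lemma binary_product:
  assumes a: "a \<in> Ob C" and b: "b \<in> Ob C"
  shows "\<exists>t p q. p \<in> hom t a \<and> q \<in> hom t b \<and>
    (\<forall>d u v. u \<in> hom d a \<longrightarrow> v \<in> hom d b \<longrightarrow>
       (\<exists>!h. h \<in> hom d t \<and> p \<cdot> h = u \<and> q \<cdot> h = v))"
proof -
  let ?R = "\<lambda>w. S a w \<times> S b w"
  obtain t p q where p: "p \<in> hom t a" and q: "q \<in> hom t b" and tab: "tab p q ?R"
    using tabulation[OF a b Rel_top[OF a b]] unfolding tab_def by auto
  have "\<exists>!h. h \<in> hom d t \<and> p \<cdot> h = u \<and> q \<cdot> h = v"
    if u: "u \<in> hom d a" and v: "v \<in> hom d b" for d u v
  proof (rule tab_universal[OF p q tab u v])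
    show "\<forall>\<^sub>F w in F. (G u w)\<inverse> O G v w \<subseteq> S a w \<times> S b w"
      using G_fun[OF u] G_fun[OF v] by eventually_elim (auto simp: is_fun_def)
  qed
  then show ?thesis using p q by blast
qed

lemma equalizer:
  assumes f: "f \<in> hom a c" and g: "g \<in> hom a c"
  shows "\<exists>t m. m \<in> hom t a \<and> f \<cdot> m = g \<cdot> m \<and>
    (\<forall>d k. k \<in> hom d a \<longrightarrow> f \<cdot> k = g \<cdot> k \<longrightarrow> (\<exists>!h. h \<in> hom d t \<and> m \<cdot> h = k))"
proof -
  have a: "a \<in> Ob C" and c: "c \<in> Ob C" using hom_Ob f by auto
  let ?Q = "\<lambda>w. {x \<in> S a w. (x, x) \<in> G f w O (G g w)\<inverse>}"
  have R: "(\<lambda>w. G (Ident C a) w \<inter> G f w O (G g w)\<inverse>) \<in> Rel a a"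
    using a c by (intro Rel_Int Rel_comp[of a c a] Rel_converse Rel_G f g Ident_in)
  have "\<forall>\<^sub>F w in F. G (Ident C a) w \<inter> G f w O (G g w)\<inverse> = Id_on (?Q w) \<and> ?Q w \<subseteq> S a w"
    using G_Ident[OF a] by eventually_elim auto
  then obtain t m where m: "m \<in> hom t a" and mono: "is_mono C m"
    and im: "\<forall>\<^sub>F w in F. image m w = ?Q w"
    by (rule subobject_exists[OF a R])
  have e: "f \<cdot> k = g \<cdot> k \<longleftrightarrow> (\<forall>\<^sub>F w in F. image k w \<subseteq> ?Q w)" if k: "k \<in> hom d a" for d k
  proof -
    have "\<forall>\<^sub>F w in F. ((G k w)\<inverse> O G k w \<subseteq> G f w O (G g w)\<inverse>) = (image k w \<subseteq> ?Q w)"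
      using G_fun[OF k]
    proof eventually_elim
      case (elim w)
      have "Range (G k w) \<subseteq> S a w" using elim by (auto simp: is_fun_def)
      then show ?case unfolding is_fun_Id_on(3)[OF elim] image_def by blast
    qed
    then show ?thesis unfolding comp_eq_iff_tab[OF k f k g] by (rule eventually_subst)
  qed
  have "\<exists>!h. h \<in> hom d t \<and> m \<cdot> h = k" if k: "k \<in> hom d a" and ek: "f \<cdot> k = g \<cdot> k" for d k
  proof (rule ex_ex1I)
    have "\<forall>\<^sub>F w in F. image k w \<subseteq> image m w"
      using im ek[unfolded e[OF k]] by eventually_elim simp
    then have "factors_through C k m" using factors_through_iff[OF k m mono] by simp
    then show "\<exists>h. h \<in> hom d t \<and> m \<cdot> h = k"
      using homD[OF k] homD[OF m] unfolding factors_through_def by auto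
  qed (use mono_hom[OF mono m] in auto)
  moreover have "f \<cdot> m = g \<cdot> m" unfolding e[OF m] using im by eventually_elim simp
  ultimately show ?thesis using m by blast
qed

lemma finite_products:
  assumes "finite I" "\<And>i. i \<in> I \<Longrightarrow> X i \<in> Ob C"
  shows "\<exists>t p. t \<in> Ob C \<and> (\<forall>i\<in>I. p i \<in> hom t (X i)) \<and>
    (\<forall>d q. d \<in> Ob C \<longrightarrow> (\<forall>i\<in>I. q i \<in> hom d (X i)) \<longrightarrow>
      (\<exists>!h. h \<in> hom d t \<and> (\<forall>i\<in>I. p i \<cdot> h = q i)))"
  using assms
proof (induction I)
  case empty
  show ?case using final_exists unfolding is_final_def by simp blast
next
  case (insert i I)
  have "\<And>j. j \<in> I \<Longrightarrow> X j \<in> Ob C" using insert.prems by simp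
  then obtain t p where t: "t \<in> Ob C" and p': "\<forall>j\<in>I. p j \<in> hom t (X j)"
    and un': "\<forall>d q. d \<in> Ob C \<longrightarrow> (\<forall>j\<in>I. q j \<in> hom d (X j)) \<longrightarrow>
      (\<exists>!h. h \<in> hom d t \<and> (\<forall>j\<in>I. p j \<cdot> h = q j))"
    using insert.IH by blast
  note p = p'[THEN bspec] and un = un'[rule_format]
  obtain s r l where r: "r \<in> hom s t" and l: "l \<in> hom s (X i)"
    and un2': "\<forall>d u v. u \<in> hom d t \<longrightarrow> v \<in> hom d (X i) \<longrightarrow>
       (\<exists>!h. h \<in> hom d s \<and> r \<cdot> h = u \<and> l \<cdot> h = v)"
    using binary_product[OF t insert.prems[OF insertI1]] by blast
  note un2 = un2'[rule_format]
  define p' where "p' j = (if j = i then l else p j \<cdot> r)" for j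
  have p'I: "p' j = p j \<cdot> r" if "j \<in> I" for j using insert.hyps that by (auto simp: p'_def)
  have p'i: "p' i = l" by (simp add: p'_def)
  have p': "p' j \<in> hom s (X j)" if "j \<in> insert i I" for j
    using that p'I p'i l Cmp_in[OF r p] by auto
  have "\<exists>!h. h \<in> hom d s \<and> (\<forall>j\<in>insert i I. p' j \<cdot> h = q j)"
    if d: "d \<in> Ob C" and q: "\<forall>j\<in>insert i I. q j \<in> hom d (X j)" for d q
  proof -
    obtain h0 where h0: "h0 \<in> hom d t" "\<forall>j\<in>I. p j \<cdot> h0 = q j"
      and u0: "\<And>h. h \<in> hom d t \<Longrightarrow> \<forall>j\<in>I. p j \<cdot> h = q j \<Longrightarrow> h = h0"
      using un[OF d, of q] q by (metis insertI2)
    have eq: "(\<forall>j\<in>insert i I. p' j \<cdot> h = q j) \<longleftrightarrow> r \<cdot> h = h0 \<and> l \<cdot> h = q i"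
      if h: "h \<in> hom d s" for h
    proof -
      have "(\<forall>j\<in>I. p' j \<cdot> h = q j) \<longleftrightarrow> (\<forall>j\<in>I. p j \<cdot> (r \<cdot> h) = q j)"
        using p'I Cmp_assoc[OF h r p] by auto
      also have "\<dots> \<longleftrightarrow> r \<cdot> h = h0" using u0[OF Cmp_in[OF h r]] h0(2) by auto
      finally show ?thesis using p'i by auto
    qed
    have "\<exists>!h. h \<in> hom d s \<and> r \<cdot> h = h0 \<and> l \<cdot> h = q i" using un2[OF h0(1)] q by blast
    then show ?thesis using eq by metis
  qed
  then show ?case using p' hom_Ob[OF r] by (intro exI[of _ s] exI[of _ p']) blast
qed

text \<open>
The limit is built by starting from the product of all objects of the diagram and imposing the
commutativity conditions one arrow \<open>u\<close> at a time by an equalizer. The intermediate notion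
\<open>cone K\<close> asks for commutativity only over the arrows in \<open>K\<close>.
\<close>

lemma finite_limits: "has_finite_limits C"
  unfolding has_finite_limits_def
proof (intro allI impI, elim conjE)
  fix J :: "(nat, nat) cat" and X U
  assume J: "small_category J" and fO: "finite (Ob J)" and fM: "finite (Mor J)"
    and X: "is_functor J C X U"
  have XO: "X i \<in> Ob C" if "i \<in> Ob J" for i using X that unfolding is_functor_def by blast
  have UM: "U u \<in> hom (X (Dom J u)) (X (Cod J u))" if "u \<in> Mor J" for u
    using X that unfolding is_functor_def hom_set_def by blast
  have DC: "Dom J u \<in> Ob J" "Cod J u \<in> Ob J" if "u \<in> Mor J" for u
    using small_category.Dom_in[OF J that] small_category.Cod_in[OF J that] by auto
  define cone where "cone K d q \<longleftrightarrow> d \<in> Ob C \<and> (\<forall>i\<in>Ob J. q i \<in> hom d (X i)) \<and>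
    (\<forall>u\<in>K. U u \<cdot> q (Dom J u) = q (Cod J u))" for K d q
  have "\<exists>t p. cone K t p \<and>
      (\<forall>d q. cone K d q \<longrightarrow> (\<exists>!h. h \<in> hom d t \<and> (\<forall>i\<in>Ob J. p i \<cdot> h = q i)))"
    if "finite K" "K \<subseteq> Mor J" for K
    using that
  proof (induction K)
    case empty
    obtain t p where "t \<in> Ob C" "\<And>i. i \<in> Ob J \<Longrightarrow> p i \<in> hom t (X i)"
      "\<And>d q. d \<in> Ob C \<Longrightarrow> \<forall>i\<in>Ob J. q i \<in> hom d (X i) \<Longrightarrow>
        \<exists>!h. h \<in> hom d t \<and> (\<forall>i\<in>Ob J. p i \<cdot> h = q i)"
      using finite_products[of "Ob J" X] fO XO by blast
    then show ?case unfolding cone_def by (intro exI[of _ t] exI[of _ p]) auto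
  next
    case (insert u K)
    then have u: "u \<in> Mor J" by simp
    obtain t p where tp: "cone K t p" and un: "\<And>d q. cone K d q \<Longrightarrow>
        (\<exists>!h. h \<in> hom d t \<and> (\<forall>i\<in>Ob J. p i \<cdot> h = q i))" using insert by auto
    have p: "p i \<in> hom t (X i)" if "i \<in> Ob J" for i using tp that unfolding cone_def by blast
    let ?f = "U u \<cdot> p (Dom J u)" and ?g = "p (Cod J u)"
    have f: "?f \<in> hom t (X (Cod J u))" and g: "?g \<in> hom t (X (Cod J u))"
      using Cmp_in[OF p[OF DC(1)[OF u]] UM[OF u]] p[OF DC(2)[OF u]] by auto
    obtain s m where m: "m \<in> hom s t" and em: "?f \<cdot> m = ?g \<cdot> m"
      and un2: "\<And>d k. k \<in> hom d t \<Longrightarrow> ?f \<cdot> k = ?g \<cdot> k \<Longrightarrow>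
         (\<exists>!h. h \<in> hom d s \<and> m \<cdot> h = k)" using equalizer[OF f g] by metis
    define p' where "p' i = p i \<cdot> m" for i
    have as: "U v \<cdot> p (Dom J v) \<cdot> h = U v \<cdot> (p (Dom J v) \<cdot> h)"
      if "h \<in> hom d t" "v \<in> Mor J" for h d v
      using Cmp_assoc[OF that(1) p[OF DC(1)[OF that(2)]] UM[OF that(2)]] .
    have "cone (insert u K) s p'"
      unfolding cone_def
    proof (intro conjI ballI)
      show "s \<in> Ob C" using hom_Ob[OF m] by simp
      show "p' i \<in> hom s (X i)" if "i \<in> Ob J" for i
        unfolding p'_def using Cmp_in[OF m p[OF that]] .
      fix v assume v: "v \<in> insert u K"
      then have "v \<in> Mor J" using insert.prems by auto
      moreover have "U v \<cdot> p (Dom J v) \<cdot> m = p (Cod J v) \<cdot> m"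
        using v em tp unfolding cone_def by auto
      ultimately show "U v \<cdot> p' (Dom J v) = p' (Cod J v)" unfolding p'_def using as[OF m] by simp
    qed
    moreover have "\<exists>!h. h \<in> hom d s \<and> (\<forall>i\<in>Ob J. p' i \<cdot> h = q i)"
      if q: "cone (insert u K) d q" for d q
    proof -
      have "cone K d q" using q unfolding cone_def by blast
      then obtain k where k: "k \<in> hom d t" "\<forall>i\<in>Ob J. p i \<cdot> k = q i"
        and uk: "\<And>h. h \<in> hom d t \<Longrightarrow> \<forall>i\<in>Ob J. p i \<cdot> h = q i \<Longrightarrow> h = k" using un by metis
      have "?f \<cdot> k = ?g \<cdot> k" using as[OF k(1) u] k(2) q DC[OF u] unfolding cone_def by simp
      then have "\<exists>!h. h \<in> hom d s \<and> m \<cdot> h = k" using un2[OF k(1)] by blast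
      moreover have "(\<forall>i\<in>Ob J. p' i \<cdot> h = q i) \<longleftrightarrow> m \<cdot> h = k" if h: "h \<in> hom d s" for h
      proof -
        have "(\<forall>i\<in>Ob J. p' i \<cdot> h = q i) \<longleftrightarrow> (\<forall>i\<in>Ob J. p i \<cdot> (m \<cdot> h) = q i)"
          unfolding p'_def using Cmp_assoc[OF h m p] by auto
        also have "\<dots> \<longleftrightarrow> m \<cdot> h = k" using uk[OF Cmp_in[OF h m]] k(2) by auto
        finally show ?thesis .
      qed
      ultimately show ?thesis by metis
    qed
    ultimately show ?case by blast
  qed
  from this[OF fM subset_refl] obtain t p where "cone (Mor J) t p"
    "\<And>d q. cone (Mor J) d q \<Longrightarrow> \<exists>!h. h \<in> hom d t \<and> (\<forall>i\<in>Ob J. p i \<cdot> h = q i)" by blast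
  moreover have "cone (Mor J) d q \<longleftrightarrow> is_cone J C X U d q" for d q
    unfolding cone_def is_cone_def hom_set_def by auto
  ultimately show "\<exists>a p. is_limit J C X U a p" unfolding is_limit_def by blast
qed

subsection \<open>Effective epimorphisms\<close>

text \<open>
The image of \<open>f\<close> is the subset defined by the composite of the converse of \<open>f\<close> with \<open>f\<close>.
\<close>

lemma factorization:
  assumes f: "f \<in> hom a b"
  obtains t e m where "e \<in> hom a t" "m \<in> hom t b" "is_mono C m" "m \<cdot> e = f"
    "\<forall>\<^sub>F w in F. image e w = S t w" "\<forall>\<^sub>F w in F. image m w = image f w"
proof -
  have a: "a \<in> Ob C" and b: "b \<in> Ob C" using hom_Ob f by auto
  have R: "(\<lambda>w. (G f w)\<inverse> O G f w) \<in> Rel b b" using a b by (intro Rel_comp[of b a b] Rel_converse Rel_G f)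
  have "\<forall>\<^sub>F w in F. (G f w)\<inverse> O G f w = Id_on (image f w) \<and> image f w \<subseteq> S b w"
    using G_fun[OF f] image_subset[OF f]
    by eventually_elim (simp add: is_fun_Id_on image_def)
  then obtain t m where m: "m \<in> hom t b" and mono: "is_mono C m"
    and im: "\<forall>\<^sub>F w in F. image m w = image f w" by (rule subobject_exists[OF b R])
  have "factors_through C f m" unfolding factors_through_iff[OF f m mono] using im by eventually_elim simp
  then obtain e where e: "e \<in> hom a t" "m \<cdot> e = f"
    using homD[OF f] homD[OF m] unfolding factors_through_def by auto
  have "\<forall>\<^sub>F w in F. image e w = S t w"
    using G_Cmp[OF e(1) m] im G_fun[OF e(1)] G_fun[OF m] mono[unfolded mono_iff[OF m]]
  proof eventually_elim
    case (elim w)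
    show ?case
    proof
      show "image e w \<subseteq> S t w" using elim(3) by (auto simp: image_def is_fun_def)
      show "S t w \<subseteq> image e w"
      proof
        fix x assume "x \<in> S t w"
        then obtain y where y: "(x, y) \<in> G m w" using elim(4) unfolding is_fun_def by blast
        then have "y \<in> Range (G e w O G m w)" using elim(1,2) unfolding e(2) image_def by blast
        then obtain z x' where "(z, x') \<in> G e w" "(x', y) \<in> G m w" by blast
        then show "x \<in> image e w"
          using elim(5) y unfolding inj_rel_def single_valued_def image_def by blast
      qed
    qed
  qed
  then show ?thesis using that e m mono im by blast
qed

lemma surj_cancel:
  assumes g: "g \<in> hom a b" and s: "\<forall>\<^sub>F w in F. image g w = S b w"
    and h: "h \<in> hom b c" and h': "h' \<in> hom b c" and e: "h \<cdot> g = h' \<cdot> g"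
  shows "h = h'"
proof (rule faithful[OF h h'])
  show "\<forall>\<^sub>F w in F. G h w = G h' w"
    using e[unfolded comp_eq_iff[OF g h g h']] s G_fun[OF g] G_fun[OF h] G_fun[OF h']
  proof eventually_elim
    case (elim w)
    have "(G g w)\<inverse> O G g w = Id_on (S b w)" using elim(2,3) by (simp add: is_fun_Id_on image_def)
    then have "R = (G g w)\<inverse> O (G g w O R)" if "is_fun (S b w) (S c w) R" for R
      using is_fun_Id_on(1)[OF that] by (simp add: O_assoc[symmetric])
    then show ?case using elim by metis
  qed
qed

text \<open>
If \<open>g\<close> is the coequalizer of its kernel pair and \<open>g = m \<cdot> e\<close> is its factorization over the image, then
\<open>e\<close> coequalizes the kernel pair as well, so it factors through \<open>g\<close>; the resulting arrow is a right inverse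
of \<open>m\<close>, so \<open>m\<close> is onto. Conversely, an arrow \<open>k\<close> that coequalizes the kernel pair of a surjective \<open>g\<close>
factors through the relation given by the converse of \<open>g\<close> followed by \<open>k\<close>, which is then functional.
\<close>

lemma effective_epi_iff:
  assumes g: "g \<in> hom a b"
  shows "is_effective_epi C g \<longleftrightarrow> (\<forall>\<^sub>F w in F. image g w = S b w)"
proof
  assume "is_effective_epi C g"
  then obtain p q where pb: "is_pullback C g g p q" and co: "is_coequalizer C p q g"
    unfolding is_effective_epi_def by blast
  obtain t where p: "p \<in> hom t a" and q: "q \<in> hom t a" and pq: "g \<cdot> p = g \<cdot> q"
    using pb homD[OF g] unfolding is_pullback_def by (auto simp: hom_set_def)
  obtain s e m where e: "e \<in> hom a s" and m: "m \<in> hom s b" and mono: "is_mono C m"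
    and me: "m \<cdot> e = g" and im: "\<forall>\<^sub>F w in F. image m w = image g w" using factorization[OF g] by metis
  have epq: "e \<cdot> p = e \<cdot> q"
  proof (rule mono_hom[OF mono m Cmp_in[OF p e] Cmp_in[OF q e]])
    show "m \<cdot> (e \<cdot> p) = m \<cdot> (e \<cdot> q)" using Cmp_assoc[OF p e m] Cmp_assoc[OF q e m] pq me by simp
  qed
  have cu: "\<exists>!h. h \<in> hom b d \<and> h \<cdot> g = k" if "k \<in> hom a d" "k \<cdot> p = k \<cdot> q" for d k
    using co that homD[OF g] homD[OF p] by (simp add: is_coequalizer_def)
  obtain h where h: "h \<in> hom b s" "h \<cdot> g = e" using cu[OF e epq] by blast
  have b: "b \<in> Ob C" using hom_Ob[OF g] by simp
  have "(m \<cdot> h) \<cdot> g = g" "Ident C b \<cdot> g = g"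
    using Cmp_assoc[OF g h(1) m] h me Ident_left[OF g] by auto
  then have mh: "m \<cdot> h = Ident C b"
    using cu[OF g pq] Cmp_in[OF h(1) m] Ident_in[OF b] by metis
  show "\<forall>\<^sub>F w in F. image g w = S b w"
    using G_Cmp[OF h(1) m] G_Ident[OF b] im image_subset[OF m]
  proof eventually_elim
    case (elim w)
    have "x \<in> image m w" if "x \<in> S b w" for x
    proof -
      have "(x, x) \<in> G h w O G m w" using elim(1,2) that unfolding mh by (metis Id_on_iff)
      then show ?thesis unfolding image_def by blast
    qed
    then show ?case using elim(3,4) by blast
  qed
next
  assume s: "\<forall>\<^sub>F w in F. image g w = S b w"
  have o: "a \<in> Ob C" "b \<in> Ob C" using hom_Ob[OF g] by auto
  obtain t p q where p: "p \<in> hom t a" and q: "q \<in> hom t a"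
    and tab: "tab p q (\<lambda>w. G g w O (G g w)\<inverse>)" using tab_exists[OF g g] .
  have pb: "is_pullback C g g p q" using tab_pullback[OF g g p q tab] .
  then have gpq: "g \<cdot> p = g \<cdot> q" unfolding is_pullback_def by blast
  have "\<exists>!h. h \<in> hom b c \<and> h \<cdot> g = k"
    if k: "k \<in> hom a c" and e: "k \<cdot> p = k \<cdot> q" for c k
  proof (rule ex_ex1I)
    let ?R = "\<lambda>w. (G g w)\<inverse> O G k w"
    have c: "c \<in> Ob C" using hom_Ob[OF k] by simp
    have R: "?R \<in> Rel b c" using o c by (intro Rel_comp[of b a c] Rel_converse Rel_G g k)
    have H: "\<forall>\<^sub>F w in F. is_fun (S b w) (S c w) (?R w) \<and> G g w O ?R w = G k w"
      using e[unfolded comp_eq_iff_tab[OF p k q k]] tab[unfolded tab_def] s G_fun[OF g] G_fun[OF k]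
    proof eventually_elim
      case (elim w)
      have ke: "G g w O (G g w)\<inverse> \<subseteq> G k w O (G k w)\<inverse>" using elim(1,2) unfolding tabulates_def by simp
      obtain f where f: "\<And>x. x \<in> S a w \<Longrightarrow> f x \<in> S b w" "\<And>x y. (x, y) \<in> G g w \<longleftrightarrow> x \<in> S a w \<and> y = f x"
        using elim(4) by (rule is_funE) blast
      obtain l where l: "\<And>x. x \<in> S a w \<Longrightarrow> l x \<in> S c w" "\<And>x y. (x, y) \<in> G k w \<longleftrightarrow> x \<in> S a w \<and> y = l x"
        using elim(5) by (rule is_funE) blast
      have lf: "l x = l y" if "x \<in> S a w" "y \<in> S a w" "f x = f y" for x y
      proof -
        have "(x, y) \<in> G g w O (G g w)\<inverse>" using that f(2)[of x "f x"] f(2)[of y "f x"] by blast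
        then have "(x, y) \<in> G k w O (G k w)\<inverse>" using ke by blast
        then obtain z where "(x, z) \<in> G k w" "(y, z) \<in> G k w" by blast
        then show ?thesis using l(2) by simp
      qed
      have R: "(y, z) \<in> ?R w \<longleftrightarrow> (\<exists>x\<in>S a w. y = f x \<and> z = l x)" for y z
        unfolding relcomp_unfold converse_unfold using f(2) l(2) by auto
      have sf: "\<exists>x\<in>S a w. y = f x" if "y \<in> S b w" for y
      proof -
        have "y \<in> Range (G g w)" using elim(3) that unfolding image_def by simp
        then show ?thesis using f(2) by blast
      qed
      have "y \<in> S b w \<and> z \<in> S c w" if "(y, z) \<in> ?R w" for y z
        using that[unfolded R] f(1) l(1) by blast
      moreover have "z = z'" if "(y, z) \<in> ?R w" "(y, z') \<in> ?R w" for y z z'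
        using that[unfolded R] lf by metis
      moreover have "\<exists>z. (y, z) \<in> ?R w" if "y \<in> S b w" for y
        using sf[OF that] unfolding R by blast
      ultimately have "is_fun (S b w) (S c w) (?R w)"
        unfolding is_fun_def single_valued_def Domain_unfold by (simp add: subset_iff)
      moreover have "(x, z) \<in> G g w O ?R w \<longleftrightarrow> (x, z) \<in> G k w" for x z
      proof -
        have "z = l x \<and> x \<in> S a w" if "(x, y) \<in> G g w" "(y, z) \<in> ?R w" for y
          using that lf unfolding R f(2) by metis
        moreover have "(x, f x) \<in> G g w" "(f x, l x) \<in> ?R w" if "x \<in> S a w"
          using that unfolding R f(2) by blast+
        ultimately show ?thesis unfolding l(2) by blast
      qed
      ultimately show ?case by (simp only: set_eq_iff split_paired_All) simp
    qed
    then have "\<forall>\<^sub>F w in F. is_fun (S b w) (S c w) (?R w)" by (rule eventually_mono) simp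
    then obtain h where h: "h \<in> hom b c" "\<forall>\<^sub>F w in F. G h w = ?R w"
      using full[OF o(2) c R] by blast
    have "h \<cdot> g = k"
    proof (rule faithful[OF Cmp_in[OF g h(1)] k])
      show "\<forall>\<^sub>F w in F. G (h \<cdot> g) w = G k w"
        using G_Cmp[OF g h(1)] h(2) H by eventually_elim simp
    qed
    then show "\<exists>h. h \<in> hom b c \<and> h \<cdot> g = k" using h by blast
  qed (use surj_cancel[OF g s] in auto)
  then have "is_coequalizer C p q g"
    unfolding is_coequalizer_def using homD[OF g] homD[OF p] q g gpq by auto
  then show "is_effective_epi C g" using pb unfolding is_effective_epi_def by blast
qed

lemma effective_epi_pullback:
  assumes g: "is_effective_epi C g" and pb: "is_pullback C f g p q"
  shows "is_effective_epi C p"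
proof -
  obtain a b c t where f: "f \<in> hom a c" and g': "g \<in> hom b c"
    and p: "p \<in> hom t a" and q: "q \<in> hom t b"
    using pb unfolding is_pullback_def by (auto simp: hom_set_def)
  show ?thesis
    unfolding effective_epi_iff[OF p]
    using pullback_tab[OF pb, unfolded tab_def] g[unfolded effective_epi_iff[OF g']]
      G_fun[OF f] image_subset[OF p]
  proof eventually_elim
    case (elim w)
    have "x \<in> image p w" if "x \<in> S a w" for x
    proof -
      obtain y where y: "(x, y) \<in> G f w" "y \<in> S c w" using elim(3) \<open>x \<in> S a w\<close> unfolding is_fun_def by blast
      then obtain z where "(z, y) \<in> G g w" using elim(2) unfolding image_def by blast
      then have "(x, z) \<in> (G p w)\<inverse> O G q w" using y elim(1) unfolding tabulates_def by blast
      then show ?thesis unfolding image_def by blast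
    qed
    then show ?case using elim(4) by blast
  qed
qed


subsection \<open>Subobjects\<close>

lemma monos_into_hom: "m \<in> monos_into C X \<Longrightarrow> m \<in> hom (Dom C m) X"
  by (auto simp: monos_into_def is_mono_def hom_set_def)

lemma monos_into_iff: "m \<in> hom t X \<Longrightarrow> m \<in> monos_into C X \<longleftrightarrow> is_mono C m"
  by (auto simp: monos_into_def hom_set_def)

definition same_image :: "'m \<Rightarrow> 'm \<Rightarrow> bool" where
  "same_image m m' \<longleftrightarrow> (\<forall>\<^sub>F w in F. image m w = image m' w)"

lemma iso_over_iff:
  "(m, m') \<in> iso_over C X \<longleftrightarrow> m \<in> monos_into C X \<and> m' \<in> monos_into C X \<and> same_image m m'"
proof
  assume "(m, m') \<in> iso_over C X"
  then obtain h where mm: "m \<in> monos_into C X" "m' \<in> monos_into C X"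
    and h: "h \<in> hom (Dom C m) (Dom C m')" "is_iso C h" "m' \<cdot> h = m"
    unfolding iso_over_def by blast
  note m = monos_into_hom[OF mm(1)] and m' = monos_into_hom[OF mm(2)]
  have mono: "is_mono C m" "is_mono C m'" using mm unfolding monos_into_def by auto
  obtain k where k: "k \<in> hom (Dom C m') (Dom C m)" "h \<cdot> k = Ident C (Dom C m')"
    using h(2) homD[OF h(1)] unfolding is_iso_def by auto
  have "m \<cdot> k = m'" using Cmp_assoc[OF k(1) h(1) m'] k(2) h(3) Ident_right[OF m'] by simp
  then have "factors_through C m' m" "factors_through C m m'"
    using h k unfolding factors_through_def by auto
  then have "same_image m m'"
    unfolding factors_through_iff[OF m m' mono(2)] factors_through_iff[OF m' m mono(1)] same_image_def
    by eventually_elim simp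
  then show "m \<in> monos_into C X \<and> m' \<in> monos_into C X \<and> same_image m m'" using mm by simp
next
  assume a: "m \<in> monos_into C X \<and> m' \<in> monos_into C X \<and> same_image m m'"
  then have m: "m \<in> hom (Dom C m) X" and m': "m' \<in> hom (Dom C m') X"
    using monos_into_hom by auto
  have mono: "is_mono C m" "is_mono C m'" using a unfolding monos_into_def by auto
  have "factors_through C m' m" "factors_through C m m'"
    unfolding factors_through_iff[OF m m' mono(2)] factors_through_iff[OF m' m mono(1)]
    using a unfolding same_image_def by (auto elim: eventually_mono)
  then obtain h k where h: "h \<in> hom (Dom C m) (Dom C m')" "m' \<cdot> h = m"
    and k: "k \<in> hom (Dom C m') (Dom C m)" "m \<cdot> k = m'" unfolding factors_through_def by blast
  have o: "Dom C m \<in> Ob C" "Dom C m' \<in> Ob C" using hom_Ob[OF m] hom_Ob[OF m'] by auto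
  have "h \<cdot> k = Ident C (Dom C m')"
    by (rule mono_hom[OF mono(2) m' Cmp_in[OF k(1) h(1)] Ident_in[OF o(2)]])
      (use Cmp_assoc[OF k(1) h(1) m'] h(2) k(2) Ident_right[OF m'] in simp)
  moreover have "k \<cdot> h = Ident C (Dom C m)"
    by (rule mono_hom[OF mono(1) m Cmp_in[OF h(1) k(1)] Ident_in[OF o(1)]])
      (use Cmp_assoc[OF h(1) k(1) m] h(2) k(2) Ident_right[OF m] in simp)
  ultimately have "is_iso C h" unfolding is_iso_def using homD[OF h(1)] k(1) by auto
  then show "(m, m') \<in> iso_over C X" unfolding iso_over_def using a h by blast
qed

lemma same_image_refl: "same_image m m"
  by (simp add: same_image_def)

lemma same_image_sym: "same_image m m' \<Longrightarrow> same_image m' m"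
  unfolding same_image_def by (auto elim: eventually_mono)

lemma same_image_trans:
  assumes "same_image m m'" "same_image m' m''"
  shows "same_image m m''"
  using assms unfolding same_image_def by eventually_elim simp

text \<open>
By \<open>iso_over_iff\<close> a subobject is determined by the eventual image of any of its members, so \<open>sub_image\<close>
identifies \<open>Sub C X\<close> with the definable subsets of \<open>X\<close>, modulo eventual equality.
\<close>

definition sub_class :: "'o \<Rightarrow> 'm \<Rightarrow> 'm set" where
  "sub_class X m = {m' \<in> monos_into C X. same_image m m'}"

lemma sub_class_eq: "m \<in> monos_into C X \<Longrightarrow> sub_class X m = iso_over C X `` {m}"
  by (auto simp: sub_class_def iso_over_iff)

lemma carrier_Sub: "carrier (Sub C X) = sub_class X ` monos_into C X"
  unfolding Sub_def quotient_def using sub_class_eq by auto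

definition rep :: "'m set \<Rightarrow> 'm" where
  "rep A = (SOME m. m \<in> A)"

definition sub_image :: "'m set \<Rightarrow> 'w \<Rightarrow> 'a set" where
  "sub_image A = image (rep A)"

lemma rep_sub_class:
  assumes "m \<in> monos_into C X"
  shows "rep (sub_class X m) \<in> monos_into C X" "same_image m (rep (sub_class X m))"
proof -
  have "m \<in> sub_class X m" using assms by (simp add: sub_class_def same_image_refl)
  then have "rep (sub_class X m) \<in> sub_class X m" unfolding rep_def by (rule someI)
  then show "rep (sub_class X m) \<in> monos_into C X" "same_image m (rep (sub_class X m))"
    by (auto simp: sub_class_def)
qed

lemma rep_in:
  assumes "A \<in> carrier (Sub C X)"
  shows "rep A \<in> monos_into C X" "A = sub_class X (rep A)" "rep A \<in> A"
proof -
  obtain m where m: "m \<in> monos_into C X" "A = sub_class X m" using assms unfolding carrier_Sub by blast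
  note r = rep_sub_class[OF m(1), folded m(2)]
  show "rep A \<in> monos_into C X" by (rule r)
  show "A = sub_class X (rep A)" unfolding m(2)
    using r(2) unfolding m(2) sub_class_def by (blast intro: same_image_sym same_image_trans)
  then show "rep A \<in> A" using r(1) by (metis (no_types, lifting) mem_Collect_eq same_image_refl sub_class_def)
qed

lemma sub_image_member:
  assumes "A \<in> carrier (Sub C X)" "m \<in> A"
  shows "m \<in> monos_into C X" "\<forall>\<^sub>F w in F. image m w = sub_image A w"
  using rep_in(2)[OF assms(1)] assms(2) same_image_sym
  unfolding sub_class_def sub_image_def same_image_def[symmetric] by blast+

lemma sub_image_sub_class:
  "m \<in> monos_into C X \<Longrightarrow> \<forall>\<^sub>F w in F. sub_image (sub_class X m) w = image m w"
  using rep_sub_class(2) same_image_sym unfolding sub_image_def same_image_def[symmetric] by blast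

lemma Sub_le_iff:
  assumes A: "A \<in> carrier (Sub C X)" and B: "B \<in> carrier (Sub C X)"
  shows "A \<sqsubseteq>\<^bsub>Sub C X\<^esub> B \<longleftrightarrow> (\<forall>\<^sub>F w in F. sub_image A w \<subseteq> sub_image B w)"
proof -
  have *: "factors_through C m m' \<longleftrightarrow> (\<forall>\<^sub>F w in F. sub_image A w \<subseteq> sub_image B w)"
    if "m \<in> A" "m' \<in> B" for m m'
  proof -
    note m = sub_image_member[OF A that(1)] and m' = sub_image_member[OF B that(2)]
    have "\<forall>\<^sub>F w in F. (image m w \<subseteq> image m' w) = (sub_image A w \<subseteq> sub_image B w)"
      using m(2) m'(2) by eventually_elim simp
    moreover have "is_mono C m'" using m'(1) unfolding monos_into_def by simp
    ultimately show ?thesis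
      using factors_through_iff[OF monos_into_hom[OF m(1)] monos_into_hom[OF m'(1)]]
      by (simp add: eventually_subst)
  qed
  then show ?thesis using rep_in(3)[OF A] rep_in(3)[OF B] unfolding Sub_def by auto
qed

lemma Sub_eq_iff:
  assumes A: "A \<in> carrier (Sub C X)" and B: "B \<in> carrier (Sub C X)"
  shows "A = B \<longleftrightarrow> (\<forall>\<^sub>F w in F. sub_image A w = sub_image B w)"
proof
  assume "\<forall>\<^sub>F w in F. sub_image A w = sub_image B w"
  then have "same_image (rep A) (rep B)" by (simp add: same_image_def sub_image_def)
  then have "sub_class X (rep A) = sub_class X (rep B)"
    unfolding sub_class_def by (blast intro: same_image_sym same_image_trans)
  then show "A = B" using rep_in(2)[OF A] rep_in(2)[OF B] by simp
qed simp

lemma partial_order_Sub: "partial_order (Sub C X)"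
proof -
  have eq: "(.=\<^bsub>Sub C X\<^esub>) = (=)" by (simp add: Sub_def)
  show ?thesis
  proof (unfold_locales, unfold eq)
    fix A B D assume A: "A \<in> carrier (Sub C X)" and B: "B \<in> carrier (Sub C X)" and D: "D \<in> carrier (Sub C X)"
    assume "A \<sqsubseteq>\<^bsub>Sub C X\<^esub> B" "B \<sqsubseteq>\<^bsub>Sub C X\<^esub> D"
    then show "A \<sqsubseteq>\<^bsub>Sub C X\<^esub> D"
      unfolding Sub_le_iff[OF A B] Sub_le_iff[OF B D] Sub_le_iff[OF A D] by eventually_elim simp
  next
    fix A B assume A: "A \<in> carrier (Sub C X)" and B: "B \<in> carrier (Sub C X)"
    assume "A \<sqsubseteq>\<^bsub>Sub C X\<^esub> B" "B \<sqsubseteq>\<^bsub>Sub C X\<^esub> A"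
    then show "A = B"
      unfolding Sub_le_iff[OF A B] Sub_le_iff[OF B A] Sub_eq_iff[OF A B] by eventually_elim simp
  qed (auto simp: Sub_le_iff)
qed

lemma Rel_image:
  assumes "m \<in> hom t X"
  shows "(\<lambda>w. (G m w)\<inverse> O G m w) \<in> Rel X X"
    "\<forall>\<^sub>F w in F. (G m w)\<inverse> O G m w = Id_on (image m w)"
proof -
  have o: "t \<in> Ob C" "X \<in> Ob C" using hom_Ob[OF assms] by auto
  then show "(\<lambda>w. (G m w)\<inverse> O G m w) \<in> Rel X X"
    by (intro Rel_comp[of X t X] Rel_converse Rel_G assms)
  show "\<forall>\<^sub>F w in F. (G m w)\<inverse> O G m w = Id_on (image m w)"
    using G_fun[OF assms] by eventually_elim (simp add: is_fun_Id_on image_def)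
qed

lemma Sub_from_Rel:
  assumes "X \<in> Ob C" "R \<in> Rel X X" "\<forall>\<^sub>F w in F. R w = Id_on (Q w) \<and> Q w \<subseteq> S X w"
  obtains A where "A \<in> carrier (Sub C X)" "\<forall>\<^sub>F w in F. sub_image A w = Q w"
proof -
  obtain t m where m: "m \<in> hom t X" "is_mono C m" and im: "\<forall>\<^sub>F w in F. image m w = Q w"
    using subobject_exists[OF assms] by blast
  then have mm: "m \<in> monos_into C X" using monos_into_iff by blast
  have "\<forall>\<^sub>F w in F. sub_image (sub_class X m) w = Q w"
    using sub_image_sub_class[OF mm] im by eventually_elim simp
  then show ?thesis using that mm unfolding carrier_Sub by blast
qed

lemma union_exists:
  assumes X: "X \<in> Ob C" and "finite \<A>" "\<A> \<subseteq> carrier (Sub C X)"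
  obtains s where "s \<in> carrier (Sub C X)" "\<forall>\<^sub>F w in F. sub_image s w = (\<Union>A\<in>\<A>. sub_image A w)"
proof -
  have "\<exists>R\<in>Rel X X. \<forall>\<^sub>F w in F. R w = Id_on (\<Union>A\<in>\<A>. sub_image A w) \<and> (\<Union>A\<in>\<A>. sub_image A w) \<subseteq> S X w"
    using assms(2,3)
  proof (induction \<A>)
    case empty
    show ?case by (rule bexI[OF _ Rel_empty[OF X X]]) simp
  next
    case (insert A \<A>)
    then obtain R where R: "R \<in> Rel X X" "\<forall>\<^sub>F w in F. R w = Id_on (\<Union>A\<in>\<A>. sub_image A w)
        \<and> (\<Union>A\<in>\<A>. sub_image A w) \<subseteq> S X w" by auto
    have m: "rep A \<in> hom (Dom C (rep A)) X" using insert.prems rep_in(1) monos_into_hom by blast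
    show ?case
    proof (rule bexI)
      show "(\<lambda>w. (G (rep A) w)\<inverse> O G (rep A) w \<union> R w) \<in> Rel X X"
        using Rel_Un[OF X X Rel_image(1)[OF m] R(1)] .
      show "\<forall>\<^sub>F w in F. (G (rep A) w)\<inverse> O G (rep A) w \<union> R w = Id_on (\<Union>A\<in>insert A \<A>. sub_image A w) \<and>
          (\<Union>A\<in>insert A \<A>. sub_image A w) \<subseteq> S X w"
        using Rel_image(2)[OF m] R(2) image_subset[OF m]
        by eventually_elim (auto simp: sub_image_def)
    qed
  qed
  then obtain R where R: "R \<in> Rel X X" "\<forall>\<^sub>F w in F. R w = Id_on (\<Union>A\<in>\<A>. sub_image A w) \<and>
      (\<Union>A\<in>\<A>. sub_image A w) \<subseteq> S X w" by (rule bexE)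
  show ?thesis by (rule Sub_from_Rel[OF X R]) (rule that)
qed

text \<open>
The definable union is an upper bound below all upper bounds; finiteness of the family is what allows
its members to be compared in one and the same eventual set of indices.
\<close>

lemma is_join_iff:
  assumes X: "X \<in> Ob C" and fin: "finite \<A>" and \<A>: "\<A> \<subseteq> carrier (Sub C X)"
    and s: "s \<in> carrier (Sub C X)"
  shows "is_join (Sub C X) \<A> s \<longleftrightarrow> (\<forall>\<^sub>F w in F. sub_image s w = (\<Union>A\<in>\<A>. sub_image A w))"
proof -
  have upper: "u \<in> Upper (Sub C X) \<A> \<longleftrightarrow> (\<forall>\<^sub>F w in F. (\<Union>A\<in>\<A>. sub_image A w) \<subseteq> sub_image u w)"
    if u: "u \<in> carrier (Sub C X)" for u
  proof -
    have "u \<in> Upper (Sub C X) \<A> \<longleftrightarrow> (\<forall>A\<in>\<A>. A \<sqsubseteq>\<^bsub>Sub C X\<^esub> u)"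
      using u \<A> unfolding Upper_def by blast
    also have "\<dots> \<longleftrightarrow> (\<forall>A\<in>\<A>. \<forall>\<^sub>F w in F. sub_image A w \<subseteq> sub_image u w)"
      using Sub_le_iff[OF _ u] \<A> by blast
    also have "\<dots> \<longleftrightarrow> (\<forall>\<^sub>F w in F. \<forall>A\<in>\<A>. sub_image A w \<subseteq> sub_image u w)"
      by (rule eventually_ball_finite_distrib[OF fin, symmetric])
    finally show ?thesis by (simp add: UN_subset_iff)
  qed
  have J: "is_join (Sub C X) \<A> s \<longleftrightarrow> s \<in> Upper (Sub C X) \<A> \<and>
      (\<forall>u\<in>Upper (Sub C X) \<A>. s \<sqsubseteq>\<^bsub>Sub C X\<^esub> u)" for s
    unfolding is_join_def least_def by (auto simp: Upper_def)
  show ?thesis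
  proof
    assume e: "\<forall>\<^sub>F w in F. sub_image s w = (\<Union>A\<in>\<A>. sub_image A w)"
    have "s \<sqsubseteq>\<^bsub>Sub C X\<^esub> u" if "u \<in> Upper (Sub C X) \<A>" for u
    proof -
      have u: "u \<in> carrier (Sub C X)" using that by (auto simp: Upper_def)
      show ?thesis unfolding Sub_le_iff[OF s u] using e that[unfolded upper[OF u]] by eventually_elim simp
    qed
    moreover have "s \<in> Upper (Sub C X) \<A>" unfolding upper[OF s] using e by eventually_elim simp
    ultimately show "is_join (Sub C X) \<A> s" unfolding J by blast
  next
    assume j: "is_join (Sub C X) \<A> s"
    obtain u where u: "u \<in> carrier (Sub C X)" and e: "\<forall>\<^sub>F w in F. sub_image u w = (\<Union>A\<in>\<A>. sub_image A w)"
      using union_exists[OF X fin \<A>] by blast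
    have "u \<in> Upper (Sub C X) \<A>" unfolding upper[OF u] using e by eventually_elim simp
    then have "s \<sqsubseteq>\<^bsub>Sub C X\<^esub> u" using j unfolding J by blast
    moreover have "s \<in> Upper (Sub C X) \<A>" using j unfolding J by blast
    ultimately show "\<forall>\<^sub>F w in F. sub_image s w = (\<Union>A\<in>\<A>. sub_image A w)"
      unfolding Sub_le_iff[OF s u] upper[OF s] using e by eventually_elim blast
  qed
qed

lemma join_semilattice_Sub: "X \<in> Ob C \<Longrightarrow> join_semilattice (Sub C X)"
  unfolding join_semilattice_def
proof (intro conjI partial_order_Sub allI impI, elim conjE)
  fix \<A> assume X: "X \<in> Ob C" and \<A>: "finite \<A>" "\<A> \<subseteq> carrier (Sub C X)"
  show "\<exists>s. is_join (Sub C X) \<A> s" using union_exists[OF X \<A>] is_join_iff[OF X \<A>] by metis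
qed

text \<open>
Every pullback of a member of \<open>A\<close> is injective with image the inverse image of \<open>A\<close>. So all these
pullbacks represent one subobject, and they exhaust its class because a pullback may be composed with an
isomorphism.
\<close>

lemma Sub_pullback:
  assumes f: "f \<in> hom a b" and A: "A \<in> carrier (Sub C b)"
  shows "Sub_pullback C f A \<in> carrier (Sub C a)"
    "\<forall>\<^sub>F w in F. sub_image (Sub_pullback C f A) w = (G f w)\<inverse> `` sub_image A w"
proof -
  let ?Q = "\<lambda>w. (G f w)\<inverse> `` sub_image A w"
  have key: "p \<in> monos_into C a \<and> (\<forall>\<^sub>F w in F. image p w = ?Q w)" if p: "p \<in> Sub_pullback C f A" for p
  proof -
    obtain m' q where m'A: "m' \<in> A" and pb: "is_pullback C f m' p q" using p unfolding Sub_pullback_def by blast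
    note m'm = sub_image_member[OF A m'A]
    note m' = monos_into_hom[OF m'm(1)]
    obtain t where p: "p \<in> hom t a" and q: "q \<in> hom t (Dom C m')"
      using pb homD[OF f] unfolding is_pullback_def by auto
    have i: "\<forall>\<^sub>F w in F. inj_rel (G m' w)" using m'm(1) mono_iff[OF m'] unfolding monos_into_def by simp
    have "\<forall>\<^sub>F w in F. inj_rel (G p w) \<and> image p w = ?Q w"
      using pullback_tab[OF pb, unfolded tab_def] i m'm(2) G_fun[OF f] G_fun[OF p] G_fun[OF q]
    proof eventually_elim
      case (elim w)
      have tab: "(G p w)\<inverse> O G q w = G f w O (G m' w)\<inverse>" using elim(1) unfolding tabulates_def by simp
      have dq: "\<exists>z. (x, z) \<in> G q w" if "(x, y) \<in> G p w" for x y
        using elim(5,6) that unfolding is_fun_def by blast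
      have svf: "y = z" if "(x, y) \<in> G f w" "(x, z) \<in> G f w" for x y z
        using elim(4) that unfolding is_fun_def single_valued_def by blast
      have im: "y = z" if "(y, x) \<in> G m' w" "(z, x) \<in> G m' w" for x y z
        using elim(2) that unfolding inj_rel_def single_valued_def by blast
      have "x = y" if xy: "(x, z) \<in> G p w" "(y, z) \<in> G p w" for x y z
      proof -
        obtain u v where uv: "(x, u) \<in> G q w" "(y, v) \<in> G q w" using dq xy by metis
        then have "(z, u) \<in> (G p w)\<inverse> O G q w" "(z, v) \<in> (G p w)\<inverse> O G q w" using xy by blast+
        then have "(z, u) \<in> G f w O (G m' w)\<inverse>" "(z, v) \<in> G f w O (G m' w)\<inverse>" unfolding tab .
        then obtain c d where "(z, c) \<in> G f w" "(u, c) \<in> G m' w" "(z, d) \<in> G f w" "(v, d) \<in> G m' w" by blast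
        then have "u = v" using svf im by metis
        then show ?thesis using elim(1) xy uv unfolding tabulates_def by blast
      qed
      then have inj: "inj_rel (G p w)" unfolding inj_rel_def single_valued_def by blast
      have "Range (G p w) = Domain ((G p w)\<inverse> O G q w)" using dq by blast
      also have "\<dots> = (G f w)\<inverse> `` Range (G m' w)" unfolding tab by blast
      finally show ?case using inj elim(3) unfolding image_def by simp
    qed
    then show ?thesis using mono_iff[OF p] monos_into_iff[OF p] by (simp add: eventually_conj_iff)
  qed
  have mA: "rep A \<in> A" and m: "rep A \<in> hom (Dom C (rep A)) b"
    using rep_in[OF A] monos_into_hom by auto
  obtain t p q where p: "p \<in> hom t a" and q: "q \<in> hom t (Dom C (rep A))"
    and tab: "tab p q (\<lambda>w. G f w O (G (rep A) w)\<inverse>)" using tab_exists[OF f m] .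
  have pS: "p \<in> Sub_pullback C f A"
    using tab_pullback[OF f m p q tab] mA unfolding Sub_pullback_def by blast
  have "p' \<in> Sub_pullback C f A" if p': "p' \<in> sub_class a p" for p'
  proof -
    have "(p', p) \<in> iso_over C a"
      using p' key[OF pS] same_image_sym unfolding iso_over_iff sub_class_def by blast
    then obtain h where h: "h \<in> hom (Dom C p') t" "is_iso C h" "p \<cdot> h = p'"
      using homD[OF p] unfolding iso_over_def by auto
    then obtain k where k: "k \<in> hom t (Dom C p')" "k \<cdot> h = Ident C (Dom C p')" "h \<cdot> k = Ident C t"
      using homD[OF h(1)] unfolding is_iso_def by auto
    have "tab (p \<cdot> h) (q \<cdot> h) (\<lambda>w. G f w O (G (rep A) w)\<inverse>)"
      by (rule tab_iso[OF tab p q k(1) h(1) k(2)])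
        (simp_all add: Cmp_assoc[OF k(1) h(1)] p q k(3) Ident_right[OF p] Ident_right[OF q]
          Cmp_assoc[OF k(1) h(1) p] Cmp_assoc[OF k(1) h(1) q])
    then have "is_pullback C f (rep A) p' (q \<cdot> h)"
      using tab_pullback[OF f m Cmp_in[OF h(1) p] Cmp_in[OF h(1) q]] h(3) by simp
    then show ?thesis using mA unfolding Sub_pullback_def by blast
  qed
  moreover have "p' \<in> sub_class a p" if p': "p' \<in> Sub_pullback C f A" for p'
  proof -
    have "same_image p p'" unfolding same_image_def
      using conjunct2[OF key[OF pS]] conjunct2[OF key[OF p']] by eventually_elim simp
    then show ?thesis using key[OF p'] unfolding sub_class_def by simp
  qed
  ultimately have eq: "Sub_pullback C f A = sub_class a p" by blast
  have pm: "p \<in> monos_into C a" using key[OF pS] by simp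
  then show "Sub_pullback C f A \<in> carrier (Sub C a)" unfolding eq carrier_Sub by blast
  show "\<forall>\<^sub>F w in F. sub_image (Sub_pullback C f A) w = ?Q w"
    unfolding eq using sub_image_sub_class[OF pm] conjunct2[OF key[OF pS]] by eventually_elim simp
qed

lemma join_hom_pullback:
  assumes f: "f \<in> hom a b"
  shows "join_hom (Sub C b) (Sub C a) (Sub_pullback C f)"
  unfolding join_hom_def
proof (intro conjI allI impI)
  show "Sub_pullback C f \<in> carrier (Sub C b) \<rightarrow> carrier (Sub C a)" using Sub_pullback(1)[OF f] by blast
  fix \<A> s assume a: "finite \<A> \<and> \<A> \<subseteq> carrier (Sub C b) \<and> is_join (Sub C b) \<A> s"
  then have fin: "finite \<A>" and \<A>: "\<A> \<subseteq> carrier (Sub C b)" and j: "is_join (Sub C b) \<A> s" by auto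
  have o: "a \<in> Ob C" "b \<in> Ob C" using hom_Ob[OF f] by auto
  have s: "s \<in> carrier (Sub C b)" using j unfolding is_join_def least_def by blast
  have im: "Sub_pullback C f ` \<A> \<subseteq> carrier (Sub C a)" using Sub_pullback(1)[OF f] \<A> by blast
  have "\<forall>\<^sub>F w in F. \<forall>A\<in>\<A>. sub_image (Sub_pullback C f A) w = (G f w)\<inverse> `` sub_image A w"
    using Sub_pullback(2)[OF f] \<A> by (intro eventually_ball_finite[OF fin]) blast
  then show "is_join (Sub C a) (Sub_pullback C f ` \<A>) (Sub_pullback C f s)"
    unfolding is_join_iff[OF o(1) finite_imageI[OF fin] im Sub_pullback(1)[OF f s]]
    using j[unfolded is_join_iff[OF o(2) fin \<A> s]] Sub_pullback(2)[OF f s]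
    by eventually_elim (simp add: Image_UN)
qed

theorem coherent: "coherent_category C"
  unfolding coherent_category_def
proof (intro conjI ballI allI impI)
  show "small_category C" by (rule is_small_category)
  show "has_finite_limits C" by (rule finite_limits)
  show "join_semilattice (Sub C X)" if "X \<in> Ob C" for X using join_semilattice_Sub that .
  show "is_effective_epi C p" if "is_effective_epi C g \<and> is_pullback C f g p q" for f g p q
    using effective_epi_pullback that by blast
  show "join_hom (Sub C (Cod C f)) (Sub C (Dom C f)) (Sub_pullback C f)" if "f \<in> Mor C" for f
    using join_hom_pullback that Mor_hom by blast
  show "\<exists>e m. is_effective_epi C e \<and> is_mono C m \<and> Cod C e = Dom C m \<and> m \<cdot> e = f"
    if f: "f \<in> Mor C" for f
  proof -
    obtain t e m where e: "e \<in> hom (Dom C f) t" and m: "m \<in> hom t (Cod C f)"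
      and mono: "is_mono C m" "m \<cdot> e = f" and surj: "\<forall>\<^sub>F w in F. image e w = S t w"
      and "\<forall>\<^sub>F w in F. image m w = image f w"
      by (rule factorization[OF f[unfolded Mor_hom]])
    have "is_effective_epi C e" using surj unfolding effective_epi_iff[OF e] .
    then show ?thesis using mono homD[OF e] homD[OF m] by (intro exI[of _ e] exI[of _ m]) simp
  qed
qed

theorem consistent:
  assumes "F \<noteq> bot"
  shows "consistent_category C"
proof -
  obtain t where t: "is_final C t" and st: "\<forall>\<^sub>F w in F. \<exists>x. S t w = {x}" using final_exists by blast
  have to: "t \<in> Ob C" using t unfolding is_final_def by blast
  obtain A where A: "A \<in> carrier (Sub C t)" "\<forall>\<^sub>F w in F. sub_image A w = {}"
    using union_exists[OF to, of "{}"] by auto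
  have "\<forall>\<^sub>F w in F. G (Ident C t) w = Id_on (S t w) \<and> S t w \<subseteq> S t w" using G_Ident[OF to] by simp
  then obtain B where B: "B \<in> carrier (Sub C t)" "\<forall>\<^sub>F w in F. sub_image B w = S t w"
    by (rule Sub_from_Rel[OF to Rel_G[OF Ident_in[OF to]]])
  have "A \<noteq> B"
  proof
    assume AB: "A = B"
    have "\<forall>\<^sub>F w in F. False" using A(2) B(2) st by eventually_elim (simp add: AB)
    then show False using assms by (simp add: trivial_limit_def)
  qed
  then show ?thesis unfolding consistent_category_def using coherent t A(1) B(1) by blast
qed

end

section \<open>Semantics\<close>

text \<open>
A model consists of a universe, over which the quantifiers range, and an interpretation of the relation
symbols on arbitrary integers. The universe may be empty. Free variables still need
values then, since derivations of sentences pass through open formulas; they are given arbitrary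
integers outside the universe, which is why \<open>assignment\<close> below puts no restriction on \<open>e\<close> in this case.
This is sound because the calculus derives an existential formula from an instance only under the
assumption \<open>Neg Emp\<close>.

The list \<open>bs\<close> in \<open>sat\<close> holds the values of the variables bound by the enclosing quantifiers.
\<close>

type_synonym 'r model = "int set \<times> ('r \<Rightarrow> int list \<Rightarrow> bool)"

primrec val :: "(int \<Rightarrow> int) \<Rightarrow> int list \<Rightarrow> var \<Rightarrow> int" where
  "val e bs (Free x) = e x"
| "val e bs (Bound i) = bs ! i"

primrec sat :: "'r model \<Rightarrow> (int \<Rightarrow> int) \<Rightarrow> int list \<Rightarrow> 'r fm \<Rightarrow> bool" where
  "sat M e bs (Rel R vs) = snd M R (map (val e bs) vs)"
| "sat M e bs (Eq u v) = (val e bs u = val e bs v)"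
| "sat M e bs (Neg \<phi>) = (\<not> sat M e bs \<phi>)"
| "sat M e bs (Or \<phi> \<psi>) = (sat M e bs \<phi> \<or> sat M e bs \<psi>)"
| "sat M e bs (ExB \<phi>) = (\<exists>d\<in>fst M. sat M e (d # bs) \<phi>)"

abbreviation holds :: "'r model \<Rightarrow> (int \<Rightarrow> int) \<Rightarrow> 'r fm \<Rightarrow> bool" where
  "holds M e \<phi> \<equiv> sat M e [] \<phi>"

definition assignment :: "'r model \<Rightarrow> (int \<Rightarrow> int) \<Rightarrow> bool" where
  "assignment M e \<longleftrightarrow> fst M = {} \<or> range e \<subseteq> fst M"

lemma sat_cong_fv: "(\<And>x. x \<in> fv \<phi> \<Longrightarrow> e x = e' x) \<Longrightarrow> sat M e bs \<phi> = sat M e' bs \<phi>"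
proof (induction \<phi> arbitrary: bs)
  case (Rel R vs)
  have "val e bs v = val e' bs v" if "v \<in> set vs" for v
  proof (cases v)
    case (Free x)
    then have "x \<in> fv (Rel R vs)" using that by force
    then show ?thesis using Rel[of x] Free by simp
  qed simp
  then have "map (val e bs) vs = map (val e' bs) vs" by simp
  then show ?case by (simp only: sat.simps)
next
  case (Eq u v)
  then show ?case by (cases u; cases v) auto
next
  case (Or \<phi> \<psi>)
  then show ?case by (metis UnCI fv.simps(4) sat.simps(4))
next
  case (Neg \<phi>) then show ?case by (metis fv.simps(3) sat.simps(3))
next
  case (ExB \<phi>) then show ?case by (metis fv.simps(5) sat.simps(5))
qed

lemma sat_cong_bound:
  "wff L k \<phi> \<Longrightarrow> (\<And>i. i < k \<Longrightarrow> bs ! i = bs' ! i) \<Longrightarrow> sat M e bs \<phi> = sat M e bs' \<phi>"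
proof (induction \<phi> arbitrary: bs bs' k)
  case (Rel R vs)
  have "val e bs v = val e bs' v" if "v \<in> set vs" for v
  proof -
    have "var_ok k v" using that Rel.prems(1) by simp
    then show ?thesis using Rel.prems(2) by (cases v) simp_all
  qed
  then have "map (val e bs) vs = map (val e bs') vs" by simp
  then show ?case by (simp only: sat.simps)
next
  case (Eq u v)
  then show ?case by (cases u; cases v) auto
next
  case (Neg \<phi>)
  then show ?case by (metis sat.simps(3) wff.simps(3))
next
  case (Or \<phi> \<psi>)
  then show ?case by (metis sat.simps(4) wff.simps(4))
next
  case (ExB \<phi>)
  have "sat M e (d # bs) \<phi> = sat M e (d # bs') \<phi>" for d
    using ExB.prems by (intro ExB.IH[of "Suc k"]) (auto simp: nth_Cons split: nat.split)
  then show ?case by simp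
qed

lemma sat_subst: "sat M e bs (subst \<sigma> \<phi>) = sat M (e \<circ> \<sigma>) bs \<phi>"
proof -
  have v: "val e bs \<circ> subst_var \<sigma> = val (e \<circ> \<sigma>) bs" for bs
  proof
    fix v show "(val e bs \<circ> subst_var \<sigma>) v = val (e \<circ> \<sigma>) bs v" by (cases v) auto
  qed
  show ?thesis using v by (induction \<phi> arbitrary: bs) (auto simp: fun_eq_iff o_def)
qed

lemma sat_bind: "sat M e bs (bind k X \<phi>) = sat M (e(X := bs ! k)) bs \<phi>"
proof -
  have v: "val e bs \<circ> bind_var k X = val (e(X := bs ! k)) bs" for bs k
  proof
    fix v show "(val e bs \<circ> bind_var k X) v = val (e(X := bs ! k)) bs v" by (cases v) auto
  qed
  show ?thesis
    using v by (induction \<phi> arbitrary: bs k) (auto simp: fun_eq_iff o_def)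
qed

lemma holds_ExV:
  assumes "\<phi> \<in> formulas L"
  shows "holds M e (ExV X \<phi>) \<longleftrightarrow> (\<exists>d\<in>fst M. holds M (e(X := d)) \<phi>)"
proof -
  have "sat M (e(X := d)) [d] \<phi> = holds M (e(X := d)) \<phi>" for d
    using assms by (intro sat_cong_bound[of L 0]) (auto simp: formulas_def)
  then show ?thesis by (simp add: ExV_def sat_bind)
qed

lemma holds_EqV [simp]: "holds M e (EqV X Y) \<longleftrightarrow> e X = e Y"
  by (simp add: EqV_def)

lemma fv_subst_var: "fv_var (subst_var \<sigma> v) = \<sigma> ` fv_var v"
  by (cases v) auto

lemma fv_subst: "fv (subst \<sigma> \<phi>) = \<sigma> ` fv \<phi>"
  by (induction \<phi>) (auto simp: fv_subst_var)

lemma wff_subst [simp]: "wff L k (subst \<sigma> \<phi>) = wff L k \<phi>"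
proof -
  have v: "var_ok k (subst_var \<sigma> v) = var_ok k v" for k v by (cases v) auto
  show ?thesis by (induction \<phi> arbitrary: k) (auto simp: v)
qed

lemma formulas_simps [simp]:
  "EqV X Y \<in> formulas L"
  "Neg \<phi> \<in> formulas L \<longleftrightarrow> \<phi> \<in> formulas L"
  "Or \<phi> \<psi> \<in> formulas L \<longleftrightarrow> \<phi> \<in> formulas L \<and> \<psi> \<in> formulas L"
  "And \<phi> \<psi> \<in> formulas L \<longleftrightarrow> \<phi> \<in> formulas L \<and> \<psi> \<in> formulas L"
  "Imp \<phi> \<psi> \<in> formulas L \<longleftrightarrow> \<phi> \<in> formulas L \<and> \<psi> \<in> formulas L"
  "subst \<sigma> \<phi> \<in> formulas L \<longleftrightarrow> \<phi> \<in> formulas L"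
  "\<phi>[Y//X] \<in> formulas L \<longleftrightarrow> \<phi> \<in> formulas L"
  by (auto simp: formulas_def EqV_def And_def Imp_def subst1_def)

lemma Emp_formula [simp]: "Emp \<in> formulas L"
  by (simp add: Emp_def wff_ExV)

lemma fv_Emp [simp]: "fv Emp = {}"
  by (simp add: Emp_def fv_ExV EqV_def)

lemma holds_Emp [simp]: "holds M e Emp \<longleftrightarrow> fst M = {}"
  using holds_ExV[of "EqV 0 0" "\<lambda>_. None" M e 0] by (auto simp: Emp_def)

definition entails :: "'r fm set \<Rightarrow> 'r fm \<Rightarrow> bool" where
  "entails \<Gamma> \<phi> \<longleftrightarrow> (\<forall>M e. assignment M e \<longrightarrow> (\<forall>\<gamma>\<in>\<Gamma>. holds M e \<gamma>) \<longrightarrow> holds M e \<phi>)"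

lemma holds_subst1: "holds M e (\<phi>[Y//X]) \<longleftrightarrow> holds M (e(X := e Y)) \<phi>"
proof -
  have "e \<circ> id(X := Y) = e(X := e Y)" by auto
  then show ?thesis by (simp add: subst1_def sat_subst)
qed

lemma holds_upd_fresh: "Y \<notin> fv \<phi> \<Longrightarrow> holds M (e(Y := d)) \<phi> = holds M e \<phi>"
  by (rule sat_cong_fv) auto

lemma holds_witness:
  assumes "Y \<notin> fv (ExV X \<phi>)"
  shows "holds M (e(Y := d)) (\<phi>[Y//X]) = holds M (e(X := d)) \<phi>"
  unfolding holds_subst1 using assms by (intro sat_cong_fv) (auto simp: fv_ExV)

lemma assignment_upd: "assignment M e \<Longrightarrow> d \<in> fst M \<Longrightarrow> assignment M (e(Y := d))"
  by (auto simp: assignment_def)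

theorem soundness: "derivable L \<Gamma> \<phi> \<Longrightarrow> entails \<Gamma> \<phi>"
proof (induction rule: derivable.induct)
  case (ex_left \<phi> Y X \<Gamma> \<psi>)
  have \<phi>: "\<phi> \<in> formulas L" using derivable_sequent[OF ex_left.hyps(1)] by simp
  show ?case unfolding entails_def
  proof (intro allI impI)
    fix M e assume e: "assignment M e" and h: "\<forall>\<gamma>\<in>insert (ExV X \<phi>) \<Gamma>. holds M e \<gamma>"
    then obtain d where d: "d \<in> fst M" "holds M (e(X := d)) \<phi>" using holds_ExV[OF \<phi>] by auto
    have "\<forall>\<gamma>\<in>\<Gamma>. holds M (e(Y := d)) \<gamma>" using h ex_left.hyps(2) by (auto simp: holds_upd_fresh)
    moreover have "holds M (e(Y := d)) (\<phi>[Y//X])"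
      using d ex_left.hyps(2) by (simp add: holds_witness)
    ultimately have "holds M (e(Y := d)) \<psi>"
      using ex_left.IH assignment_upd[OF e d(1)] unfolding entails_def by blast
    then show "holds M e \<psi>" using ex_left.hyps(3) by (simp add: holds_upd_fresh)
  qed
next
  case (ex_right \<Gamma> \<phi> Y X)
  have \<phi>: "\<phi> \<in> formulas L" using derivable_sequent[OF ex_right.hyps(1)] by simp
  show ?case unfolding entails_def
  proof (intro allI impI)
    fix M e assume e: "assignment M e" and h: "\<forall>\<gamma>\<in>insert (Neg Emp) \<Gamma>. holds M e \<gamma>"
    then have "e Y \<in> fst M" by (auto simp: assignment_def)
    moreover have "holds M (e(X := e Y)) \<phi>"
      using ex_right.IH e h unfolding entails_def holds_subst1 by blast
    ultimately show "holds M e (ExV X \<phi>)" using holds_ExV[OF \<phi>] by blast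
  qed
next
  case (ex_ex \<psi> Y X \<Gamma> \<phi> Y' X')
  have \<phi>: "\<phi> \<in> formulas L" and \<psi>: "\<psi> \<in> formulas L"
    using derivable_sequent[OF ex_ex.hyps(1)] by simp_all
  show ?case unfolding entails_def
  proof (intro allI impI)
    fix M e assume e: "assignment M e" and h: "\<forall>\<gamma>\<in>insert (ExV X \<psi>) \<Gamma>. holds M e \<gamma>"
    then obtain d where d: "d \<in> fst M" "holds M (e(X := d)) \<psi>" using holds_ExV[OF \<psi>] by auto
    let ?e = "e(Y := d)"
    have e': "assignment M ?e" by (rule assignment_upd[OF e d(1)])
    have "\<forall>\<gamma>\<in>\<Gamma>. holds M ?e \<gamma>" using h ex_ex.hyps(2) by (auto simp: holds_upd_fresh)
    moreover have "holds M ?e (\<psi>[Y//X])" using d ex_ex.hyps(2) by (simp add: holds_witness)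
    ultimately have "holds M ?e (\<phi>[Y'//X'])" using ex_ex.IH e' unfolding entails_def by blast
    moreover have "?e Y' \<in> fst M" using e' d by (auto simp: assignment_def)
    ultimately have "holds M ?e (ExV X' \<phi>)"
      using holds_ExV[OF \<phi>] by (metis holds_subst1)
    then show "holds M e (ExV X' \<phi>)" using ex_ex.hyps(3) by (simp add: holds_upd_fresh)
  qed
next
  case (eq_subst \<Gamma> \<phi> Y X Y')
  then show ?case unfolding entails_def holds_subst1 by (metis holds_EqV insert_iff)
next
  case (weaken \<Gamma> \<phi> \<Gamma>') then show ?case unfolding entails_def by blast
next
  case (by_cases \<psi> \<Gamma> \<phi>) then show ?case unfolding entails_def by (metis insert_iff sat.simps(3))
next
  case (contradiction \<phi> \<Gamma> \<psi>) then show ?case unfolding entails_def by (metis insert_iff sat.simps(3))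
next
  case (or_left \<phi> \<Gamma> \<chi> \<psi>) then show ?case unfolding entails_def by (metis insert_iff sat.simps(4))
qed (auto simp: entails_def)

section \<open>Completeness\<close>


lemma derivable_cut: "derivable L \<Gamma> \<psi> \<Longrightarrow> derivable L (insert \<psi> \<Gamma>) \<phi> \<Longrightarrow> derivable L \<Gamma> \<phi>"
proof (rule by_cases[of L \<psi>])
  assume a: "derivable L \<Gamma> \<psi>" and b: "derivable L (insert \<psi> \<Gamma>) \<phi>"
  let ?\<Gamma> = "insert (Neg \<phi>) (insert (Neg \<psi>) \<Gamma>)"
  have f: "finite ?\<Gamma>" "?\<Gamma> \<subseteq> formulas L"
    using derivable_sequent[OF a] derivable_sequent[OF b] by auto
  show "derivable L (insert (Neg \<psi>) \<Gamma>) \<phi>"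
  proof (rule contradiction)
    show "derivable L ?\<Gamma> \<psi>" by (rule weaken[OF a f]) auto
    show "derivable L ?\<Gamma> (Neg \<psi>)" by (rule assm[OF f]) auto
  qed
qed

lemma derivable_mono:
  assumes "derivable L0 \<Gamma> \<phi>" and "L0 \<subseteq>\<^sub>m L"
  shows "derivable L \<Gamma> \<phi>"
proof -
  have "wff L k \<phi>" if "wff L0 k \<phi>" for k \<phi>
    using that
  proof (induction \<phi> arbitrary: k)
    case (Rel R vs)
    then show ?case using assms(2) by (auto simp: map_le_def dom_def)
  qed auto
  then have f: "\<phi> \<in> formulas L" if "\<phi> \<in> formulas L0" for \<phi>
    using that by (simp add: formulas_def)
  from assms(1) show ?thesis
  proof induction
    case assm then show ?case using f by (intro derivable.assm) auto
  next
    case eq_refl then show ?case by (rule derivable.eq_refl)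
  next
    case (weaken \<Gamma> \<phi> \<Gamma>')
    then show ?case using f by (blast intro: derivable.weaken[OF weaken.IH])
  next
    case by_cases then show ?case by (blast intro: derivable.by_cases)
  next
    case contradiction then show ?case by (blast intro: derivable.contradiction)
  next
    case or_left then show ?case by (blast intro: derivable.or_left)
  next
    case or_right1 then show ?case using f by (blast intro: derivable.or_right1)
  next
    case or_right2 then show ?case using f by (blast intro: derivable.or_right2)
  next
    case ex_left then show ?case by (blast intro: derivable.ex_left)
  next
    case ex_right then show ?case by (blast intro: derivable.ex_right)
  next
    case ex_ex then show ?case by (blast intro: derivable.ex_ex)
  next
    case eq_subst then show ?case by (blast intro: derivable.eq_subst)
  qed
qed

lemma formula_ExB_D:
  fixes \<chi> :: "'r fm"
  assumes "ExB \<chi> \<in> formulas L"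
  obtains X \<psi> where "\<psi> \<in> formulas L" "ExB \<chi> = ExV X \<psi>"
proof -
  obtain X where "X \<notin> fv \<chi>"
    using ex_new_if_finite[OF infinite_UNIV_int finite_fv] by blast
  then show ?thesis using ExB_eq_ExV[OF assms] that by blast
qed

text \<open>
Decides one formula \<open>\<theta>\<close>, adding a witness if \<open>\<theta>\<close> is an accepted existential formula. A variable that is
fresh for the finite set \<open>\<Delta>\<close> serves as witness, by the left rule for \<open>\<exists>\<close>; this is possible also if the
universe is going to be empty, since then no existential formula is ever accepted.
\<close>

lemma henkin_step:
  fixes \<Delta> :: "'r fm set"
  assumes D: "finite \<Delta>" "\<Delta> \<subseteq> formulas L" "\<not> derivable L \<Delta> \<phi>"
    and \<phi>: "\<phi> \<in> formulas L" and \<theta>: "\<theta> \<in> formulas L"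
  shows "\<exists>\<Delta>'. finite \<Delta>' \<and> \<Delta>' \<subseteq> formulas L \<and> \<not> derivable L \<Delta>' \<phi> \<and> \<Delta> \<subseteq> \<Delta>' \<and>
     (\<theta> \<in> \<Delta>' \<or> Neg \<theta> \<in> \<Delta>') \<and>
     (\<forall>\<chi>. \<theta> = ExB \<chi> \<longrightarrow> \<theta> \<in> \<Delta>' \<longrightarrow>
        (\<exists>X Y \<psi>. \<psi> \<in> formulas L \<and> \<theta> = ExV X \<psi> \<and> \<psi>[Y//X] \<in> \<Delta>'))"
proof (cases "derivable L (insert \<theta> \<Delta>) \<phi>")
  case True
  then have n: "\<not> derivable L (insert (Neg \<theta>) \<Delta>) \<phi>" using D(3) derivable.by_cases by blast
  moreover have "\<theta> \<notin> insert (Neg \<theta>) \<Delta>"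
  proof
    assume "\<theta> \<in> insert (Neg \<theta>) \<Delta>"
    then have "derivable L (insert (Neg \<theta>) \<Delta>) \<theta>" using D \<theta> by (intro assm) auto
    moreover have "derivable L (insert \<theta> (insert (Neg \<theta>) \<Delta>)) \<phi>"
      using D \<theta> by (intro weaken[OF True]) auto
    ultimately show False using n derivable_cut by blast
  qed
  ultimately show ?thesis using D \<theta> by (intro exI[of _ "insert (Neg \<theta>) \<Delta>"]) auto
next
  case False
  show ?thesis
  proof (cases "\<exists>\<chi>. \<theta> = ExB \<chi>")
    case True
    then obtain X \<psi> where \<psi>: "\<psi> \<in> formulas L" "\<theta> = ExV X \<psi>" using formula_ExB_D \<theta> by metis
    have "finite (fv \<phi> \<union> (\<Union>\<chi>\<in>insert \<theta> \<Delta>. fv \<chi>))" using D by (auto simp: finite_fv)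
    then obtain Y where Y: "Y \<notin> fv \<phi> \<union> (\<Union>\<chi>\<in>insert \<theta> \<Delta>. fv \<chi>)"
      using ex_new_if_finite[OF infinite_UNIV_int] by blast
    let ?D = "insert (\<psi>[Y//X]) (insert \<theta> \<Delta>)"
    have "\<not> derivable L ?D \<phi>"
    proof
      assume "derivable L ?D \<phi>"
      then have "derivable L (insert (ExV X \<psi>) (insert \<theta> \<Delta>)) \<phi>"
        using Y \<psi> by (intro ex_left) auto
      then show False using False \<psi> by simp
    qed
    moreover have "\<exists>X' Y' \<psi>'. \<psi>' \<in> formulas L \<and> \<theta> = ExV X' \<psi>' \<and> \<psi>'[Y'//X'] \<in> ?D"
      using \<psi> by blast
    ultimately show ?thesis using D(1,2) \<psi>(1) \<theta>
      by (intro exI[of _ ?D] conjI allI impI) (assumption | simp | blast)+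
  next
    case F: False
    then show ?thesis using D False \<theta> by (intro exI[of _ "insert \<theta> \<Delta>"]) auto
  qed
qed

instance var :: countable by countable_datatype
instance fm :: (countable) countable by countable_datatype

text \<open>
The type of relation symbols need not be countable, so the enumeration of formulas exists only over a
finite signature; \<open>completeness\<close> restricts to the symbols that occur in the sequent.
\<close>

lemma countable_formulas:
  fixes L :: "'r signature"
  assumes "finite (dom L)"
  shows "countable (formulas L)"
proof -
  have s: "set_fm \<phi> \<subseteq> dom L" if "wff L k \<phi>" for k \<phi>
    using that
  proof (induction \<phi> arbitrary: k)
    case (Or \<phi> \<psi>)
    then show ?case using Or.IH[of k] by simp
  qed auto
  have "\<phi> = map_fm (from_nat_into (dom L)) (map_fm (to_nat_on (dom L)) \<phi>)"
    if "\<phi> \<in> formulas L" for \<phi>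
  proof -
    have "map_fm (from_nat_into (dom L) \<circ> to_nat_on (dom L)) \<phi> = map_fm id \<phi>"
      
    proof (rule fm.map_cong0)
      fix z assume "z \<in> set_fm \<phi>"
      then have "z \<in> dom L" using s[of 0 \<phi>] that by (auto simp only: formulas_def)
      then show "(from_nat_into (dom L) \<circ> to_nat_on (dom L)) z = id z"
        using from_nat_into_to_nat_on[OF countable_finite[OF assms]] by simp
    qed
    then show ?thesis by (simp add: fm.map_comp fm.map_id)
  qed
  then have "formulas L \<subseteq> range (map_fm (from_nat_into (dom L)))" by blast
  then show ?thesis by (rule countable_subset) simp
qed

lemma henkin_extension:
  fixes \<Gamma> :: "'r fm set"
  assumes D: "finite \<Gamma>" "\<Gamma> \<subseteq> formulas L" "\<not> derivable L \<Gamma> \<phi>"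
    and \<phi>: "\<phi> \<in> formulas L" and L: "finite (dom L)"
  obtains \<Delta> where "\<Gamma> \<subseteq> \<Delta>" "\<Delta> \<subseteq> formulas L"
    "\<And>\<Gamma>'. finite \<Gamma>' \<Longrightarrow> \<Gamma>' \<subseteq> \<Delta> \<Longrightarrow> \<not> derivable L \<Gamma>' \<phi>"
    "\<And>\<theta>. \<theta> \<in> formulas L \<Longrightarrow> \<theta> \<in> \<Delta> \<or> Neg \<theta> \<in> \<Delta>"
    "\<And>\<chi>. ExB \<chi> \<in> \<Delta> \<Longrightarrow> \<exists>X Y \<psi>. \<psi> \<in> formulas L \<and> ExB \<chi> = ExV X \<psi> \<and> \<psi>[Y//X] \<in> \<Delta>"
proof -
  define F where "F = from_nat_into (formulas L)"
  have F: "range F = formulas L"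
    unfolding F_def using countable_formulas[OF L] \<phi> by (intro range_from_nat_into) auto
  define good where "good D \<longleftrightarrow> finite D \<and> D \<subseteq> formulas L \<and> \<not> derivable L D \<phi>" for D
  define next_stage where "next_stage n D D' \<longleftrightarrow> D \<subseteq> D' \<and> (F n \<in> D' \<or> Neg (F n) \<in> D') \<and>
     (\<forall>\<chi>. F n = ExB \<chi> \<longrightarrow> F n \<in> D' \<longrightarrow>
        (\<exists>X Y \<psi>. \<psi> \<in> formulas L \<and> F n = ExV X \<psi> \<and> \<psi>[Y//X] \<in> D'))" for n :: nat and D D'
  have "\<exists>f. \<forall>n::nat. (good (f n) \<and> (n = 0 \<longrightarrow> f n = \<Gamma>)) \<and> next_stage n (f n) (f (Suc n))"
  proof (rule dependent_nat_choice)
    show "\<exists>x. good x \<and> (0 = 0 \<longrightarrow> x = \<Gamma>)" using D by (auto simp: good_def)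
  next
    fix D and n :: nat assume "good D \<and> (n = 0 \<longrightarrow> D = \<Gamma>)"
    then have "\<exists>D'. good D' \<and> next_stage n D D'"
      using henkin_step[of D L \<phi> "F n"] \<phi> F unfolding good_def next_stage_def by blast
    then show "\<exists>y. (good y \<and> (Suc n = 0 \<longrightarrow> y = \<Gamma>)) \<and> next_stage n D y" by auto
  qed
  then obtain f where f: "\<And>n. good (f n)" "f 0 = \<Gamma>" "\<And>n. next_stage n (f n) (f (Suc n))"
    by blast
  have "mono f" using f(3) by (auto simp: mono_iff_le_Suc next_stage_def)
  then have mono: "f m \<subseteq> f n" if "m \<le> n" for m n using that by (simp add: monoD)
  have dec: "F n \<in> f (Suc n) \<or> Neg (F n) \<in> f (Suc n)" for n
    using f(3)[of n] unfolding next_stage_def by blast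
  have con: "\<not> derivable L \<Gamma>' \<phi>" if "finite \<Gamma>'" "\<Gamma>' \<subseteq> (\<Union>n. f n)" for \<Gamma>'
  proof
    assume d: "derivable L \<Gamma>' \<phi>"
    have "\<exists>n. \<Gamma>' \<subseteq> f n" using that
    proof (induction \<Gamma>')
      case (insert x A)
      then obtain m n where "x \<in> f m" "A \<subseteq> f n" by auto
      then have "insert x A \<subseteq> f (max m n)" using mono[of m "max m n"] mono[of n "max m n"] by auto
      then show ?case by blast
    qed simp
    then obtain n where "\<Gamma>' \<subseteq> f n" by blast
    then show False using weaken[OF d, of "f n"] f(1)[of n] by (simp add: good_def)
  qed
  show ?thesis
  proof (rule that[of "\<Union>n. f n"])
    show "\<Gamma> \<subseteq> (\<Union>n. f n)" using f(2) by blast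
    show "(\<Union>n. f n) \<subseteq> formulas L" using f(1) unfolding good_def by blast
    show "\<not> derivable L \<Gamma>' \<phi>" if "finite \<Gamma>'" "\<Gamma>' \<subseteq> (\<Union>n. f n)" for \<Gamma>' using con that .
    show "\<theta> \<in> (\<Union>n. f n) \<or> Neg \<theta> \<in> (\<Union>n. f n)" if "\<theta> \<in> formulas L" for \<theta>
    proof -
      have "\<theta> \<in> range F" using F that by simp
      then obtain n where "\<theta> = F n" by (rule rangeE)
      moreover have "f (Suc n) \<subseteq> (\<Union>n. f n)" by blast
      ultimately show ?thesis using dec[of n] by (metis subsetD)
    qed
    show "\<exists>X Y \<psi>. \<psi> \<in> formulas L \<and> ExB \<chi> = ExV X \<psi> \<and> \<psi>[Y//X] \<in> (\<Union>n. f n)"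
      if e: "ExB \<chi> \<in> (\<Union>n. f n)" for \<chi>
    proof -
      obtain m where m: "ExB \<chi> \<in> f m" using e by blast
      then have l: "ExB \<chi> \<in> formulas L" using f(1)[of m] unfolding good_def by blast
      then obtain n where n: "F n = ExB \<chi>" using F by (metis imageE)
      have "ExB \<chi> \<in> f (Suc n)"
      proof (rule ccontr)
        assume "ExB \<chi> \<notin> f (Suc n)"
        then have "Neg (ExB \<chi>) \<in> f (Suc n)" using dec[of n] n by auto
        then have s: "{ExB \<chi>, Neg (ExB \<chi>)} \<subseteq> (\<Union>n. f n)" using m by blast
        have fl: "finite {Neg \<phi>, ExB \<chi>, Neg (ExB \<chi>)}" "{Neg \<phi>, ExB \<chi>, Neg (ExB \<chi>)} \<subseteq> formulas L"
          using \<phi> l by auto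
        have "derivable L {ExB \<chi>, Neg (ExB \<chi>)} \<phi>"
          by (rule contradiction[of L _ _ "ExB \<chi>"]; rule assm[OF fl]; simp)
        then show False using con[OF _ s] by simp
      qed
      then show ?thesis using f(3)[of n] n unfolding next_stage_def by auto
    qed
  qed
qed

text \<open>
The measure for the induction in the truth lemma: unlike the size, it ignores variables, and so it is
invariant under substitution.
\<close>

primrec depth :: "'r fm \<Rightarrow> nat" where
  "depth (Rel R vs) = 0"
| "depth (Eq u v) = 0"
| "depth (Neg \<phi>) = Suc (depth \<phi>)"
| "depth (Or \<phi> \<psi>) = Suc (depth \<phi> + depth \<psi>)"
| "depth (ExB \<phi>) = Suc (depth \<phi>)"

lemma depth_subst [simp]: "depth (subst \<sigma> \<phi>) = depth \<phi>"
  by (induction \<phi>) auto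

lemma depth_subst1 [simp]: "depth (\<phi>[Y//X]) = depth \<phi>"
  by (simp add: subst1_def)

lemma depth_bind [simp]: "depth (bind k X \<phi>) = depth \<phi>"
  by (induction \<phi> arbitrary: k) auto

text \<open>
The model is made of the variables modulo the equations in the maximal set \<open>\<Delta>\<close>, each class being represented
by one of its indices. Its universe is the set of all these classes or empty, according to which of \<open>Neg Emp\<close>
and \<open>Emp\<close> belongs to \<open>\<Delta>\<close>; in both cases \<open>rep\<close> is an admissible assignment.
\<close>

lemma henkin_model:
  fixes \<Gamma> :: "'r fm set"
  assumes D: "finite \<Gamma>" "\<Gamma> \<subseteq> formulas L" "\<not> derivable L \<Gamma> \<phi>"
    and \<phi>: "\<phi> \<in> formulas L" and L: "finite (dom L)"
  shows "\<not> entails \<Gamma> \<phi>"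
proof -
  obtain \<Delta> where \<Delta>: "\<Gamma> \<subseteq> \<Delta>" "\<Delta> \<subseteq> formulas L"
    and con: "\<And>\<Gamma>'. finite \<Gamma>' \<Longrightarrow> \<Gamma>' \<subseteq> \<Delta> \<Longrightarrow> \<not> derivable L \<Gamma>' \<phi>"
    and dec: "\<And>\<theta>. \<theta> \<in> formulas L \<Longrightarrow> \<theta> \<in> \<Delta> \<or> Neg \<theta> \<in> \<Delta>"
    and wit: "\<And>\<chi>. ExB \<chi> \<in> \<Delta> \<Longrightarrow> \<exists>X Y \<psi>. \<psi> \<in> formulas L \<and> ExB \<chi> = ExV X \<psi> \<and> \<psi>[Y//X] \<in> \<Delta>"
    using henkin_extension[OF assms] by metis
  have closed: "\<psi> \<in> \<Delta>" if d: "derivable L G \<psi>" and G: "G \<subseteq> \<Delta>" for G \<psi>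
  proof (rule ccontr)
    assume "\<psi> \<notin> \<Delta>"
    moreover have \<psi>: "\<psi> \<in> formulas L" and Gf: "finite G" "G \<subseteq> formulas L"
      using derivable_sequent[OF d] by auto
    ultimately have n: "insert (Neg \<psi>) G \<subseteq> \<Delta>" using dec G by blast
    have fl: "finite (insert (Neg \<phi>) (insert (Neg \<psi>) G))"
      "insert (Neg \<phi>) (insert (Neg \<psi>) G) \<subseteq> formulas L" using Gf \<psi> \<phi> by auto
    have "derivable L (insert (Neg \<psi>) G) \<phi>"
    proof (rule contradiction)
      show "derivable L (insert (Neg \<phi>) (insert (Neg \<psi>) G)) \<psi>" by (rule weaken[OF d fl]) auto
      show "derivable L (insert (Neg \<phi>) (insert (Neg \<psi>) G)) (Neg \<psi>)" by (rule assm[OF fl]) auto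
    qed
    then show False using con n Gf by blast
  qed
  have neg: "Neg \<psi> \<in> \<Delta> \<longleftrightarrow> \<psi> \<notin> \<Delta>" if \<psi>: "\<psi> \<in> formulas L" for \<psi>
  proof
    show "\<psi> \<notin> \<Delta>" if "Neg \<psi> \<in> \<Delta>"
    proof
      assume "\<psi> \<in> \<Delta>"
      have fl: "finite {Neg \<phi>, \<psi>, Neg \<psi>}" "{Neg \<phi>, \<psi>, Neg \<psi>} \<subseteq> formulas L" using \<phi> \<psi> by auto
      have "derivable L {\<psi>, Neg \<psi>} \<phi>"
        by (rule contradiction[of L _ _ \<psi>]; rule assm[OF fl]; simp)
      then show False using con[of "{\<psi>, Neg \<psi>}"] \<open>Neg \<psi> \<in> \<Delta>\<close> \<open>\<psi> \<in> \<Delta>\<close> by simp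
    qed
    show "Neg \<psi> \<in> \<Delta>" if "\<psi> \<notin> \<Delta>" using dec[OF \<psi>] that by blast
  qed
  have disj: "Or \<psi> \<chi> \<in> \<Delta> \<longleftrightarrow> \<psi> \<in> \<Delta> \<or> \<chi> \<in> \<Delta>" if f: "\<psi> \<in> formulas L" "\<chi> \<in> formulas L" for \<psi> \<chi>
  proof
    assume o: "Or \<psi> \<chi> \<in> \<Delta>"
    show "\<psi> \<in> \<Delta> \<or> \<chi> \<in> \<Delta>"
    proof (rule ccontr)
      assume "\<not> ?thesis"
      then have n: "Neg \<psi> \<in> \<Delta>" "Neg \<chi> \<in> \<Delta>" using neg f by auto
      have "derivable L (insert (Or \<psi> \<chi>) {Neg \<psi>, Neg \<chi>}) \<phi>"
      proof (rule or_left)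
        have fl: "finite {Neg \<phi>, \<psi>, Neg \<psi>, Neg \<chi>}" "{Neg \<phi>, \<psi>, Neg \<psi>, Neg \<chi>} \<subseteq> formulas L"
          using \<phi> f by auto
        show "derivable L {\<psi>, Neg \<psi>, Neg \<chi>} \<phi>"
          by (rule contradiction[of L _ _ \<psi>]; rule assm[OF fl]; simp)
        have fl: "finite {Neg \<phi>, \<chi>, Neg \<psi>, Neg \<chi>}" "{Neg \<phi>, \<chi>, Neg \<psi>, Neg \<chi>} \<subseteq> formulas L"
          using \<phi> f by auto
        show "derivable L {\<chi>, Neg \<psi>, Neg \<chi>} \<phi>"
          by (rule contradiction[of L _ _ \<chi>]; rule assm[OF fl]; simp)
      qed
      then show False using con[of "{Or \<psi> \<chi>, Neg \<psi>, Neg \<chi>}"] o n by simp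
    qed
  next
    have a: "derivable L {\<theta>} \<theta>" if "\<theta> \<in> formulas L" for \<theta> using that by (simp add: assm)
    assume "\<psi> \<in> \<Delta> \<or> \<chi> \<in> \<Delta>"
    then show "Or \<psi> \<chi> \<in> \<Delta>"
      using closed[OF or_right1[OF a[OF f(1)] f(2)]] closed[OF or_right2[OF a[OF f(2)] f(1)]] by blast
  qed
  have replace: "\<psi>[Y'//X] \<in> \<Delta>" if "\<psi>[Y//X] \<in> \<Delta>" "EqV Y Y' \<in> \<Delta>" for \<psi> :: "'r fm" and X Y Y'
  proof -
    have "derivable L {\<psi>[Y//X]} (\<psi>[Y//X])" using that \<Delta>(2) by (intro assm) auto
    from closed[OF eq_subst[OF this]] show ?thesis using that by blast
  qed
  have E1: "EqV x x \<in> \<Delta>" for x using closed[OF eq_refl] by blast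
  have E2: "EqV y x \<in> \<Delta>" if "EqV x y \<in> \<Delta>" for x y
  proof -
    \<comment> \<open>The occurrence of \<open>x\<close> to be replaced in \<open>x = x\<close> is marked by a fresh variable \<open>z\<close>.\<close>
    obtain z where z: "z \<notin> {x}" using ex_new_if_finite[OF infinite_UNIV_int, of "{x}"] by blast
    then show ?thesis using replace[of "EqV z x" x z y] that E1[of x]
      by (simp add: subst1_def EqV_def)
  qed
  have E3: "EqV x z \<in> \<Delta>" if "EqV x y \<in> \<Delta>" "EqV y z \<in> \<Delta>" for x y z
  proof -
    obtain w where w: "w \<notin> {x}" using ex_new_if_finite[OF infinite_UNIV_int, of "{x}"] by blast
    then show ?thesis using replace[of "EqV x w" y w z] that by (simp add: subst1_def EqV_def)
  qed
  define rep where "rep x = (SOME y. EqV x y \<in> \<Delta>)" for x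
  have rep: "EqV x (rep x) \<in> \<Delta>" for x unfolding rep_def using E1 by (rule someI)
  have rep_eq: "rep x = rep y \<longleftrightarrow> EqV x y \<in> \<Delta>" for x y
  proof
    assume "EqV x y \<in> \<Delta>"
    then have "EqV x z \<in> \<Delta> \<longleftrightarrow> EqV y z \<in> \<Delta>" for z using E2 E3 by metis
    then show "rep x = rep y" by (simp add: rep_def)
  next
    assume "rep x = rep y"
    then show "EqV x y \<in> \<Delta>" using rep[of x] rep[of y] E2 E3 by metis
  qed
  have rel: "Rel R (map Free (us @ vs)) \<in> \<Delta> \<longleftrightarrow> Rel R (map Free (map rep us @ vs)) \<in> \<Delta>" for R us vs
  proof (induction us arbitrary: vs rule: rev_induct)
    case (snoc u us)
    obtain z where z: "z \<notin> set us \<union> set vs"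
      using ex_new_if_finite[OF infinite_UNIV_int, of "set us \<union> set vs"] by blast
    \<comment> \<open>The position to be replaced is marked by a fresh variable \<open>z\<close>.\<close>
    have s: "(Rel R (map Free (us @ z # vs)))[y//z] = Rel R (map Free (us @ y # vs))" for y
      using z by (auto simp: subst1_def)
    have "Rel R (map Free (us @ u # vs)) \<in> \<Delta> \<longleftrightarrow> Rel R (map Free (us @ rep u # vs)) \<in> \<Delta>"
      using replace[of "Rel R (map Free (us @ z # vs))" u z "rep u"]
        replace[of "Rel R (map Free (us @ z # vs))" "rep u" z u] rep[of u] E2[OF rep[of u]]
      unfolding s by blast
    then show ?case using snoc.IH[of "rep u # vs"] by simp
  qed simp
  define U where "U = (if Neg Emp \<in> \<Delta> then range rep else {})"
  define I where "I R ds \<longleftrightarrow> Rel R (map Free ds) \<in> \<Delta>" for R ds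
  define M where "M = (U, I)"
  have M: "fst M = U" "snd M = I" by (simp_all add: M_def)
  have truth: "holds M rep \<theta> \<longleftrightarrow> \<theta> \<in> \<Delta>" if "\<theta> \<in> formulas L" for \<theta>
    using that
  proof (induction "depth \<theta>" arbitrary: \<theta> rule: less_induct)
    case less
    show ?case
    proof (cases \<theta>)
      case (Rel R vs)
      have "\<exists>us. vs = map Free us"
      proof (rule ex_map_conv[THEN iffD2], rule ballI)
        fix v assume "v \<in> set vs"
        then have "var_ok 0 v" using less.prems Rel by (simp add: formulas_def)
        then show "\<exists>x. v = Free x" by (cases v) auto
      qed
      then obtain us where us: "vs = map Free us" by blast
      have "map (val rep [] \<circ> Free) us = map rep us" by simp
      then show ?thesis using rel[of R us "[]"] by (simp only: Rel us M I_def map_map sat.simps append_Nil2)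
    next
      case (Eq u v)
      then obtain x y where "u = Free x" "v = Free y"
        using less.prems by (cases u; cases v) (auto simp: formulas_def)
      then show ?thesis using Eq rep_eq[of x y] by (simp add: EqV_def)
    next
      case (Neg \<psi>)
      then show ?thesis using less neg[of \<psi>] by simp
    next
      case (Or \<psi> \<chi>)
      then show ?thesis using less.hyps[of \<psi>] less.hyps[of \<chi>] less.prems disj[of \<psi> \<chi>] by simp
    next
      case (ExB \<chi>)
      have inst: "holds M rep (\<psi>[Y//X]) \<longleftrightarrow> \<psi>[Y//X] \<in> \<Delta>"
        if "\<psi> \<in> formulas L" "\<theta> = ExV X \<psi>" for X Y and \<psi> :: "'r fm"
        using that less.hyps[of "\<psi>[Y//X]"] by (simp add: ExV_def)
      show ?thesis
      proof
        assume "\<theta> \<in> \<Delta>"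
        then obtain X Y and \<psi> :: "'r fm"
          where \<psi>: "\<psi> \<in> formulas L" "\<theta> = ExV X \<psi>" "\<psi>[Y//X] \<in> \<Delta>"
          using wit ExB by metis
        obtain Z where Z: "Z \<notin> fv (ExV X \<psi>)"
          using ex_new_if_finite[OF infinite_UNIV_int finite_fv] by blast
        \<comment> \<open>The rule \<open>ex_ex\<close> turns every existential formula into the nonemptiness of the universe.\<close>
        have "derivable L {ExV X \<psi>} (ExV 0 (EqV 0 0))"
        proof (rule ex_ex)
          show "Z \<notin> (\<Union>\<chi>\<in>{ExV X \<psi>}. fv \<chi>)" using Z by simp
          show "Z \<notin> fv (ExV 0 (EqV 0 0))" by (simp add: fv_ExV EqV_def)
          have "(EqV 0 0 :: 'r fm)[Z//0] = EqV Z Z" by (simp add: subst1_def EqV_def)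
          then show "derivable L {\<psi>[Z//X]} ((EqV 0 0)[Z//0])"
            using \<psi>(1) weaken[OF eq_refl, where \<Gamma>' = "{\<psi>[Z//X]}"] by simp
        qed
        then have "ExV 0 (EqV 0 0) \<in> \<Delta>" using closed \<open>\<theta> \<in> \<Delta>\<close> \<psi> by blast
        then have "Neg Emp \<in> \<Delta>" using neg[of Emp] neg[of "ExV 0 (EqV 0 0)"]
          by (simp add: Emp_def wff_ExV)
        moreover have "holds M (rep(X := rep Y)) \<psi>"
          using inst \<psi> by (metis holds_subst1)
        ultimately show "holds M rep \<theta>"
          unfolding \<psi>(2) holds_ExV[OF \<psi>(1)] M U_def by auto
      next
        assume h: "holds M rep \<theta>"
        obtain X \<psi> where \<psi>: "\<psi> \<in> formulas L" "\<theta> = ExV X \<psi>"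
          using formula_ExB_D less.prems ExB by metis
        obtain d where d: "d \<in> U" "holds M (rep(X := d)) \<psi>"
          using h unfolding \<psi>(2) holds_ExV[OF \<psi>(1)] M by blast
        then obtain Y where Y: "d = rep Y" "Neg Emp \<in> \<Delta>" unfolding U_def by (auto split: if_splits)
        have i: "\<psi>[Y//X] \<in> \<Delta>" using inst[OF \<psi>] d Y by (simp add: holds_subst1)
        have "derivable L {\<psi>[Y//X]} (\<psi>[Y//X])" using \<psi> by (intro assm) auto
        from closed[OF ex_right[OF this]] show "\<theta> \<in> \<Delta>" using i Y \<psi> by blast
      qed
    qed
  qed
  have "assignment M rep" by (auto simp: assignment_def M U_def)
  moreover have "\<forall>\<gamma>\<in>\<Gamma>. holds M rep \<gamma>" using truth \<Delta> by blast
  moreover have "\<phi> \<notin> \<Delta>"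
  proof
    assume "\<phi> \<in> \<Delta>"
    then show False using con[of "{\<phi>}"] assm[of "{\<phi>}" L \<phi>] \<phi> by auto
  qed
  ultimately show ?thesis using truth[OF \<phi>] unfolding entails_def by blast
qed

theorem completeness:
  assumes f: "finite \<Gamma>" "\<Gamma> \<subseteq> formulas L" "\<phi> \<in> formulas L" and e: "entails \<Gamma> \<phi>"
  shows "derivable L \<Gamma> \<phi>"
proof -
  define A where "A = (\<Union>\<psi>\<in>insert \<phi> \<Gamma>. set_fm \<psi>)"
  have "finite (set_fm \<psi>)" for \<psi> :: "'a fm" by (induction \<psi>) auto
  then have A: "finite A" unfolding A_def using f(1) by simp
  have "wff (L |` A) k \<psi>" if "wff L k \<psi>" "set_fm \<psi> \<subseteq> A" for k \<psi>
    using that by (induction \<psi> arbitrary: k) auto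
  then have F: "\<psi> \<in> formulas (L |` A)" if "\<psi> \<in> insert \<phi> \<Gamma>" for \<psi>
    using that f unfolding A_def formulas_def by blast
  have "derivable (L |` A) \<Gamma> \<phi>"
    using henkin_model[of \<Gamma> "L |` A" \<phi>] f(1) F A e by fastforce
  then show ?thesis by (rule derivable_mono) (simp add: map_le_def)
qed

corollary derivable_iff_entails:
  "derivable L \<Gamma> \<phi> \<longleftrightarrow> finite \<Gamma> \<and> \<Gamma> \<subseteq> formulas L \<and> \<phi> \<in> formulas L \<and> entails \<Gamma> \<phi>"
  using soundness completeness derivable_sequent by metis

section \<open>Theories as filters of models\<close>

text \<open>
A set of models is large if it contains all models of some finite subset of \<open>S\<close>. Truth on a large set is
then the same as provability, without an appeal to a compactness theorem for \<open>S\<close>.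
\<close>

definition Models :: "'r fm set \<Rightarrow> 'r model filter" where
  "Models S = (INF \<phi>\<in>S. principal {M. \<forall>e. holds M e \<phi>})"

lemma eventually_Models:
  "eventually P (Models S) \<longleftrightarrow>
     (\<exists>\<Gamma>\<subseteq>S. finite \<Gamma> \<and> (\<forall>M. (\<forall>\<gamma>\<in>\<Gamma>. \<forall>e. holds M e \<gamma>) \<longrightarrow> P M))"
proof -
  have "eventually P (INF \<phi>\<in>\<Gamma>. principal {M. \<forall>e. holds M e \<phi>}) \<longleftrightarrow>
      (\<forall>M. (\<forall>\<gamma>\<in>\<Gamma>. \<forall>e. holds M e \<gamma>) \<longrightarrow> P M)" if "finite \<Gamma>" for \<Gamma>
    unfolding INF_principal_finite[OF that] eventually_principal by auto
  then show ?thesis unfolding Models_def eventually_INF[of P _ S] by blast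
qed

lemma Models_insert:
  "eventually P (Models (S \<union> {\<phi>})) \<longleftrightarrow> eventually (\<lambda>M. (\<forall>e. holds M e \<phi>) \<longrightarrow> P M) (Models S)"
proof -
  have "Models (S \<union> {\<phi>}) = inf (Models S) (principal {M. \<forall>e. holds M e \<phi>})"
    unfolding Models_def by (simp add: inf_commute)
  then show ?thesis by (simp add: eventually_inf_principal)
qed

lemma holds_sentence: "fv \<phi> = {} \<Longrightarrow> holds M e \<phi> = holds M e' \<phi>"
  by (rule sat_cong_fv) simp

lemma assignment_exists: "\<exists>e. assignment M e"
proof (cases "fst M = {}")
  case False
  then obtain d where "d \<in> fst M" by blast
  then have "assignment M (\<lambda>_. d)" by (auto simp: assignment_def)
  then show ?thesis by blast
qed (auto simp: assignment_def)

lemma sentences_formulas: "\<phi> \<in> sentences L \<Longrightarrow> \<phi> \<in> formulas L \<and> fv \<phi> = {}"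
  by (simp add: sentences_def)

lemma derivable_from_theory_iff:
  assumes S: "S \<subseteq> sentences L" and f: "finite \<Delta>" "\<Delta> \<subseteq> formulas L" "\<phi> \<in> formulas L"
  shows "(\<exists>\<Gamma>. finite \<Gamma> \<and> \<Gamma> \<subseteq> S \<and> derivable L (\<Delta> \<union> \<Gamma>) \<phi>) \<longleftrightarrow>
    (\<forall>\<^sub>F M in Models S. \<forall>e. assignment M e \<longrightarrow> (\<forall>\<delta>\<in>\<Delta>. holds M e \<delta>) \<longrightarrow> holds M e \<phi>)"
proof -
  have "(finite \<Gamma> \<and> \<Gamma> \<subseteq> S \<and> derivable L (\<Delta> \<union> \<Gamma>) \<phi>) \<longleftrightarrow> (\<Gamma> \<subseteq> S \<and> finite \<Gamma> \<and>
    (\<forall>M. (\<forall>\<gamma>\<in>\<Gamma>. \<forall>e. holds M e \<gamma>) \<longrightarrow>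
      (\<forall>e. assignment M e \<longrightarrow> (\<forall>\<delta>\<in>\<Delta>. holds M e \<delta>) \<longrightarrow> holds M e \<phi>)))" for \<Gamma>
  proof (cases "finite \<Gamma> \<and> \<Gamma> \<subseteq> S")
    case True
    then have g: "\<Gamma> \<subseteq> formulas L" "\<And>\<gamma>. \<gamma> \<in> \<Gamma> \<Longrightarrow> fv \<gamma> = {}" using S sentences_formulas by blast+
    have "derivable L (\<Delta> \<union> \<Gamma>) \<phi> \<longleftrightarrow> entails (\<Delta> \<union> \<Gamma>) \<phi>"
      using derivable_iff_entails[of L "\<Delta> \<union> \<Gamma>"] True f g(1) by simp
    moreover have "(\<forall>\<gamma>\<in>\<Gamma>. holds M e \<gamma>) \<longleftrightarrow> (\<forall>\<gamma>\<in>\<Gamma>. \<forall>e. holds M e \<gamma>)" for M e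
      using holds_sentence g(2) by blast
    ultimately show ?thesis using True unfolding entails_def ball_Un by meson
  qed auto
  then show ?thesis unfolding eventually_Models by (simp only:)
qed

lemma prov_implies_iff:
  assumes "S \<subseteq> sentences L" "\<phi> \<in> formulas L" "\<phi>' \<in> formulas L"
  shows "prov_implies L S \<phi> \<phi>' \<longleftrightarrow>
    (\<forall>\<^sub>F M in Models S. \<forall>e. assignment M e \<longrightarrow> holds M e \<phi> \<longrightarrow> holds M e \<phi>')"
  unfolding prov_implies_def using derivable_from_theory_iff[OF assms(1), of "{\<phi>}" \<phi>'] assms by simp

lemma proves_iff:
  assumes "S \<subseteq> sentences L" "\<phi> \<in> sentences L"
  shows "proves L S \<phi> \<longleftrightarrow> (\<forall>\<^sub>F M in Models S. \<forall>e. holds M e \<phi>)"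
proof -
  have "holds M e \<phi> = holds M e' \<phi>" for M e e'
    using holds_sentence assms(2) sentences_formulas by blast
  then have "(\<forall>e. assignment M e \<longrightarrow> holds M e \<phi>) \<longleftrightarrow> (\<forall>e. holds M e \<phi>)" for M
    using assignment_exists[of M] by blast
  then show ?thesis unfolding proves_def
    using derivable_from_theory_iff[OF assms(1), of "{}" \<phi>] sentences_formulas[OF assms(2)] by simp
qed

lemma consistent_Models:
  assumes "S \<subseteq> sentences L" "consistent_theory L S"
  shows "Models S \<noteq> bot"
proof
  assume "Models S = bot"
  then have "proves L S Emp" "proves L S (Neg Emp)"
    using proves_iff[OF assms(1), of Emp] proves_iff[OF assms(1), of "Neg Emp"]
    by (simp_all add: sentences_def)
  then show False using assms(2) unfolding consistent_theory_def by fastforce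
qed

section \<open>Satisfaction of derived formulas\<close>

lemma holds_And [simp]: "holds M e (And \<phi> \<psi>) \<longleftrightarrow> holds M e \<phi> \<and> holds M e \<psi>"
  by (simp add: And_def)

lemma holds_Imp [simp]: "holds M e (Imp \<phi> \<psi>) \<longleftrightarrow> (holds M e \<phi> \<longrightarrow> holds M e \<psi>)"
  by (simp add: Imp_def)

lemma fv_simps [simp]:
  "fv (And \<phi> \<psi>) = fv \<phi> \<union> fv \<psi>" "fv (Imp \<phi> \<psi>) = fv \<phi> \<union> fv \<psi>" "fv (EqV X Y) = {X, Y}"
  by (auto simp: And_def Imp_def EqV_def)

lemma AllV_formula [simp]: "\<phi> \<in> formulas L \<Longrightarrow> AllV X \<phi> \<in> formulas L"
  by (simp add: AllV_def wff_ExV)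

lemma Alls_formula [simp]: "\<phi> \<in> formulas L \<Longrightarrow> Alls Xs \<phi> \<in> formulas L"
  unfolding Alls_def by (induction Xs) auto

lemma Exs_formula [simp]: "\<phi> \<in> formulas L \<Longrightarrow> Exs Xs \<phi> \<in> formulas L"
  unfolding Exs_def by (induction Xs) (auto simp: wff_ExV)

lemma fv_Alls [simp]: "fv (Alls Xs \<phi>) = fv \<phi> - set Xs"
  unfolding Alls_def by (induction Xs) (auto simp: AllV_def fv_ExV)

lemma fv_Exs [simp]: "fv (Exs Xs \<phi>) = fv \<phi> - set Xs"
  unfolding Exs_def by (induction Xs) (auto simp: fv_ExV)

lemma Alls_append: "Alls Xs (Alls Ys \<phi>) = Alls (Xs @ Ys) \<phi>"
  by (simp add: Alls_def)

lemma holds_Exs: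
  assumes f: "\<phi> \<in> formulas L"
  shows "holds M e (Exs Xs \<phi>) \<longleftrightarrow>
    (\<exists>e'. (\<forall>x. x \<notin> set Xs \<longrightarrow> e' x = e x) \<and> e' ` set Xs \<subseteq> fst M \<and> holds M e' \<phi>)"
proof (induction Xs arbitrary: e)
  case Nil
  have "(\<forall>x. e' x = e x) \<longleftrightarrow> e' = e" for e' by auto
  then show ?case by (simp add: Exs_def)
next
  case (Cons X Xs)
  have "Exs Xs \<phi> \<in> formulas L" using f by simp
  then have "holds M e (Exs (X # Xs) \<phi>) \<longleftrightarrow> (\<exists>d\<in>fst M. holds M (e(X := d)) (Exs Xs \<phi>))"
    using holds_ExV[of "Exs Xs \<phi>"] by (simp add: Exs_def)
  also have "\<dots> \<longleftrightarrow> (\<exists>e'. (\<forall>x. x \<notin> set (X # Xs) \<longrightarrow> e' x = e x) \<and> e' ` set (X # Xs) \<subseteq> fst M \<and> holds M e' \<phi>)"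
    (is "?l \<longleftrightarrow> ?r")
  proof
    assume ?l
    then obtain d e' where d: "d \<in> fst M" and e': "\<forall>x. x \<notin> set Xs \<longrightarrow> e' x = (e(X := d)) x"
      "e' ` set Xs \<subseteq> fst M" "holds M e' \<phi>" unfolding Cons by blast
    have "e' X \<in> fst M" using d e' by (cases "X \<in> set Xs") auto
    then show ?r using e' by (intro exI[of _ e']) auto
  next
    assume ?r
    then obtain e' where e': "\<forall>x. x \<notin> set (X # Xs) \<longrightarrow> e' x = e x"
      "e' ` set (X # Xs) \<subseteq> fst M" "holds M e' \<phi>" by blast
    then show ?l unfolding Cons by (intro bexI[of _ "e' X"] exI[of _ e']) auto
  qed
  finally show ?case .
qed

lemma Alls_Exs: "holds M e (Alls Xs \<phi>) \<longleftrightarrow> \<not> holds M e (Exs Xs (Neg \<phi>))" if "\<phi> \<in> formulas L"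
proof (induction Xs arbitrary: e)
  case (Cons X Xs)
  have "holds M e (Alls (X # Xs) \<phi>) \<longleftrightarrow> (\<forall>d\<in>fst M. holds M (e(X := d)) (Alls Xs \<phi>))"
  proof -
    have "Neg (Alls Xs \<phi>) \<in> formulas L" using that by simp
    moreover have "Alls (X # Xs) \<phi> = Neg (ExV X (Neg (Alls Xs \<phi>)))" by (simp add: Alls_def AllV_def)
    ultimately show ?thesis using holds_ExV[of "Neg (Alls Xs \<phi>)" L] by simp
  qed
  moreover have "holds M e (Exs (X # Xs) (Neg \<phi>)) \<longleftrightarrow> (\<exists>d\<in>fst M. holds M (e(X := d)) (Exs Xs (Neg \<phi>)))"
  proof -
    have "Exs Xs (Neg \<phi>) \<in> formulas L" using that by simp
    moreover have "Exs (X # Xs) (Neg \<phi>) = ExV X (Exs Xs (Neg \<phi>))" by (simp add: Exs_def)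
    ultimately show ?thesis using holds_ExV[of "Exs Xs (Neg \<phi>)" L] by simp
  qed
  ultimately show ?case unfolding Cons.IH by blast
qed (simp add: Alls_def Exs_def)

lemma valid_Alls:
  assumes "\<phi> \<in> formulas L"
  shows "(\<forall>e. holds M e (Alls Xs \<phi>)) \<longleftrightarrow> (\<forall>e. e ` set Xs \<subseteq> fst M \<longrightarrow> holds M e \<phi>)"
proof -
  have "Neg \<phi> \<in> formulas L" using assms by simp
  then show ?thesis unfolding Alls_Exs[OF assms] holds_Exs[OF \<open>Neg \<phi> \<in> formulas L\<close>] by auto
qed

lemma holds_Ands [simp]: "holds M e (Ands \<phi>s) \<longleftrightarrow> (\<forall>\<phi>\<in>set \<phi>s. holds M e \<phi>)"
  by (induction \<phi>s rule: Ands.induct) auto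

lemma fv_Ands [simp]: "fv (Ands \<phi>s) = (\<Union>\<phi>\<in>set \<phi>s. fv \<phi>)"
  by (induction \<phi>s rule: Ands.induct) auto

lemma Ands_formula [simp]: "Ands \<phi>s \<in> formulas L \<longleftrightarrow> set \<phi>s \<subseteq> formulas L"
  by (induction \<phi>s rule: Ands.induct) auto

lemma holds_Eqs: "length Xs = length Ys \<Longrightarrow> holds M e (Eqs Xs Ys) \<longleftrightarrow> map e Xs = map e Ys"
  unfolding Eqs_def holds_Ands by (induction Xs Ys rule: list_induct2) auto

lemma Eqs_formula [simp]: "Eqs Xs Ys \<in> formulas L"
  unfolding Eqs_def by auto

lemma fv_Eqs: "fv (Eqs Xs Ys) \<subseteq> set Xs \<union> set Ys"
  unfolding Eqs_def by (auto dest: set_zip_leftD set_zip_rightD)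

definition rename :: "int list \<Rightarrow> int list \<Rightarrow> int \<Rightarrow> int" where
  "rename Xs Ys x = (case map_of (zip Xs Ys) x of None \<Rightarrow> x | Some y \<Rightarrow> y)"

lemma substs_rename: "substs \<phi> Xs Ys = subst (rename Xs Ys) \<phi>"
  by (simp add: substs_def rename_def[abs_def])

lemma substs_formula [simp]: "substs \<phi> Xs Ys \<in> formulas L \<longleftrightarrow> \<phi> \<in> formulas L"
  by (simp add: substs_def)

lemma inst_formula [simp]: "inst \<phi> Xs \<in> formulas L \<longleftrightarrow> \<phi> \<in> formulas L"
  by (simp add: inst_def)

lemma rename_nth:
  assumes "distinct Xs" "length Xs = length Ys" "i < length Xs"
  shows "rename Xs Ys (Xs ! i) = Ys ! i"
  unfolding rename_def by (subst map_of_zip_nth) (use assms in auto)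

lemma rename_map: "distinct Xs \<Longrightarrow> length Xs = length Ys \<Longrightarrow> map (rename Xs Ys) Xs = Ys"
  by (intro nth_equalityI) (auto simp: rename_nth)

lemma rename_other: "x \<notin> set Xs \<Longrightarrow> rename Xs Ys x = x"
proof -
  assume "x \<notin> set Xs"
  then have "x \<notin> fst ` set (zip Xs Ys)" by (auto dest: set_zip_leftD)
  then show ?thesis by (simp add: rename_def map_of_eq_None_iff[THEN iffD2])
qed

lemma rename_image: "distinct Xs \<Longrightarrow> length Xs = length Ys \<Longrightarrow> rename Xs Ys ` set Xs = set Ys"
  using rename_map[of Xs Ys] by (metis set_map)

lemma fv_substs:
  assumes "distinct Xs" "length Xs = length Ys"
  shows "fv (substs \<phi> Xs Ys) \<subseteq> (fv \<phi> - set Xs) \<union> set Ys"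
proof
  fix y assume "y \<in> fv (substs \<phi> Xs Ys)"
  then obtain x where x: "x \<in> fv \<phi>" "y = rename Xs Ys x" by (auto simp: substs_rename fv_subst)
  show "y \<in> (fv \<phi> - set Xs) \<union> set Ys"
  proof (cases "x \<in> set Xs")
    case True then show ?thesis using x rename_image[OF assms] by blast
  next
    case False then show ?thesis using x rename_other by simp
  qed
qed

lemma holds_substs: "holds M e (substs \<phi> Xs Ys) \<longleftrightarrow> holds M (e \<circ> rename Xs Ys) \<phi>"
  by (simp add: substs_rename sat_subst)

lemma length_vars [simp]: "length (neg_vars n) = n" "length (pos_vars k n) = n"
  by (simp_all add: neg_vars_def pos_vars_def)

lemma nth_vars [simp]:
  "i < n \<Longrightarrow> neg_vars n ! i = - 1 - int i" "i < n \<Longrightarrow> pos_vars k n ! i = int k + int i + 1"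
  by (simp_all add: neg_vars_def pos_vars_def del: upt_Suc)

lemma set_vars: "set (neg_vars n) = {- int n..- 1}" "set (pos_vars k n) = {int k + 1..int k + int n}"
proof -
  have "x \<in> (\<lambda>i. - int i) ` {1..<Suc n}" if "- int n \<le> x" "x \<le> - 1" for x
    using that by (intro image_eqI[of _ _ "nat (- x)"]) auto
  then show "set (neg_vars n) = {- int n..- 1}" by (auto simp: neg_vars_def simp del: upt_Suc)
  have "x \<in> (\<lambda>i. int (k + i)) ` {1..<Suc n}" if "int k + 1 \<le> x" "x \<le> int k + int n" for x
    using that by (intro image_eqI[of _ _ "nat (x - int k)"]) auto
  then show "set (pos_vars k n) = {int k + 1..int k + int n}" by (auto simp: pos_vars_def simp del: upt_Suc)
qed

lemma distinct_vars [simp]: "distinct (neg_vars n)" "distinct (pos_vars k n)"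
  by (simp_all add: neg_vars_def pos_vars_def distinct_map inj_on_def)

section \<open>Interpretation of formulas by sets of tuples\<close>

definition tuples :: "int set \<Rightarrow> nat \<Rightarrow> int list set" where
  "tuples U n = {a. length a = n \<and> set a \<subseteq> U}"

text \<open>
Premorphisms have their source variables at negative and their target variables at positive indices, so a
pair of tuples is an assignment for them.
\<close>

definition env :: "int list \<Rightarrow> int list \<Rightarrow> int \<Rightarrow> int" where
  "env a b x = (if x < 0 then a ! nat (- x - 1) else b ! nat (x - 1))"

lemma map_env [simp]:
  "length a = n \<Longrightarrow> map (env a b) (neg_vars n) = a"
  "length b = m \<Longrightarrow> map (env a b) (pos_vars 0 m) = b"
  by (auto intro!: nth_equalityI simp: env_def)

lemma map_env_drop: "length b = k + m \<Longrightarrow> map (env a b) (pos_vars k m) = drop k b"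
  by (auto intro!: nth_equalityI simp: env_def nat_add_distrib nat_int_add)

abbreviation hom_vars :: "nat \<Rightarrow> nat \<Rightarrow> int set" where
  "hom_vars n m \<equiv> set (neg_vars n) \<union> set (pos_vars 0 m)"

lemma env_map:
  assumes "x \<in> hom_vars n m"
  shows "env (map e (neg_vars n)) (map e (pos_vars 0 m)) x = e x"
proof (cases "x < 0")
  case True
  then have "nat (- x - 1) < n" using assms by (auto simp: set_vars)
  then show ?thesis using True by (simp add: env_def)
next
  case False
  then have "nat (x - 1) < m" "x \<ge> 1" using assms by (auto simp: set_vars)
  then show ?thesis using False by (simp add: env_def)
qed

lemma holds_env:
  assumes "fv \<theta> \<subseteq> hom_vars n m" "map e (neg_vars n) = a" "map e (pos_vars 0 m) = b"
  shows "holds M e \<theta> \<longleftrightarrow> holds M (env a b) \<theta>"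
  using assms env_map[of _ n m e] by (intro sat_cong_fv) auto

lemma map_in_tuples: "map e Xs \<in> tuples U n \<longleftrightarrow> length Xs = n \<and> e ` set Xs \<subseteq> U"
  by (auto simp: tuples_def)

lemma all_env_iff:
  "(\<forall>e. e ` hom_vars n m \<subseteq> U \<longrightarrow> P (map e (neg_vars n)) (map e (pos_vars 0 m))) \<longleftrightarrow>
   (\<forall>a\<in>tuples U n. \<forall>b\<in>tuples U m. P a b)" (is "?l \<longleftrightarrow> ?r")
proof
  assume l: ?l
  show ?r
  proof (intro ballI)
    fix a b assume ab: "a \<in> tuples U n" "b \<in> tuples U m"
    then have e: "map (env a b) (neg_vars n) = a" "map (env a b) (pos_vars 0 m) = b"
      by (simp_all add: tuples_def)
    then have "env a b ` set (neg_vars n) \<subseteq> U" "env a b ` set (pos_vars 0 m) \<subseteq> U"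
      using ab map_in_tuples by metis+
    then show "P a b" using l e by (metis image_Un Un_least)
  qed
next
  assume ?r
  then show ?l by (simp add: map_in_tuples image_Un)
qed

definition ext :: "'r fm \<Rightarrow> 'r model \<Rightarrow> int list set" where
  "ext \<alpha> M = {a \<in> tuples (fst M) (nfv \<alpha>).
     holds M (\<lambda>x. the (map_of (zip (sorted_list_of_set (fv \<alpha>)) a) x)) \<alpha>}"

lemma holds_inst:
  assumes "length Xs = nfv \<alpha>" "e ` set Xs \<subseteq> fst M"
  shows "holds M e (inst \<alpha> Xs) \<longleftrightarrow> map e Xs \<in> ext \<alpha> M"
proof -
  let ?V = "sorted_list_of_set (fv \<alpha>)"
  have V: "set ?V = fv \<alpha>" "length ?V = nfv \<alpha>" by (simp_all add: finite_fv nfv_def)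
  have "(e \<circ> rename ?V Xs) x = the (map_of (zip ?V (map e Xs)) x)" if x: "x \<in> fv \<alpha>" for x
  proof -
    obtain y where "map_of (zip ?V Xs) x = Some y"
      using x V assms(1) map_of_zip_is_Some[of ?V Xs x] by auto
    then show ?thesis by (simp add: rename_def zip_map2 map_of_map)
  qed
  then have "holds M e (inst \<alpha> Xs) \<longleftrightarrow> holds M (\<lambda>x. the (map_of (zip ?V (map e Xs)) x)) \<alpha>"
    unfolding inst_def holds_substs by (rule sat_cong_fv)
  then show ?thesis using assms by (simp add: ext_def map_in_tuples)
qed

lemma fv_inst:
  assumes "length Xs = nfv \<alpha>"
  shows "fv (inst \<alpha> Xs) \<subseteq> set Xs"
  using fv_substs[of "sorted_list_of_set (fv \<alpha>)" Xs \<alpha>] assms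
  by (auto simp: inst_def finite_fv nfv_def)

definition gr :: "nat \<Rightarrow> nat \<Rightarrow> 'r fm \<Rightarrow> 'r model \<Rightarrow> (int list \<times> int list) set" where
  "gr n m \<theta> M = {(a, b). a \<in> tuples (fst M) n \<and> b \<in> tuples (fst M) m \<and> holds M (env a b) \<theta>}"

lemma gr_iff: "(a, b) \<in> gr n m \<theta> M \<longleftrightarrow>
    a \<in> tuples (fst M) n \<and> b \<in> tuples (fst M) m \<and> holds M (env a b) \<theta>"
  by (simp add: gr_def)

lemma ext_tuples: "ext \<alpha> M \<subseteq> tuples (fst M) (nfv \<alpha>)"
  by (auto simp: ext_def)

lemma holds_inst_env:
  assumes "a \<in> tuples (fst M) n" "b \<in> tuples (fst M) m"
  shows "nfv \<alpha> = n \<Longrightarrow> holds M (env a b) (inst \<alpha> (neg_vars n)) \<longleftrightarrow> a \<in> ext \<alpha> M"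
    "nfv \<beta> = m \<Longrightarrow> holds M (env a b) (inst \<beta> (pos_vars 0 m)) \<longleftrightarrow> b \<in> ext \<beta> M"
proof -
  have e: "map (env a b) (neg_vars n) = a" "map (env a b) (pos_vars 0 m) = b"
    using assms by (simp_all add: tuples_def)
  then have i: "env a b ` set (neg_vars n) \<subseteq> fst M" "env a b ` set (pos_vars 0 m) \<subseteq> fst M"
    using assms map_in_tuples by metis+
  show "nfv \<alpha> = n \<Longrightarrow> holds M (env a b) (inst \<alpha> (neg_vars n)) \<longleftrightarrow> a \<in> ext \<alpha> M"
    using holds_inst[OF _ i(1), of \<alpha>] e by simp
  show "nfv \<beta> = m \<Longrightarrow> holds M (env a b) (inst \<beta> (pos_vars 0 m)) \<longleftrightarrow> b \<in> ext \<beta> M"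
    using holds_inst[OF _ i(2), of \<beta>] e by simp
qed

section \<open>Definable relations\<close>

lemma map_comp_rename:
  "distinct Xs \<Longrightarrow> length Xs = length Ys \<Longrightarrow> map (e \<circ> rename Xs Ys) Xs = map e Ys"
  "set Xs \<inter> set Zs = {} \<Longrightarrow> map (e \<circ> rename Xs Ys) Zs = map e Zs"
proof -
  show "map (e \<circ> rename Xs Ys) Xs = map e Ys" if "distinct Xs" "length Xs = length Ys"
    using rename_map[OF that] by (metis map_map)
  show "map (e \<circ> rename Xs Ys) Zs = map e Zs" if "set Xs \<inter> set Zs = {}"
    using that by (intro map_cong refl) (metis IntI comp_apply empty_iff rename_other)
qed

lemma map_env_take: "m \<le> length b \<Longrightarrow> map (env a b) (pos_vars 0 m) = take m b"
  by (auto intro!: nth_equalityI simp: env_def)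

lemma vars_disjoint [simp]:
  "set (neg_vars n) \<inter> set (pos_vars k m) = {}" "set (pos_vars k m) \<inter> set (neg_vars n) = {}"
  "set (pos_vars 0 k) \<inter> set (pos_vars k m) = {}" "set (pos_vars k m) \<inter> set (pos_vars 0 k) = {}"
  by (auto simp: set_vars)

lemma map_off: "(\<And>x. x \<notin> set Ys \<Longrightarrow> e' x = e x) \<Longrightarrow> set Xs \<inter> set Ys = {} \<Longrightarrow> map e' Xs = map e Xs"
  by auto

text \<open>
This and the next two lemmas turn the three conditions on a premorphism into the three parts of \<open>is_fun\<close>,
model by model.
\<close>

lemma is_fun_premorphism_total:
  assumes \<theta>: "fv \<theta> \<subseteq> hom_vars n m" "\<theta> \<in> formulas L" and n: "nfv \<alpha> = n"
  shows "(\<forall>e. e ` set (neg_vars n) \<subseteq> fst M \<longrightarrow> holds M e (Imp (inst \<alpha> (neg_vars n)) (Exs (pos_vars 0 m) \<theta>)))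
    \<longleftrightarrow> ext \<alpha> M \<subseteq> Domain (gr n m \<theta> M)" (is "?l \<longleftrightarrow> ?r")
proof
  assume l: ?l
  show ?r
  proof
    fix a assume a: "a \<in> ext \<alpha> M"
    then have at: "a \<in> tuples (fst M) n" using ext_tuples n by blast
    then have ea: "map (env a []) (neg_vars n) = a" by (simp add: tuples_def)
    then have eU: "env a [] ` set (neg_vars n) \<subseteq> fst M" using at map_in_tuples by metis
    have "holds M (env a []) (inst \<alpha> (neg_vars n)) \<longleftrightarrow> map (env a []) (neg_vars n) \<in> ext \<alpha> M"
      by (rule holds_inst[OF _ eU]) (simp add: n)
    then have "holds M (env a []) (inst \<alpha> (neg_vars n))" unfolding ea using a by simp
    then have "holds M (env a []) (Exs (pos_vars 0 m) \<theta>)" using l eU by auto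
    then obtain e' where e': "\<forall>x. x \<notin> set (pos_vars 0 m) \<longrightarrow> e' x = env a [] x"
      "e' ` set (pos_vars 0 m) \<subseteq> fst M" "holds M e' \<theta>" unfolding holds_Exs[OF \<theta>(2)] by blast
    have "map e' (neg_vars n) = a" using map_off[of "pos_vars 0 m" e' "env a []" "neg_vars n"] e' ea by simp
    then have "(a, map e' (pos_vars 0 m)) \<in> gr n m \<theta> M"
      using e' at holds_env[OF \<theta>(1), of e'] by (simp add: gr_iff map_in_tuples)
    then show "a \<in> Domain (gr n m \<theta> M)" by blast
  qed
next
  assume r: ?r
  show ?l
  proof (intro allI impI)
    fix e assume e: "e ` set (neg_vars n) \<subseteq> fst M"
    have "holds M e (Exs (pos_vars 0 m) \<theta>)" if a: "map e (neg_vars n) \<in> ext \<alpha> M"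
    proof -
      obtain b where b: "(map e (neg_vars n), b) \<in> gr n m \<theta> M" using r a by blast
      let ?a = "map e (neg_vars n)"
      let ?e = "\<lambda>x. if x \<in> set (pos_vars 0 m) then env ?a b x else e x"
      have bt: "b \<in> tuples (fst M) m" using b by (simp add: gr_iff)
      have "map ?e (pos_vars 0 m) = map (env ?a b) (pos_vars 0 m)" by simp
      also have "\<dots> = b" using bt map_env(2)[of b m ?a] by (simp add: tuples_def)
      finally have eb: "map ?e (pos_vars 0 m) = b" .
      have ea: "map ?e (neg_vars n) = ?a" by (rule map_off[of "pos_vars 0 m"]) auto
      have "holds M ?e \<theta>" using holds_env[OF \<theta>(1) ea eb] b by (simp add: gr_iff)
      moreover have "?e ` set (pos_vars 0 m) \<subseteq> fst M" using bt eb map_in_tuples by metis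
      ultimately show ?thesis unfolding holds_Exs[OF \<theta>(2)] by (intro exI[of _ ?e]) simp
    qed
    then show "holds M e (Imp (inst \<alpha> (neg_vars n)) (Exs (pos_vars 0 m) \<theta>))"
      using holds_inst[OF _ e, of \<alpha>] n by simp
  qed
qed

lemma is_fun_premorphism_bounded:
  assumes \<theta>: "fv \<theta> \<subseteq> hom_vars n m" and n: "nfv \<alpha> = n" "nfv \<beta> = m"
  shows "(\<forall>e. e ` hom_vars n m \<subseteq> fst M \<longrightarrow>
      holds M e (Imp \<theta> (And (inst \<alpha> (neg_vars n)) (inst \<beta> (pos_vars 0 m)))))
    \<longleftrightarrow> gr n m \<theta> M \<subseteq> ext \<alpha> M \<times> ext \<beta> M" (is "?l \<longleftrightarrow> ?r")
proof -
  have "?l \<longleftrightarrow> (\<forall>e. e ` hom_vars n m \<subseteq> fst M \<longrightarrow>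
      holds M (env (map e (neg_vars n)) (map e (pos_vars 0 m))) \<theta> \<longrightarrow>
      map e (neg_vars n) \<in> ext \<alpha> M \<and> map e (pos_vars 0 m) \<in> ext \<beta> M)"
  proof (intro iff_allI imp_cong refl)
    fix e assume e: "e ` hom_vars n m \<subseteq> fst M"
    have "holds M e (inst \<alpha> (neg_vars n)) \<longleftrightarrow> map e (neg_vars n) \<in> ext \<alpha> M"
      "holds M e (inst \<beta> (pos_vars 0 m)) \<longleftrightarrow> map e (pos_vars 0 m) \<in> ext \<beta> M"
      using e n by (intro holds_inst; auto)+
    then show "holds M e (Imp \<theta> (And (inst \<alpha> (neg_vars n)) (inst \<beta> (pos_vars 0 m)))) \<longleftrightarrow>
        (holds M (env (map e (neg_vars n)) (map e (pos_vars 0 m))) \<theta> \<longrightarrow>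
        map e (neg_vars n) \<in> ext \<alpha> M \<and> map e (pos_vars 0 m) \<in> ext \<beta> M)"
      unfolding holds_Imp holds_And holds_env[OF \<theta> refl refl, of M e] by simp
  qed
  also have "\<dots> \<longleftrightarrow> (\<forall>a\<in>tuples (fst M) n. \<forall>b\<in>tuples (fst M) m.
      holds M (env a b) \<theta> \<longrightarrow> a \<in> ext \<alpha> M \<and> b \<in> ext \<beta> M)" by (rule all_env_iff)
  also have "\<dots> \<longleftrightarrow> ?r" by (auto simp: gr_def)
  finally show ?thesis .
qed

lemma is_fun_premorphism_single_valued:
  assumes \<theta>: "fv \<theta> \<subseteq> hom_vars n m"
  defines "ys \<equiv> pos_vars 0 m" and "ys' \<equiv> pos_vars m m"
  shows "(\<forall>e. e ` set (neg_vars n @ ys @ ys') \<subseteq> fst M \<longrightarrow>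
      holds M e (Imp (And \<theta> (substs \<theta> ys ys')) (Eqs ys ys')))
    \<longleftrightarrow> single_valued (gr n m \<theta> M)" (is "?l \<longleftrightarrow> ?r")
proof -
  have s: "holds M e (substs \<theta> ys ys') \<longleftrightarrow> holds M (env (map e (neg_vars n)) (map e ys')) \<theta>" for e
    unfolding holds_substs
    by (rule holds_env[OF \<theta>]) (simp_all add: ys_def ys'_def map_comp_rename del: map_map)
  have i: "holds M e (Imp (And \<theta> (substs \<theta> ys ys')) (Eqs ys ys')) \<longleftrightarrow>
     (holds M (env (map e (neg_vars n)) (map e ys)) \<theta> \<and> holds M (env (map e (neg_vars n)) (map e ys')) \<theta> \<longrightarrow>
      map e ys = map e ys')" for e
    using s[of e] holds_env[OF \<theta> refl refl, of M e] holds_Eqs[of ys ys' M e] by (simp add: ys_def ys'_def)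
  show ?thesis unfolding i
  proof
    assume l: "\<forall>e. e ` set (neg_vars n @ ys @ ys') \<subseteq> fst M \<longrightarrow>
     (holds M (env (map e (neg_vars n)) (map e ys)) \<theta> \<and> holds M (env (map e (neg_vars n)) (map e ys')) \<theta> \<longrightarrow>
      map e ys = map e ys')"
    have "b = b'" if ab: "(a, b) \<in> gr n m \<theta> M" "(a, b') \<in> gr n m \<theta> M" for a b b'
    proof -
      have t: "a \<in> tuples (fst M) n" "b \<in> tuples (fst M) m" "b' \<in> tuples (fst M) m"
        using ab by (simp_all add: gr_iff)
      \<comment> \<open>The primed target variables follow the unprimed ones.\<close>
      let ?e = "env a (b @ b')"
      have e: "map ?e (neg_vars n) = a" "map ?e ys = b" "map ?e ys' = b'"
        using t by (simp_all add: tuples_def ys_def ys'_def map_env_take map_env_drop)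
      have "?e ` set (neg_vars n) \<subseteq> fst M" "?e ` set ys \<subseteq> fst M" "?e ` set ys' \<subseteq> fst M"
        using t e map_in_tuples by metis+
      then show ?thesis using l[rule_format, of ?e] e ab by (simp add: image_Un gr_iff)
    qed
    then show ?r by (simp add: single_valued_def)
  next
    assume r: ?r
    show "\<forall>e. e ` set (neg_vars n @ ys @ ys') \<subseteq> fst M \<longrightarrow>
     (holds M (env (map e (neg_vars n)) (map e ys)) \<theta> \<and> holds M (env (map e (neg_vars n)) (map e ys')) \<theta> \<longrightarrow>
      map e ys = map e ys')"
    proof (intro allI impI)
      fix e assume e: "e ` set (neg_vars n @ ys @ ys') \<subseteq> fst M"
        and h: "holds M (env (map e (neg_vars n)) (map e ys)) \<theta> \<and> holds M (env (map e (neg_vars n)) (map e ys')) \<theta>"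
      then have "(map e (neg_vars n), map e ys) \<in> gr n m \<theta> M" "(map e (neg_vars n), map e ys') \<in> gr n m \<theta> M"
        by (auto simp: gr_iff map_in_tuples image_Un ys_def ys'_def)
      then show "map e ys = map e ys'" using r by (rule single_valuedD[rotated])
    qed
  qed
qed

lemma premorphism_iff:
  assumes T: "T \<subseteq> sentences L" and f: "\<alpha> \<in> formulas L" "\<beta> \<in> formulas L"
  shows "premorphism L T \<alpha> \<beta> \<theta> \<longleftrightarrow> \<theta> \<in> formulas L \<and> fv \<theta> \<subseteq> hom_vars (nfv \<alpha>) (nfv \<beta>) \<and>
    (\<forall>\<^sub>F M in Models T. is_fun (ext \<alpha> M) (ext \<beta> M) (gr (nfv \<alpha>) (nfv \<beta>) \<theta> M))"
proof (cases "\<theta> \<in> formulas L \<and> fv \<theta> \<subseteq> hom_vars (nfv \<alpha>) (nfv \<beta>)")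
  case True
  define n m where "n = nfv \<alpha>" and "m = nfv \<beta>"
  define xs ys ys' where "xs = neg_vars n" and "ys = pos_vars 0 m" and "ys' = pos_vars m m"
  have \<theta>: "\<theta> \<in> formulas L" "fv \<theta> \<subseteq> hom_vars n m" using True by (simp_all add: n_def m_def)
  define \<phi>1 where "\<phi>1 = Imp \<theta> (And (inst \<alpha> xs) (inst \<beta> ys))"
  define \<phi>2 where "\<phi>2 = Imp (inst \<alpha> xs) (Exs ys \<theta>)"
  define \<phi>3 where "\<phi>3 = Imp (And \<theta> (substs \<theta> ys ys')) (Eqs ys ys')"
  have len: "length xs = nfv \<alpha>" "length ys = nfv \<beta>" by (simp_all add: xs_def ys_def n_def m_def)
  have fi: "fv (inst \<alpha> xs) \<subseteq> set xs" "fv (inst \<beta> ys) \<subseteq> set ys" using fv_inst len by auto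
  have fs: "fv (substs \<theta> ys ys') \<subseteq> fv \<theta> \<union> set ys'"
    using fv_substs[of ys ys' \<theta>] by (auto simp: ys_def ys'_def)
  have \<phi>: "\<phi>1 \<in> formulas L" "\<phi>2 \<in> formulas L" "\<phi>3 \<in> formulas L"
    using \<theta> f by (simp_all add: \<phi>1_def \<phi>2_def \<phi>3_def)
  have s: "Alls (xs @ ys) \<phi>1 \<in> sentences L" "Alls xs \<phi>2 \<in> sentences L" "Alls (xs @ ys @ ys') \<phi>3 \<in> sentences L"
    using \<phi> fi fs \<theta>(2) fv_Eqs[of ys ys']
    by (auto simp: sentences_def \<phi>1_def \<phi>2_def \<phi>3_def xs_def ys_def)
  have "premorphism L T \<alpha> \<beta> \<theta> \<longleftrightarrow> proves L T (Alls (xs @ ys) \<phi>1) \<and> proves L T (Alls xs \<phi>2) \<and>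
     proves L T (Alls (xs @ ys @ ys') \<phi>3)"
    unfolding premorphism_def Let_def Alls_append n_def[symmetric] m_def[symmetric] xs_def[symmetric]
      ys_def[symmetric] ys'_def[symmetric] \<phi>1_def[symmetric] \<phi>2_def[symmetric] \<phi>3_def[symmetric]
    using \<theta> by (simp add: xs_def ys_def)
  also have "\<dots> \<longleftrightarrow> (\<forall>\<^sub>F M in Models T. (\<forall>e. holds M e (Alls (xs @ ys) \<phi>1)) \<and>
      (\<forall>e. holds M e (Alls xs \<phi>2)) \<and> (\<forall>e. holds M e (Alls (xs @ ys @ ys') \<phi>3)))"
    by (simp only: proves_iff[OF T s(1)] proves_iff[OF T s(2)] proves_iff[OF T s(3)] eventually_conj_iff)
  also have "\<dots> \<longleftrightarrow> (\<forall>\<^sub>F M in Models T. gr n m \<theta> M \<subseteq> ext \<alpha> M \<times> ext \<beta> M \<and>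
      ext \<alpha> M \<subseteq> Domain (gr n m \<theta> M) \<and> single_valued (gr n m \<theta> M))"
    unfolding valid_Alls[OF \<phi>(1)] valid_Alls[OF \<phi>(2)] valid_Alls[OF \<phi>(3)]
    unfolding \<phi>1_def \<phi>2_def \<phi>3_def xs_def ys_def ys'_def
      is_fun_premorphism_total[OF \<theta>(2,1) n_def[symmetric]]
      is_fun_premorphism_single_valued[OF \<theta>(2), unfolded set_append] set_append
      is_fun_premorphism_bounded[OF \<theta>(2) n_def[symmetric] m_def[symmetric]] ..
  finally show ?thesis using True unfolding is_fun_def n_def m_def by simp
qed (auto simp: premorphism_def Let_def)

lemma gr_And: "gr n m (And \<theta> \<theta>') M = gr n m \<theta> M \<inter> gr n m \<theta>' M"
  by (auto simp: gr_def)

lemma gr_Or: "gr n m (Or \<theta> \<theta>') M = gr n m \<theta> M \<union> gr n m \<theta>' M"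
  by (auto simp: gr_def)

lemma gr_inst:
  "nfv \<alpha> = n \<Longrightarrow> gr n m (inst \<alpha> (neg_vars n)) M = ext \<alpha> M \<times> tuples (fst M) m"
  "nfv \<beta> = m \<Longrightarrow> gr n m (inst \<beta> (pos_vars 0 m)) M = tuples (fst M) n \<times> ext \<beta> M"
  using holds_inst_env ext_tuples unfolding gr_def by blast+

lemma map_uminus_vars: "map uminus (neg_vars n) = pos_vars 0 n" "map uminus (pos_vars 0 n) = neg_vars n"
  by (auto intro!: nth_equalityI)

lemma gr_converse:
  assumes "fv \<theta> \<subseteq> hom_vars n m"
  shows "gr m n (subst uminus \<theta>) M = (gr n m \<theta> M)\<inverse>"
proof -
  have "holds M (env b a) (subst uminus \<theta>) \<longleftrightarrow> holds M (env a b) \<theta>"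
    if "length a = n" "length b = m" for a b
    unfolding sat_subst
    by (rule holds_env[OF assms]) (use that in \<open>simp_all add: map_uminus_vars flip: map_map\<close>)
  then show ?thesis by (auto simp: gr_def tuples_def)
qed

lemma gr_comp:
  assumes n: "nfv \<beta> = k" "nfv \<gamma> = m" and \<theta>: "\<theta>1 \<in> formulas L" "\<theta>2 \<in> formulas L"
    and fv: "fv \<theta>1 \<subseteq> hom_vars n k" "fv \<theta>2 \<subseteq> hom_vars k m"
  shows "gr n m (premor_comp \<beta> \<gamma> \<theta>1 \<theta>2) M = gr n k \<theta>1 M O gr k m \<theta>2 M"
proof -
  let ?ts = "pos_vars m k"
  let ?\<psi> = "And (substs \<theta>1 (pos_vars 0 k) ?ts) (substs \<theta>2 (neg_vars k) ?ts)"
  have \<psi>: "?\<psi> \<in> formulas L" using \<theta> by simp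
  have c: "premor_comp \<beta> \<gamma> \<theta>1 \<theta>2 = Exs ?ts ?\<psi>" by (simp add: premor_comp_def n Let_def)
  have s: "holds M e ?\<psi> \<longleftrightarrow> holds M (env (map e (neg_vars n)) (map e ?ts)) \<theta>1 \<and>
      holds M (env (map e ?ts) (map e (pos_vars 0 m))) \<theta>2" for e
    unfolding holds_And holds_substs
    by (intro arg_cong2[where f = "(\<and>)"] holds_env[OF fv(1)] holds_env[OF fv(2)])
      (simp_all add: map_comp_rename del: map_map)
  have "(a, c) \<in> gr n m (premor_comp \<beta> \<gamma> \<theta>1 \<theta>2) M \<longleftrightarrow> (a, c) \<in> gr n k \<theta>1 M O gr k m \<theta>2 M" for a c
  proof
    assume g: "(a, c) \<in> gr n m (premor_comp \<beta> \<gamma> \<theta>1 \<theta>2) M"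
    then have t: "a \<in> tuples (fst M) n" "c \<in> tuples (fst M) m" by (simp_all add: gr_iff)
    obtain e' where e': "\<forall>x. x \<notin> set ?ts \<longrightarrow> e' x = env a c x" "e' ` set ?ts \<subseteq> fst M" "holds M e' ?\<psi>"
      using g unfolding gr_iff c holds_Exs[OF \<psi>] by blast
    have "map (env a c) (neg_vars n) = a" "map (env a c) (pos_vars 0 m) = c"
      using t by (simp_all add: tuples_def)
    moreover have "map e' (neg_vars n) = map (env a c) (neg_vars n)"
        "map e' (pos_vars 0 m) = map (env a c) (pos_vars 0 m)"
      by (rule map_off[of ?ts]; use e'(1) in simp)+
    ultimately have "map e' (neg_vars n) = a" "map e' (pos_vars 0 m) = c" by metis+
    then have "(a, map e' ?ts) \<in> gr n k \<theta>1 M" "(map e' ?ts, c) \<in> gr k m \<theta>2 M"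
      using e' t s[of e'] by (simp_all add: gr_iff map_in_tuples)
    then show "(a, c) \<in> gr n k \<theta>1 M O gr k m \<theta>2 M" by blast
  next
    assume "(a, c) \<in> gr n k \<theta>1 M O gr k m \<theta>2 M"
    then obtain b where b: "(a, b) \<in> gr n k \<theta>1 M" "(b, c) \<in> gr k m \<theta>2 M" by blast
    then have t: "a \<in> tuples (fst M) n" "b \<in> tuples (fst M) k" "c \<in> tuples (fst M) m"
      by (simp_all add: gr_iff)
    \<comment> \<open>The bound variables of the composite follow its \<open>m\<close> target variables, hence the list \<open>c @ b\<close>.\<close>
    define e where "e x = (if x \<in> set ?ts then env a (c @ b) x else env a c x)" for x
    have "map (env a c) (neg_vars n) = a" "map (env a c) (pos_vars 0 m) = c" "map (env a (c @ b)) ?ts = b"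
      using t by (simp_all add: tuples_def map_env_drop)
    moreover have "map e (neg_vars n) = map (env a c) (neg_vars n)"
        "map e (pos_vars 0 m) = map (env a c) (pos_vars 0 m)"
      by (rule map_off[of ?ts]; simp add: e_def)+
    moreover have "map e ?ts = map (env a (c @ b)) ?ts" by (simp add: e_def)
    ultimately have e: "map e (neg_vars n) = a" "map e (pos_vars 0 m) = c" "map e ?ts = b"
      by metis+
    then have "holds M e ?\<psi>" using s[of e] b by (simp add: gr_iff)
    moreover have "e ` set ?ts \<subseteq> fst M" using e(3) t(2) map_in_tuples by metis
    ultimately have "holds M (env a c) (Exs ?ts ?\<psi>)"
      unfolding holds_Exs[OF \<psi>] by (intro exI[of _ e]) (simp add: e_def)
    then show "(a, c) \<in> gr n m (premor_comp \<beta> \<gamma> \<theta>1 \<theta>2) M" unfolding gr_iff c using t by simp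
  qed
  then show ?thesis by (simp only: set_eq_iff split_paired_All) simp
qed

lemma premor_comp_formula: "\<theta>1 \<in> formulas L \<Longrightarrow> \<theta>2 \<in> formulas L \<Longrightarrow> premor_comp \<beta> \<gamma> \<theta>1 \<theta>2 \<in> formulas L"
  by (simp add: premor_comp_def Let_def)

lemma fv_premor_comp:
  assumes "fv \<theta>1 \<subseteq> hom_vars n (nfv \<beta>)" "fv \<theta>2 \<subseteq> hom_vars (nfv \<beta>) (nfv \<gamma>)"
  shows "fv (premor_comp \<beta> \<gamma> \<theta>1 \<theta>2) \<subseteq> hom_vars n (nfv \<gamma>)"
proof -
  let ?k = "nfv \<beta>" and ?ts = "pos_vars (nfv \<gamma>) (nfv \<beta>)"
  have "fv (substs \<theta>1 (pos_vars 0 ?k) ?ts) \<subseteq> fv \<theta>1 - set (pos_vars 0 ?k) \<union> set ?ts"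
    "fv (substs \<theta>2 (neg_vars ?k) ?ts) \<subseteq> fv \<theta>2 - set (neg_vars ?k) \<union> set ?ts"
    by (rule fv_substs; simp)+
  then show ?thesis using assms unfolding premor_comp_def Let_def by auto
qed

lemma tuples_empty: "tuples {} (Suc n) = {}"
  by (auto simp: tuples_def)

text \<open>
Two premorphisms are compared only over models with nonempty universe. Nothing is lost, since over
the empty universe there are no tuples of positive length, so both graphs are empty.
\<close>

lemma prov_equiv_iff:
  assumes T: "T \<subseteq> sentences L" and \<theta>: "\<theta> \<in> formulas L" "\<theta>' \<in> formulas L"
    and fv: "fv \<theta> \<subseteq> hom_vars n m" "fv \<theta>' \<subseteq> hom_vars n m" and m: "m > 0"
  shows "prov_equiv L (T \<union> {Neg Emp}) \<theta> \<theta>' \<longleftrightarrow> (\<forall>\<^sub>F M in Models T. gr n m \<theta> M = gr n m \<theta>' M)"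
proof -
  have T': "T \<union> {Neg Emp} \<subseteq> sentences L" using T by (simp add: sentences_def)
  have "((\<forall>e. holds M e (Neg Emp)) \<longrightarrow> (\<forall>e. assignment M e \<longrightarrow> holds M e \<theta> = holds M e \<theta>')) \<longleftrightarrow>
    gr n m \<theta> M = gr n m \<theta>' M" for M
  proof (cases "fst M = {}")
    case True
    then show ?thesis using m by (cases m) (simp_all add: gr_def tuples_empty)
  next
    case False
    then obtain u where u: "u \<in> fst M" by blast
    have "gr n m \<theta> M = gr n m \<theta>' M \<longleftrightarrow>
      (\<forall>a\<in>tuples (fst M) n. \<forall>b\<in>tuples (fst M) m. holds M (env a b) \<theta> = holds M (env a b) \<theta>')"
      unfolding gr_def by blast
    also have "\<dots> \<longleftrightarrow> (\<forall>e. e ` hom_vars n m \<subseteq> fst M \<longrightarrow>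
       holds M (env (map e (neg_vars n)) (map e (pos_vars 0 m))) \<theta> =
       holds M (env (map e (neg_vars n)) (map e (pos_vars 0 m))) \<theta>')"
      by (rule all_env_iff[symmetric])
    also have "\<dots> \<longleftrightarrow> (\<forall>e. e ` hom_vars n m \<subseteq> fst M \<longrightarrow> holds M e \<theta> = holds M e \<theta>')"
      using holds_env[OF fv(1) refl refl] holds_env[OF fv(2) refl refl] by simp
    also have "\<dots> \<longleftrightarrow> (\<forall>e. assignment M e \<longrightarrow> holds M e \<theta> = holds M e \<theta>')"
    proof (rule iffI; intro allI impI)
      fix e assume "\<forall>e. e ` hom_vars n m \<subseteq> fst M \<longrightarrow> holds M e \<theta> = holds M e \<theta>'" "assignment M e"
      then show "holds M e \<theta> = holds M e \<theta>'" using False by (auto simp: assignment_def)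
    next
      fix e assume a: "\<forall>e. assignment M e \<longrightarrow> holds M e \<theta> = holds M e \<theta>'" and e: "e ` hom_vars n m \<subseteq> fst M"
      \<comment> \<open>An admissible assignment takes all its values, also those outside \<open>hom_vars n m\<close>, in the universe.\<close>
      let ?e = "\<lambda>x. if x \<in> hom_vars n m then e x else u"
      have "assignment M ?e" using e u by (auto simp: assignment_def)
      then have "holds M ?e \<theta> = holds M ?e \<theta>'" using a by blast
      moreover have "holds M ?e \<theta> = holds M e \<theta>" "holds M ?e \<theta>' = holds M e \<theta>'"
        using fv by (auto intro!: sat_cong_fv)
      ultimately show "holds M e \<theta> = holds M e \<theta>'" by simp
    qed
    finally show ?thesis using False by simp
  qed
  moreover have "prov_equiv L (T \<union> {Neg Emp}) \<theta> \<theta>' \<longleftrightarrow> (\<forall>\<^sub>F M in Models T.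
      (\<forall>e. holds M e (Neg Emp)) \<longrightarrow> (\<forall>e. assignment M e \<longrightarrow> holds M e \<theta> = holds M e \<theta>'))"
    unfolding prov_equiv_def prov_implies_iff[OF T' \<theta>] prov_implies_iff[OF T' \<theta>(2,1)]
      Models_insert eventually_conj_iff[symmetric]
    by (rule arg_cong[where f = "\<lambda>P. eventually P (Models T)"]) (rule HOL.ext, blast)
  ultimately show ?thesis by simp
qed

section \<open>The syntactic category\<close>

text \<open>
The graph of a formal arrow is the full relation, which is single-valued because a sentence has at most one
tuple. For a class of premorphisms any member may be used; different members have the same graph only
eventually.
\<close>

fun arr_graph :: "'r arrow \<Rightarrow> 'r model \<Rightarrow> (int list \<times> int list) set" where
  "arr_graph (Formal \<alpha> s) M = ext \<alpha> M \<times> ext s M"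
| "arr_graph (Class \<alpha> \<beta> \<Theta>) M = gr (nfv \<alpha>) (nfv \<beta>) (SOME \<theta>. \<theta> \<in> \<Theta>) M"

definition definable :: "'r signature \<Rightarrow> 'r fm \<Rightarrow> 'r fm \<Rightarrow> ('r model \<Rightarrow> (int list \<times> int list) set) set" where
  "definable L \<alpha> \<beta> = {R. \<exists>\<theta>\<in>formulas L. fv \<theta> \<subseteq> hom_vars (nfv \<alpha>) (nfv \<beta>) \<and>
     R = gr (nfv \<alpha>) (nfv \<beta>) \<theta>}"

lemma definableI:
  assumes "\<theta> \<in> formulas L" "fv \<theta> \<subseteq> hom_vars (nfv \<alpha>) (nfv \<beta>)"
    "\<And>M. gr (nfv \<alpha>) (nfv \<beta>) \<theta> M = R M"
  shows "R \<in> definable L \<alpha> \<beta>"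
proof -
  have "R = gr (nfv \<alpha>) (nfv \<beta>) \<theta>" using assms(3) by (intro HOL.ext) simp
  then show ?thesis unfolding definable_def using assms(1,2) by blast
qed

lemma definableE:
  assumes "R \<in> definable L \<alpha> \<beta>"
  obtains \<theta> where "\<theta> \<in> formulas L" "fv \<theta> \<subseteq> hom_vars (nfv \<alpha>) (nfv \<beta>)"
    "R = gr (nfv \<alpha>) (nfv \<beta>) \<theta>"
  using assms unfolding definable_def by blast

lemma nfv_0: "nfv \<phi> = 0 \<longleftrightarrow> fv \<phi> = {}"
  by (simp add: nfv_def finite_fv)

lemma tuples_0: "tuples U 0 = {[]}"
  by (auto simp: tuples_def)

lemma ext_sentence:
  assumes "fv s = {}"
  shows "ext s M = (if holds M e s then {[]} else {})"
proof -
  have "nfv s = 0" using assms nfv_0 by blast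
  then show ?thesis using holds_sentence[OF assms, of M _ e] by (auto simp: ext_def tuples_0)
qed

lemma ext_sentence_subset: "fv s = {} \<Longrightarrow> ext s M \<subseteq> {[]}"
  by (subst ext_sentence[of _ _ undefined]) auto

lemma is_fun_times:
  assumes "B \<subseteq> {x}"
  shows "is_fun A B (A \<times> B) \<longleftrightarrow> (A \<noteq> {} \<longrightarrow> B \<noteq> {})" "is_fun A B R \<Longrightarrow> R = A \<times> B"
proof -
  show "is_fun A B (A \<times> B) \<longleftrightarrow> (A \<noteq> {} \<longrightarrow> B \<noteq> {})"
    using assms by (auto simp: is_fun_def single_valued_def)
  show "R = A \<times> B" if "is_fun A B R" using that assms unfolding is_fun_def by blast
qed

text \<open>
A formula without source variables does not restrict the source tuple. This compares a premorphism whose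
source is a sentence with the same formula regarded as part of a premorphism from an arbitrary object.
\<close>

lemma gr_sentence_source:
  assumes "fv \<theta> \<subseteq> hom_vars 0 m"
  shows "(a, b) \<in> gr n m \<theta> M \<longleftrightarrow> a \<in> tuples (fst M) n \<and> ([], b) \<in> gr 0 m \<theta> M"
proof -
  have "holds M (env a b) \<theta> \<longleftrightarrow> holds M (env [] b) \<theta>" if "length b = m"
    by (rule holds_env[OF assms]) (use that in \<open>simp_all add: neg_vars_def\<close>)
  then show ?thesis by (auto simp: gr_iff tuples_def)
qed

lemma gr_formal_comp:
  assumes fv: "fv \<theta> \<subseteq> hom_vars 0 m" and b: "fv \<beta> = {}" and fn: "is_fun (ext \<beta> M) C (gr 0 m \<theta> M)"
  shows "gr (nfv \<alpha>) m (formal_comp \<alpha> \<theta>) M = (ext \<alpha> M \<times> ext \<beta> M) O gr 0 m \<theta> M"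
proof -
  have "(x, z) \<in> gr (nfv \<alpha>) m (formal_comp \<alpha> \<theta>) M \<longleftrightarrow> x \<in> ext \<alpha> M \<and> ([], z) \<in> gr 0 m \<theta> M" for x z
    unfolding formal_comp_def gr_And gr_inst(1)[OF refl] Int_iff gr_sentence_source[OF fv, of x z "nfv \<alpha>"]
    using ext_tuples[of \<alpha> M] by (auto simp: gr_iff)
  moreover have "(x, z) \<in> (ext \<alpha> M \<times> ext \<beta> M) O gr 0 m \<theta> M \<longleftrightarrow> x \<in> ext \<alpha> M \<and> ([], z) \<in> gr 0 m \<theta> M" for x z
    using ext_sentence_subset[OF b, of M] fn unfolding is_fun_def by blast
  ultimately show ?thesis by (simp only: set_eq_iff split_paired_All) simp
qed

subsection \<open>Tabulation\<close>

text \<open>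
The relation defined by \<open>\<theta>\<close> becomes an object in the variables \<open>x\<^sub>1, \<dots>, x\<^sub>n\<^sub>+\<^sub>m\<close>. Since the arity of an object
is the number of variables that occur freely in it, the trivial equations \<open>x = x\<close> are added to make all of
them occur.
\<close>

definition tab_formula :: "nat \<Rightarrow> nat \<Rightarrow> 'r fm \<Rightarrow> 'r fm" where
  "tab_formula n m \<theta> = And (subst (\<lambda>x. if x < 0 then - x else int n + x) \<theta>)
     (Ands (map (\<lambda>x. EqV x x) (pos_vars 0 (n + m))))"

lemma tab_formula:
  assumes fv: "fv \<theta> \<subseteq> hom_vars n m"
  shows "nfv (tab_formula n m \<theta>) = n + m"
    "c \<in> ext (tab_formula n m \<theta>) M \<longleftrightarrow> length c = n + m \<and> (take n c, drop n c) \<in> gr n m \<theta> M"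
proof -
  let ?\<sigma> = "\<lambda>x::int. if x < 0 then - x else int n + x"
  let ?V = "pos_vars 0 (n + m)"
  have "?\<sigma> ` hom_vars n m \<subseteq> set ?V" by (auto simp: set_vars)
  then have "fv (subst ?\<sigma> \<theta>) \<subseteq> set ?V" unfolding fv_subst using fv by blast
  then have fvt: "fv (tab_formula n m \<theta>) = set ?V" by (auto simp: tab_formula_def)
  show n: "nfv (tab_formula n m \<theta>) = n + m" by (simp add: nfv_def fvt distinct_card)
  have "sorted ?V" by (simp add: pos_vars_def sorted_map del: upt_Suc)
  then have so: "sorted_list_of_set (fv (tab_formula n m \<theta>)) = ?V"
    unfolding fvt by (simp add: sorted_list_of_set.idem_if_sorted_distinct)
  have s1: "map ?\<sigma> (neg_vars n) = pos_vars 0 n" "map ?\<sigma> (pos_vars 0 m) = pos_vars n m"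
    by (auto intro!: nth_equalityI)
  show "c \<in> ext (tab_formula n m \<theta>) M \<longleftrightarrow> length c = n + m \<and> (take n c, drop n c) \<in> gr n m \<theta> M"
  proof (cases "c \<in> tuples (fst M) (n + m)")
    case True
    then have len: "length c = n + m" by (simp add: tuples_def)
    let ?e = "\<lambda>x. the (map_of (zip ?V c) x)"
    have e: "?e (?V ! i) = c ! i" if "i < n + m" for i
      using map_of_zip_nth[of ?V c i] len that by simp
    have "map ?e (pos_vars 0 n) = take n c"
    proof (rule nth_equalityI)
      fix i assume "i < length (map ?e (pos_vars 0 n))"
      then show "map ?e (pos_vars 0 n) ! i = take n c ! i" using e[of i] by simp
    qed (simp add: len)
    moreover have "map ?e (pos_vars n m) = drop n c"
    proof (rule nth_equalityI)
      fix i assume "i < length (map ?e (pos_vars n m))"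
      then show "map ?e (pos_vars n m) ! i = drop n c ! i" using e[of "n + i"] len by simp
    qed (simp add: len)
    ultimately have "map (?e \<circ> ?\<sigma>) (neg_vars n) = take n c" "map (?e \<circ> ?\<sigma>) (pos_vars 0 m) = drop n c"
      using s1 by (metis map_map)+
    then have "holds M ?e (subst ?\<sigma> \<theta>) \<longleftrightarrow> holds M (env (take n c) (drop n c)) \<theta>"
      unfolding sat_subst by (rule holds_env[OF fv])
    then have "holds M ?e (tab_formula n m \<theta>) \<longleftrightarrow> holds M (env (take n c) (drop n c)) \<theta>"
      by (simp add: tab_formula_def)
    moreover have "take n c \<in> tuples (fst M) n" "drop n c \<in> tuples (fst M) m"
      using True by (auto simp: tuples_def dest: in_set_takeD in_set_dropD)
    ultimately show ?thesis using True len by (simp add: ext_def n so gr_iff)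
  next
    case False
    have "c \<in> tuples (fst M) (n + m)" if "length c = n + m" "(take n c, drop n c) \<in> gr n m \<theta> M"
    proof -
      have "set (take n c @ drop n c) \<subseteq> fst M" using that(2) unfolding set_append by (simp add: gr_iff tuples_def)
      then show ?thesis using that(1) by (simp add: tuples_def)
    qed
    then show ?thesis using False ext_tuples[of "tab_formula n m \<theta>" M] unfolding n by blast
  qed
qed

text \<open>
Both legs of the tabulation are of this form: the first one has \<open>i = 0\<close>, and for the second one \<open>i\<close> is the
arity of the source.
\<close>

lemma tab_projection:
  assumes n: "nfv \<tau> = k" and b: "nfv \<beta> = m" and k: "i + m \<le> k"
    and \<tau>: "\<tau> \<in> formulas L"
  shows "(\<lambda>M. {(c, b). c \<in> ext \<tau> M \<and> b = take m (drop i c)}) \<in> definable L \<tau> \<beta>"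
proof (rule definableI)
  let ?zs = "take m (drop i (neg_vars k))"
  let ?\<theta> = "And (inst \<tau> (neg_vars k)) (Eqs (pos_vars 0 m) ?zs)"
  have zs: "length ?zs = m" "set ?zs \<subseteq> set (neg_vars k)"
    using k by (auto dest: in_set_takeD in_set_dropD)
  show "?\<theta> \<in> formulas L" using \<tau> by simp
  have "fv (inst \<tau> (neg_vars k)) \<subseteq> set (neg_vars k)" by (rule fv_inst) (simp add: n)
  then show "fv ?\<theta> \<subseteq> hom_vars (nfv \<tau>) (nfv \<beta>)" using fv_Eqs[of "pos_vars 0 m" ?zs] zs n b by auto
  show "gr (nfv \<tau>) (nfv \<beta>) ?\<theta> M = {(c, b). c \<in> ext \<tau> M \<and> b = take m (drop i c)}" for M
  proof -
    have h: "holds M (env c b) (Eqs (pos_vars 0 m) ?zs) \<longleftrightarrow> b = take m (drop i c)"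
      if "length c = k" "length b = m" for c b
    proof -
      have "map (env c b) ?zs = take m (drop i (map (env c b) (neg_vars k)))"
        by (simp add: take_map drop_map)
      then show ?thesis using holds_Eqs[of "pos_vars 0 m" ?zs M "env c b"] zs that by simp
    qed
    have tt: "c \<in> ext \<tau> M \<Longrightarrow> c \<in> tuples (fst M) k \<and> take m (drop i c) \<in> tuples (fst M) m" for c
      using ext_tuples[of \<tau> M] n k by (auto simp: tuples_def dest!: in_set_takeD in_set_dropD)
    have "(c, b) \<in> gr k m ?\<theta> M \<longleftrightarrow> c \<in> ext \<tau> M \<and> b = take m (drop i c)" for c b
      unfolding gr_And gr_inst(1)[OF n] using tt[of c] h[of c b] by (auto simp: gr_iff tuples_def)
    then show ?thesis unfolding n b by auto
  qed
qed

subsection \<open>Morphisms as definable functions\<close>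

context
  fixes L :: "'r signature" and T :: "'r fm set"
  assumes T: "T \<subseteq> sentences L"
begin

lemma formal_exists_iff:
  assumes a: "\<alpha> \<in> formulas L" and s: "s \<in> formulas L" "fv s = {}"
  shows "formal_exists L T \<alpha> s \<longleftrightarrow>
    (\<forall>\<^sub>F M in Models T. is_fun (ext \<alpha> M) (ext s M) (ext \<alpha> M \<times> ext s M))"
proof -
  let ?n = "nfv \<alpha>"
  let ?xs = "neg_vars ?n"
  let ?\<phi> = "Imp (inst \<alpha> ?xs) s"
  have \<phi>: "?\<phi> \<in> formulas L" using a s by simp
  have "fv (inst \<alpha> ?xs) \<subseteq> set ?xs" by (rule fv_inst) simp
  then have A: "Alls ?xs ?\<phi> \<in> sentences L" using \<phi> s by (auto simp: sentences_def)
  have "(\<forall>e. holds M e (Alls ?xs ?\<phi>)) \<longleftrightarrow> is_fun (ext \<alpha> M) (ext s M) (ext \<alpha> M \<times> ext s M)" for M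
  proof -
    have h: "holds M e ?\<phi> \<longleftrightarrow> (map e ?xs \<in> ext \<alpha> M \<longrightarrow> ext s M \<noteq> {})"
      if "e ` set ?xs \<subseteq> fst M" for e
    proof -
      have "holds M e (inst \<alpha> ?xs) \<longleftrightarrow> map e ?xs \<in> ext \<alpha> M" by (rule holds_inst[OF _ that]) simp
      then show ?thesis using ext_sentence[OF s(2), of M e] by simp
    qed
    have "(\<forall>e. holds M e (Alls ?xs ?\<phi>)) \<longleftrightarrow>
        (\<forall>e. e ` set ?xs \<subseteq> fst M \<longrightarrow> map e ?xs \<in> ext \<alpha> M \<longrightarrow> ext s M \<noteq> {})"
      unfolding valid_Alls[OF \<phi>] using h by blast
    also have "\<dots> \<longleftrightarrow> (ext \<alpha> M \<noteq> {} \<longrightarrow> ext s M \<noteq> {})"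
    proof (intro iffI impI allI)
      assume l: "\<forall>e. e ` set ?xs \<subseteq> fst M \<longrightarrow> map e ?xs \<in> ext \<alpha> M \<longrightarrow> ext s M \<noteq> {}"
        and "ext \<alpha> M \<noteq> {}"
      then obtain a where a: "a \<in> ext \<alpha> M" by blast
      then have at: "a \<in> tuples (fst M) ?n" using ext_tuples by blast
      then have ea: "map (env a []) ?xs = a" by (simp add: tuples_def)
      then have "env a [] ` set ?xs \<subseteq> fst M" using at map_in_tuples by metis
      then show "ext s M \<noteq> {}" using l[rule_format, of "env a []"] ea a by simp
    qed blast
    also have "\<dots> \<longleftrightarrow> is_fun (ext \<alpha> M) (ext s M) (ext \<alpha> M \<times> ext s M)"
      using is_fun_times(1)[OF ext_sentence_subset[OF s(2)]] by blast
    finally show ?thesis .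
  qed
  then show ?thesis unfolding formal_exists_def Let_def proves_iff[OF T A] by simp
qed

lemma hom_Syn_sentence:
  assumes "fv \<beta> = {}"
  shows "f \<in> hom_set (Syn L T) \<alpha> \<beta> \<longleftrightarrow>
    f = Formal \<alpha> \<beta> \<and> \<alpha> \<in> formulas L \<and> \<beta> \<in> formulas L \<and> formal_exists L T \<alpha> \<beta>"
  using assms by (auto simp: hom_set_def Syn_def sentences_def nonsentences_def)

lemma hom_Syn_nonsentence:
  assumes "fv \<beta> \<noteq> {}"
  shows "f \<in> hom_set (Syn L T) \<alpha> \<beta> \<longleftrightarrow> \<alpha> \<in> formulas L \<and> \<beta> \<in> formulas L \<and>
    (\<exists>\<theta>. premorphism L T \<alpha> \<beta> \<theta> \<and> f = Class \<alpha> \<beta> (premor_class L T \<alpha> \<beta> \<theta>))"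
proof
  assume "f \<in> hom_set (Syn L T) \<alpha> \<beta>"
  then show "\<alpha> \<in> formulas L \<and> \<beta> \<in> formulas L \<and>
      (\<exists>\<theta>. premorphism L T \<alpha> \<beta> \<theta> \<and> f = Class \<alpha> \<beta> (premor_class L T \<alpha> \<beta> \<theta>))"
    using assms by (auto simp: hom_set_def Syn_def sentences_def nonsentences_def)
next
  assume "\<alpha> \<in> formulas L \<and> \<beta> \<in> formulas L \<and>
      (\<exists>\<theta>. premorphism L T \<alpha> \<beta> \<theta> \<and> f = Class \<alpha> \<beta> (premor_class L T \<alpha> \<beta> \<theta>))"
  then obtain \<theta> where "\<alpha> \<in> formulas L" "\<beta> \<in> nonsentences L" "premorphism L T \<alpha> \<beta> \<theta>"
    and f: "f = Class \<alpha> \<beta> (premor_class L T \<alpha> \<beta> \<theta>)" using assms by (auto simp: nonsentences_def)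
  then have "f \<in> Mor (Syn L T)" by (simp add: Syn_def) blast
  then show "f \<in> hom_set (Syn L T) \<alpha> \<beta>" unfolding hom_set_def by (simp add: f Syn_def)
qed

lemma mem_premor_class:
  assumes o: "\<alpha> \<in> formulas L" "\<beta> \<in> formulas L" "fv \<beta> \<noteq> {}" and \<theta>: "premorphism L T \<alpha> \<beta> \<theta>"
  shows "\<theta>' \<in> premor_class L T \<alpha> \<beta> \<theta> \<longleftrightarrow> premorphism L T \<alpha> \<beta> \<theta>' \<and>
    (\<forall>\<^sub>F M in Models T. gr (nfv \<alpha>) (nfv \<beta>) \<theta> M = gr (nfv \<alpha>) (nfv \<beta>) \<theta>' M)"
proof -
  have m: "nfv \<beta> > 0" using o(3) nfv_0[of \<beta>] by simp
  note i = premorphism_iff[OF T o(1,2)]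
  show ?thesis unfolding premor_class_def
    using prov_equiv_iff[OF T _ _ _ _ m, of \<theta> \<theta>' "nfv \<alpha>"] \<theta> i[of \<theta>] i[of \<theta>'] by blast
qed

lemma premor_class_eq:
  assumes o: "\<alpha> \<in> formulas L" "\<beta> \<in> formulas L" "fv \<beta> \<noteq> {}"
    and \<theta>: "premorphism L T \<alpha> \<beta> \<theta>" "premorphism L T \<alpha> \<beta> \<theta>'"
    and e: "\<forall>\<^sub>F M in Models T. gr (nfv \<alpha>) (nfv \<beta>) \<theta> M = gr (nfv \<alpha>) (nfv \<beta>) \<theta>' M"
  shows "premor_class L T \<alpha> \<beta> \<theta> = premor_class L T \<alpha> \<beta> \<theta>'"
proof -
  have "(\<forall>\<^sub>F M in Models T. gr (nfv \<alpha>) (nfv \<beta>) \<theta> M = gr (nfv \<alpha>) (nfv \<beta>) \<theta>'' M) \<longleftrightarrow>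
    (\<forall>\<^sub>F M in Models T. gr (nfv \<alpha>) (nfv \<beta>) \<theta>' M = gr (nfv \<alpha>) (nfv \<beta>) \<theta>'' M)" for \<theta>''
    by (rule eventually_subst) (use e in \<open>eventually_elim, simp\<close>)
  then show ?thesis using mem_premor_class[OF o \<theta>(1)] mem_premor_class[OF o \<theta>(2)] by blast
qed

lemma premor_class_self:
  assumes o: "\<alpha> \<in> formulas L" "\<beta> \<in> formulas L" "fv \<beta> \<noteq> {}" and \<theta>: "premorphism L T \<alpha> \<beta> \<theta>"
  shows "\<theta> \<in> premor_class L T \<alpha> \<beta> \<theta>"
  using mem_premor_class[OF assms, of \<theta>] \<theta> by simp

lemma arr_graph_Class:
  assumes o: "\<alpha> \<in> formulas L" "\<beta> \<in> formulas L" "fv \<beta> \<noteq> {}" and \<theta>: "premorphism L T \<alpha> \<beta> \<theta>"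
  shows "\<forall>\<^sub>F M in Models T. arr_graph (Class \<alpha> \<beta> (premor_class L T \<alpha> \<beta> \<theta>)) M = gr (nfv \<alpha>) (nfv \<beta>) \<theta> M"
    "premorphism L T \<alpha> \<beta> (SOME \<theta>'. \<theta>' \<in> premor_class L T \<alpha> \<beta> \<theta>)"
proof -
  have "(SOME \<theta>'. \<theta>' \<in> premor_class L T \<alpha> \<beta> \<theta>) \<in> premor_class L T \<alpha> \<beta> \<theta>"
    by (rule someI, rule premor_class_self[OF assms])
  then have h: "premorphism L T \<alpha> \<beta> (SOME \<theta>'. \<theta>' \<in> premor_class L T \<alpha> \<beta> \<theta>)"
     "\<forall>\<^sub>F M in Models T. gr (nfv \<alpha>) (nfv \<beta>) \<theta> M =
        gr (nfv \<alpha>) (nfv \<beta>) (SOME \<theta>'. \<theta>' \<in> premor_class L T \<alpha> \<beta> \<theta>) M"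
    using mem_premor_class[OF assms] by blast+
  then show "premorphism L T \<alpha> \<beta> (SOME \<theta>'. \<theta>' \<in> premor_class L T \<alpha> \<beta> \<theta>)" by simp
  show "\<forall>\<^sub>F M in Models T. arr_graph (Class \<alpha> \<beta> (premor_class L T \<alpha> \<beta> \<theta>)) M = gr (nfv \<alpha>) (nfv \<beta>) \<theta> M"
    using h(2) by eventually_elim simp
qed

lemma arr_graph_fun:
  assumes f: "f \<in> hom_set (Syn L T) \<alpha> \<beta>"
  shows "\<forall>\<^sub>F M in Models T. is_fun (ext \<alpha> M) (ext \<beta> M) (arr_graph f M)"
proof (cases "fv \<beta> = {}")
  case True
  then have "f = Formal \<alpha> \<beta>" "\<alpha> \<in> formulas L" "\<beta> \<in> formulas L" "formal_exists L T \<alpha> \<beta>"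
    using f hom_Syn_sentence by auto
  then show ?thesis using formal_exists_iff[of \<alpha> \<beta>] True by simp
next
  case False
  then obtain \<theta> where o: "\<alpha> \<in> formulas L" "\<beta> \<in> formulas L" and \<theta>: "premorphism L T \<alpha> \<beta> \<theta>"
    and f: "f = Class \<alpha> \<beta> (premor_class L T \<alpha> \<beta> \<theta>)" using f hom_Syn_nonsentence by blast
  have "\<forall>\<^sub>F M in Models T. is_fun (ext \<alpha> M) (ext \<beta> M) (gr (nfv \<alpha>) (nfv \<beta>) \<theta> M)"
    using \<theta> premorphism_iff[OF T o] by blast
  then show ?thesis unfolding f using arr_graph_Class(1)[OF o False \<theta>] by eventually_elim simp
qed

lemma arr_graph_faithful:
  assumes f: "f \<in> hom_set (Syn L T) \<alpha> \<beta>" and g: "g \<in> hom_set (Syn L T) \<alpha> \<beta>"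
    and e: "\<forall>\<^sub>F M in Models T. arr_graph f M = arr_graph g M"
  shows "f = g"
proof (cases "fv \<beta> = {}")
  case True
  then show ?thesis using f g unfolding hom_Syn_sentence[OF True] by simp
next
  case False
  obtain \<theta> \<theta>' where o: "\<alpha> \<in> formulas L" "\<beta> \<in> formulas L"
    and \<theta>: "premorphism L T \<alpha> \<beta> \<theta>" "premorphism L T \<alpha> \<beta> \<theta>'"
    and fg: "f = Class \<alpha> \<beta> (premor_class L T \<alpha> \<beta> \<theta>)" "g = Class \<alpha> \<beta> (premor_class L T \<alpha> \<beta> \<theta>')"
    using f g unfolding hom_Syn_nonsentence[OF False] by auto
  have "\<forall>\<^sub>F M in Models T. gr (nfv \<alpha>) (nfv \<beta>) \<theta> M = gr (nfv \<alpha>) (nfv \<beta>) \<theta>' M"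
    using e[unfolded fg] arr_graph_Class(1)[OF o False \<theta>(1)] arr_graph_Class(1)[OF o False \<theta>(2)]
    by eventually_elim simp
  then show ?thesis unfolding fg using premor_class_eq[OF o False \<theta>] by simp
qed

lemma arr_graph_full:
  assumes o: "\<alpha> \<in> formulas L" "\<beta> \<in> formulas L" and R: "R \<in> definable L \<alpha> \<beta>"
    and fn: "\<forall>\<^sub>F M in Models T. is_fun (ext \<alpha> M) (ext \<beta> M) (R M)"
  shows "\<exists>f\<in>hom_set (Syn L T) \<alpha> \<beta>. \<forall>\<^sub>F M in Models T. arr_graph f M = R M"
proof (cases "fv \<beta> = {}")
  case True
  note eq = is_fun_times(2)[OF ext_sentence_subset[OF True]]
  have e: "\<forall>\<^sub>F M in Models T. arr_graph (Formal \<alpha> \<beta>) M = R M"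
    using fn by eventually_elim (metis eq arr_graph.simps(1))
  have "\<forall>\<^sub>F M in Models T. is_fun (ext \<alpha> M) (ext \<beta> M) (ext \<alpha> M \<times> ext \<beta> M)"
    using fn by eventually_elim (metis eq)
  then have "Formal \<alpha> \<beta> \<in> hom_set (Syn L T) \<alpha> \<beta>"
    using o True hom_Syn_sentence[OF True] formal_exists_iff by blast
  then show ?thesis using e by blast
next
  case False
  obtain \<theta> where \<theta>: "\<theta> \<in> formulas L" "fv \<theta> \<subseteq> hom_vars (nfv \<alpha>) (nfv \<beta>)"
    and R: "R = gr (nfv \<alpha>) (nfv \<beta>) \<theta>" using R by (rule definableE)
  have p: "premorphism L T \<alpha> \<beta> \<theta>" using fn[unfolded R] \<theta> premorphism_iff[OF T o] by blast
  then have "Class \<alpha> \<beta> (premor_class L T \<alpha> \<beta> \<theta>) \<in> hom_set (Syn L T) \<alpha> \<beta>"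
    using o hom_Syn_nonsentence[OF False] by blast
  then show ?thesis unfolding R using arr_graph_Class(1)[OF o False p] by blast
qed

lemma definable_top: "\<alpha> \<in> formulas L \<Longrightarrow> \<beta> \<in> formulas L \<Longrightarrow> (\<lambda>M. ext \<alpha> M \<times> ext \<beta> M) \<in> definable L \<alpha> \<beta>"
proof (rule definableI[of "And (inst \<alpha> (neg_vars (nfv \<alpha>))) (inst \<beta> (pos_vars 0 (nfv \<beta>)))"])
  have "fv (inst \<alpha> (neg_vars (nfv \<alpha>))) \<subseteq> set (neg_vars (nfv \<alpha>))" "fv (inst \<beta> (pos_vars 0 (nfv \<beta>))) \<subseteq> set (pos_vars 0 (nfv \<beta>))"
    by (rule fv_inst; simp)+
  then show "fv (And (inst \<alpha> (neg_vars (nfv \<alpha>))) (inst \<beta> (pos_vars 0 (nfv \<beta>)))) \<subseteq> hom_vars (nfv \<alpha>) (nfv \<beta>)" by auto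
  show "gr (nfv \<alpha>) (nfv \<beta>) (And (inst \<alpha> (neg_vars (nfv \<alpha>))) (inst \<beta> (pos_vars 0 (nfv \<beta>)))) M =
    ext \<alpha> M \<times> ext \<beta> M" for M
    using ext_tuples[of \<alpha> M] ext_tuples[of \<beta> M] by (auto simp: gr_And gr_inst)
qed simp

lemma definable_arr_graph:
  assumes f: "f \<in> hom_set (Syn L T) \<alpha> \<beta>"
  shows "arr_graph f \<in> definable L \<alpha> \<beta>"
proof (cases "fv \<beta> = {}")
  case True
  then have "f = Formal \<alpha> \<beta>" "\<alpha> \<in> formulas L" "\<beta> \<in> formulas L" using f hom_Syn_sentence by auto
  moreover have "arr_graph (Formal \<alpha> \<beta>) = (\<lambda>M. ext \<alpha> M \<times> ext \<beta> M)" by (rule HOL.ext) simp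
  ultimately show ?thesis using definable_top by simp
next
  case False
  then obtain \<theta> where o: "\<alpha> \<in> formulas L" "\<beta> \<in> formulas L" and \<theta>: "premorphism L T \<alpha> \<beta> \<theta>"
    and f: "f = Class \<alpha> \<beta> (premor_class L T \<alpha> \<beta> \<theta>)" using f hom_Syn_nonsentence by blast
  show ?thesis
    by (rule definableI[of "SOME \<theta>'. \<theta>' \<in> premor_class L T \<alpha> \<beta> \<theta>"])
      (use arr_graph_Class(2)[OF o False \<theta>] in \<open>simp_all add: premorphism_iff[OF T o] f\<close>)
qed

lemma Syn_Ident:
  assumes o: "\<alpha> \<in> formulas L"
  shows "syn_ident L T \<alpha> \<in> hom_set (Syn L T) \<alpha> \<alpha>"
    "\<forall>\<^sub>F M in Models T. arr_graph (syn_ident L T \<alpha>) M = Id_on (ext \<alpha> M)"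
proof -
  let ?xs = "neg_vars (nfv \<alpha>)" and ?ys = "pos_vars 0 (nfv \<alpha>)"
  have "syn_ident L T \<alpha> \<in> hom_set (Syn L T) \<alpha> \<alpha> \<and>
    (\<forall>\<^sub>F M in Models T. arr_graph (syn_ident L T \<alpha>) M = Id_on (ext \<alpha> M))"
  proof (cases "fv \<alpha> = {}")
    case True
    have "Id_on (ext \<alpha> M) = ext \<alpha> M \<times> ext \<alpha> M" for M using ext_sentence_subset[OF True, of M] by auto
    moreover have "is_fun (ext \<alpha> M) (ext \<alpha> M) (ext \<alpha> M \<times> ext \<alpha> M)" for M
      using is_fun_times(1)[OF ext_sentence_subset[OF True]] by blast
    ultimately show ?thesis using o True hom_Syn_sentence formal_exists_iff[OF o o True]
      by (simp add: syn_ident_def)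
  next
    case False
    let ?\<theta> = "And (inst \<alpha> ?xs) (Eqs ?ys ?xs)"
    have g: "gr (nfv \<alpha>) (nfv \<alpha>) ?\<theta> M = Id_on (ext \<alpha> M)" for M
    proof -
      have "holds M (env a b) (Eqs ?ys ?xs) \<longleftrightarrow> b = a" if "length a = nfv \<alpha>" "length b = nfv \<alpha>" for a b
        using holds_Eqs[of ?ys ?xs M "env a b"] that by simp
      then show ?thesis unfolding gr_And gr_inst(1)[OF refl]
        using ext_tuples[of \<alpha> M] by (auto simp: gr_def tuples_def)
    qed
    have "fv (inst \<alpha> ?xs) \<subseteq> set ?xs" by (rule fv_inst) simp
    then have "fv ?\<theta> \<subseteq> hom_vars (nfv \<alpha>) (nfv \<alpha>)" using fv_Eqs[of ?ys ?xs] by auto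
    moreover have "is_fun A A (Id_on A)" for A :: "int list set" by (auto simp: is_fun_def single_valued_def)
    ultimately have \<theta>: "premorphism L T \<alpha> \<alpha> ?\<theta>" unfolding premorphism_iff[OF T o o] g using o by simp
    have i: "syn_ident L T \<alpha> = Class \<alpha> \<alpha> (premor_class L T \<alpha> \<alpha> ?\<theta>)"
      using False by (simp add: syn_ident_def Let_def)
    show ?thesis unfolding i hom_Syn_nonsentence[OF False]
      using arr_graph_Class(1)[OF o o False \<theta>, unfolded g] \<theta> o by blast
  qed
  then show "syn_ident L T \<alpha> \<in> hom_set (Syn L T) \<alpha> \<alpha>"
    "\<forall>\<^sub>F M in Models T. arr_graph (syn_ident L T \<alpha>) M = Id_on (ext \<alpha> M)" by blast+
qed

text \<open>
Composition in \<open>Syn L T\<close> is defined as a union over all representatives. The union is one class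
because all representatives of the composite have eventually the same graph \<open>R\<close>.
\<close>

lemma Class_UN:
  assumes o: "\<alpha> \<in> formulas L" "\<gamma> \<in> formulas L" "fv \<gamma> \<noteq> {}" and I: "i \<in> I"
    and \<Theta>: "\<And>i. i \<in> I \<Longrightarrow> \<Theta> i \<in> formulas L \<and> fv (\<Theta> i) \<subseteq> hom_vars (nfv \<alpha>) (nfv \<gamma>)"
    and R: "\<And>i. i \<in> I \<Longrightarrow> \<forall>\<^sub>F M in Models T. gr (nfv \<alpha>) (nfv \<gamma>) (\<Theta> i) M = R M"
    and fn: "\<forall>\<^sub>F M in Models T. is_fun (ext \<alpha> M) (ext \<gamma> M) (R M)"
  defines "f \<equiv> Class \<alpha> \<gamma> (\<Union>i\<in>I. premor_class L T \<alpha> \<gamma> (\<Theta> i))"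
  shows "f \<in> hom_set (Syn L T) \<alpha> \<gamma> \<and> (\<forall>\<^sub>F M in Models T. arr_graph f M = R M)"
proof -
  have p: "premorphism L T \<alpha> \<gamma> (\<Theta> i)" if "i \<in> I" for i
  proof -
    have "\<forall>\<^sub>F M in Models T. is_fun (ext \<alpha> M) (ext \<gamma> M) (gr (nfv \<alpha>) (nfv \<gamma>) (\<Theta> i) M)"
      using R[OF that] fn by eventually_elim simp
    then show ?thesis unfolding premorphism_iff[OF T o(1,2)] using \<Theta>[OF that] by blast
  qed
  have k: "premor_class L T \<alpha> \<gamma> (\<Theta> j) = premor_class L T \<alpha> \<gamma> (\<Theta> i)" if "j \<in> I" for j
    by (rule premor_class_eq[OF o p[OF that] p[OF I]])
      (use R[OF that] R[OF I] in \<open>eventually_elim, simp\<close>)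
  have "I \<noteq> {}" using I by blast
  then have "(\<Union>i\<in>I. premor_class L T \<alpha> \<gamma> (\<Theta> i)) = premor_class L T \<alpha> \<gamma> (\<Theta> i)"
    using k by (rule SUP_eq_const)
  then have f: "f = Class \<alpha> \<gamma> (premor_class L T \<alpha> \<gamma> (\<Theta> i))" unfolding f_def by simp
  have "\<forall>\<^sub>F M in Models T. arr_graph f M = R M"
    unfolding f using arr_graph_Class(1)[OF o p[OF I]] R[OF I] by eventually_elim simp
  moreover have "f \<in> hom_set (Syn L T) \<alpha> \<gamma>"
    unfolding f hom_Syn_nonsentence[OF o(3)] using p[OF I] o by blast
  ultimately show ?thesis by blast
qed

text \<open>
There are three cases, as the target and the middle object are sentences or not; in each of them the
composite has the composite graph, which is functional again.
\<close>

lemma Syn_Cmp: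
  assumes f: "f \<in> hom_set (Syn L T) \<alpha> \<beta>" and g: "g \<in> hom_set (Syn L T) \<beta> \<gamma>"
  shows "syn_comp L T g f \<in> hom_set (Syn L T) \<alpha> \<gamma> \<and>
    (\<forall>\<^sub>F M in Models T. arr_graph (syn_comp L T g f) M = arr_graph f M O arr_graph g M)"
proof -
  have fn: "\<forall>\<^sub>F M in Models T. is_fun (ext \<alpha> M) (ext \<gamma> M) (arr_graph f M O arr_graph g M)"
    using arr_graph_fun[OF f] arr_graph_fun[OF g]
  proof eventually_elim
    case (elim M)
    obtain u where u: "\<And>a. a \<in> ext \<alpha> M \<Longrightarrow> u a \<in> ext \<beta> M"
      "\<And>a b. (a, b) \<in> arr_graph f M \<longleftrightarrow> a \<in> ext \<alpha> M \<and> b = u a" using elim(1) by (rule is_funE) blast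
    obtain v where v: "\<And>a. a \<in> ext \<beta> M \<Longrightarrow> v a \<in> ext \<gamma> M"
      "\<And>a b. (a, b) \<in> arr_graph g M \<longleftrightarrow> a \<in> ext \<beta> M \<and> b = v a" using elim(2) by (rule is_funE) blast
    show ?case unfolding is_fun_def single_valued_def Domain_unfold subset_iff
      using relcomp_fun_iff[OF u(2,1) v(2)] u(1) v(1) by auto
  qed
  have o: "\<alpha> \<in> formulas L" "\<beta> \<in> formulas L" "\<gamma> \<in> formulas L"
    using f g hom_Syn_sentence hom_Syn_nonsentence by metis+
  show ?thesis
  proof (cases "fv \<gamma> = {}")
    case True
    have gf: "g = Formal \<beta> \<gamma>" using g hom_Syn_sentence[OF True] by blast
    have "arr_dom f = \<alpha>" using f by (simp add: hom_set_def Syn_def)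
    then have c: "syn_comp L T g f = Formal \<alpha> \<gamma>" by (simp add: gf)
    note eq = is_fun_times(2)[OF ext_sentence_subset[OF True]]
    have "\<forall>\<^sub>F M in Models T. is_fun (ext \<alpha> M) (ext \<gamma> M) (ext \<alpha> M \<times> ext \<gamma> M)"
      using fn by eventually_elim (metis eq)
    moreover have "\<forall>\<^sub>F M in Models T. arr_graph (Formal \<alpha> \<gamma>) M = arr_graph f M O arr_graph g M"
      using fn by eventually_elim (metis eq arr_graph.simps(1))
    ultimately show ?thesis
      unfolding c hom_Syn_sentence[OF True] formal_exists_iff[OF o(1,3) True] using o by blast
  next
    case False
    obtain \<theta>2 where \<theta>2: "premorphism L T \<beta> \<gamma> \<theta>2" and g': "g = Class \<beta> \<gamma> (premor_class L T \<beta> \<gamma> \<theta>2)"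
      using g hom_Syn_nonsentence[OF False] by blast
    note in2 = mem_premor_class[OF o(2,3) False \<theta>2] and self2 = premor_class_self[OF o(2,3) False \<theta>2]
    note pi = premorphism_iff[OF T]
    have G2: "\<forall>\<^sub>F M in Models T. arr_graph g M = gr (nfv \<beta>) (nfv \<gamma>) \<theta>' M"
      if "\<theta>' \<in> premor_class L T \<beta> \<gamma> \<theta>2" for \<theta>'
    proof -
      have "\<forall>\<^sub>F M in Models T. gr (nfv \<beta>) (nfv \<gamma>) \<theta>2 M = gr (nfv \<beta>) (nfv \<gamma>) \<theta>' M" using that in2 by blast
      then show ?thesis using arr_graph_Class(1)[OF o(2,3) False \<theta>2, folded g'] by eventually_elim simp
    qed
    show ?thesis
    proof (cases "fv \<beta> = {}")
      case True
      have f': "f = Formal \<alpha> \<beta>" using f hom_Syn_sentence[OF True] by blast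
      have b0: "nfv \<beta> = 0" using True nfv_0 by blast
      have eq: "syn_comp L T g f = Class \<alpha> \<gamma> (\<Union>\<theta>\<in>premor_class L T \<beta> \<gamma> \<theta>2.
          premor_class L T \<alpha> \<gamma> (formal_comp \<alpha> \<theta>))" unfolding f' g' by simp
      show ?thesis unfolding eq
      proof (rule Class_UN[OF o(1,3) False self2 _ _ fn])
        fix \<theta> assume \<theta>: "\<theta> \<in> premor_class L T \<beta> \<gamma> \<theta>2"
        have p: "\<theta> \<in> formulas L" "fv \<theta> \<subseteq> hom_vars 0 (nfv \<gamma>)"
          "\<forall>\<^sub>F M in Models T. is_fun (ext \<beta> M) (ext \<gamma> M) (gr 0 (nfv \<gamma>) \<theta> M)"
          using \<theta> in2 pi[OF o(2,3)] b0 by auto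
        have "fv (inst \<alpha> (neg_vars (nfv \<alpha>))) \<subseteq> set (neg_vars (nfv \<alpha>))" by (rule fv_inst) simp
        then show "formal_comp \<alpha> \<theta> \<in> formulas L \<and> fv (formal_comp \<alpha> \<theta>) \<subseteq> hom_vars (nfv \<alpha>) (nfv \<gamma>)"
          using p(1,2) o by (auto simp: formal_comp_def neg_vars_def)
        show "\<forall>\<^sub>F M in Models T. gr (nfv \<alpha>) (nfv \<gamma>) (formal_comp \<alpha> \<theta>) M = arr_graph f M O arr_graph g M"
          using p(3) G2[OF \<theta>] by eventually_elim (simp add: f' gr_formal_comp[OF p(2) True] b0)
      qed
    next
      case b: False
      obtain \<theta>1 where \<theta>1: "premorphism L T \<alpha> \<beta> \<theta>1" and f': "f = Class \<alpha> \<beta> (premor_class L T \<alpha> \<beta> \<theta>1)"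
        using f hom_Syn_nonsentence[OF b] by blast
      note in1 = mem_premor_class[OF o(1,2) b \<theta>1] and self1 = premor_class_self[OF o(1,2) b \<theta>1]
      have G1: "\<forall>\<^sub>F M in Models T. arr_graph f M = gr (nfv \<alpha>) (nfv \<beta>) \<theta>' M"
        if "\<theta>' \<in> premor_class L T \<alpha> \<beta> \<theta>1" for \<theta>'
      proof -
        have "\<forall>\<^sub>F M in Models T. gr (nfv \<alpha>) (nfv \<beta>) \<theta>1 M = gr (nfv \<alpha>) (nfv \<beta>) \<theta>' M" using that in1 by blast
        then show ?thesis using arr_graph_Class(1)[OF o(1,2) b \<theta>1, folded f'] by eventually_elim simp
      qed
      have eq: "syn_comp L T g f = Class \<alpha> \<gamma>
          (\<Union>i\<in>premor_class L T \<alpha> \<beta> \<theta>1 \<times> premor_class L T \<beta> \<gamma> \<theta>2.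
            premor_class L T \<alpha> \<gamma> (premor_comp \<beta> \<gamma> (fst i) (snd i)))"
      proof -
        have "(\<Union>x\<in>A. \<Union>y\<in>B. h x y) = (\<Union>i\<in>A \<times> B. h (fst i) (snd i))"
          for A B and h :: "'r fm \<Rightarrow> 'r fm \<Rightarrow> 'r fm set" by auto blast
        then show ?thesis unfolding f' g' by (simp only: syn_comp.simps)
      qed
      show ?thesis unfolding eq
      proof (rule Class_UN[OF o(1,3) False SigmaI[OF self1 self2] _ _ fn])
        fix i assume i: "i \<in> premor_class L T \<alpha> \<beta> \<theta>1 \<times> premor_class L T \<beta> \<gamma> \<theta>2"
        then have \<theta>: "fst i \<in> premor_class L T \<alpha> \<beta> \<theta>1" "snd i \<in> premor_class L T \<beta> \<gamma> \<theta>2" by auto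
        have p: "fst i \<in> formulas L" "fv (fst i) \<subseteq> hom_vars (nfv \<alpha>) (nfv \<beta>)"
          "snd i \<in> formulas L" "fv (snd i) \<subseteq> hom_vars (nfv \<beta>) (nfv \<gamma>)"
          using \<theta>[unfolded in1 in2] unfolding pi[OF o(1,2)] pi[OF o(2,3)] by blast+
        show "premor_comp \<beta> \<gamma> (fst i) (snd i) \<in> formulas L \<and>
            fv (premor_comp \<beta> \<gamma> (fst i) (snd i)) \<subseteq> hom_vars (nfv \<alpha>) (nfv \<gamma>)"
          by (intro conjI fv_premor_comp[OF p(2,4)] premor_comp_formula[OF p(1,3)])
        show "\<forall>\<^sub>F M in Models T. gr (nfv \<alpha>) (nfv \<gamma>) (premor_comp \<beta> \<gamma> (fst i) (snd i)) M =
            arr_graph f M O arr_graph g M"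
          using G1[OF \<theta>(1)] G2[OF \<theta>(2)] by eventually_elim (simp add: gr_comp[OF refl refl p(1,3,2,4)])
      qed
    qed
  qed
qed

text \<open>
A pair of tuples of lengths \<open>n\<close> and \<open>m\<close> is the same as one tuple of length \<open>n + m\<close>.
\<close>

lemma Syn_tabulation:
  assumes o: "\<alpha> \<in> formulas L" "\<beta> \<in> formulas L" and R: "R \<in> definable L \<alpha> \<beta>"
    and le: "\<forall>\<^sub>F M in Models T. R M \<subseteq> ext \<alpha> M \<times> ext \<beta> M"
  shows "\<exists>\<tau> p q. p \<in> hom_set (Syn L T) \<tau> \<alpha> \<and> q \<in> hom_set (Syn L T) \<tau> \<beta> \<and>
    (\<forall>\<^sub>F M in Models T. tabulates (arr_graph p M) (arr_graph q M) (R M))"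
proof -
  let ?n = "nfv \<alpha>" and ?m = "nfv \<beta>"
  obtain \<theta> where \<theta>: "\<theta> \<in> formulas L" "fv \<theta> \<subseteq> hom_vars ?n ?m" and R: "R = gr ?n ?m \<theta>"
    using R by (rule definableE)
  define \<tau> where "\<tau> = tab_formula ?n ?m \<theta>"
  have \<tau>: "\<tau> \<in> formulas L" unfolding \<tau>_def tab_formula_def using \<theta>(1) by auto
  note tf = tab_formula[OF \<theta>(2), folded \<tau>_def]
  let ?P = "\<lambda>M. {(c, b). c \<in> ext \<tau> M \<and> b = take ?n (drop 0 c)}"
  let ?Q = "\<lambda>M. {(c, b). c \<in> ext \<tau> M \<and> b = take ?m (drop ?n c)}"
  have P: "?P \<in> definable L \<tau> \<alpha>" by (rule tab_projection[OF tf(1) refl _ \<tau>]) simp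
  have Q: "?Q \<in> definable L \<tau> \<beta>" by (rule tab_projection[OF tf(1) refl _ \<tau>]) simp
  have tk: "take ?m (drop ?n c) = drop ?n c" if "c \<in> ext \<tau> M" for c M using tf(2) that by simp
  have "\<forall>\<^sub>F M in Models T. is_fun (ext \<tau> M) (ext \<alpha> M) (?P M)"
    using le unfolding R by eventually_elim (auto simp: is_fun_def single_valued_def tf(2))
  then obtain p where p: "p \<in> hom_set (Syn L T) \<tau> \<alpha>" "\<forall>\<^sub>F M in Models T. arr_graph p M = ?P M"
    using arr_graph_full[OF \<tau> o(1) P] by blast
  have "\<forall>\<^sub>F M in Models T. is_fun (ext \<tau> M) (ext \<beta> M) (?Q M)"
    using le unfolding R by eventually_elim (auto simp: is_fun_def single_valued_def tf(2))
  then obtain q where q: "q \<in> hom_set (Syn L T) \<tau> \<beta>" "\<forall>\<^sub>F M in Models T. arr_graph q M = ?Q M"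
    using arr_graph_full[OF \<tau> o(2) Q] by blast
  have tab: "tabulates (?P M) (?Q M) (R M)" for M
  proof (subst tabulates_fun_iff[where T = "ext \<tau> M" and p = "take ?n" and q = "drop ?n"])
    show "(c, b) \<in> ?P M \<longleftrightarrow> c \<in> ext \<tau> M \<and> b = take ?n c" for c b by simp
    show "(c, b) \<in> ?Q M \<longleftrightarrow> c \<in> ext \<tau> M \<and> b = drop ?n c" for c b using tk[of c M] by auto
    have "(a, b) \<in> R M \<longleftrightarrow> (\<exists>c\<in>ext \<tau> M. a = take ?n c \<and> b = drop ?n c)" for a b
    proof
      assume r: "(a, b) \<in> R M"
      then have "length a = ?n" "length b = ?m" by (simp_all add: R gr_iff tuples_def)
      then show "\<exists>c\<in>ext \<tau> M. a = take ?n c \<and> b = drop ?n c"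
        using r by (intro bexI[of _ "a @ b"]) (simp_all add: tf(2) R)
    qed (auto simp: tf(2) R)
    moreover have "c = d" if "take ?n c = take ?n d" "drop ?n c = drop ?n d" for c d :: "int list"
      using that by (metis append_take_drop_id)
    ultimately show "(\<forall>x y. (x, y) \<in> R M \<longleftrightarrow> (\<exists>t\<in>ext \<tau> M. x = take ?n t \<and> y = drop ?n t)) \<and>
      (\<forall>s\<in>ext \<tau> M. \<forall>t\<in>ext \<tau> M. take ?n s = take ?n t \<longrightarrow> drop ?n s = drop ?n t \<longrightarrow> s = t)" by blast
  qed
  have "\<forall>\<^sub>F M in Models T. tabulates (arr_graph p M) (arr_graph q M) (R M)"
    using p(2) q(2) by eventually_elim (simp only: tab)
  then show ?thesis using p(1) q(1) by blast
qed

lemma Syn_relational_category: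
  "relational_category (Syn L T) (Models T) ext arr_graph (definable L)"
proof
  have Ob: "Ob (Syn L T) = formulas L" by (simp add: Syn_def)
  have Id: "Ident (Syn L T) = syn_ident L T" and Cm: "Cmp (Syn L T) = syn_comp L T"
    by (simp_all add: Syn_def)
  show "Dom (Syn L T) f \<in> Ob (Syn L T)" "Cod (Syn L T) f \<in> Ob (Syn L T)" if "f \<in> Mor (Syn L T)" for f
    using that by (auto simp: Syn_def sentences_def nonsentences_def)
  show "Ident (Syn L T) a \<in> hom_set (Syn L T) a a"
    "\<forall>\<^sub>F w in Models T. arr_graph (Ident (Syn L T) a) w = Id_on (ext a w)"
    if "a \<in> Ob (Syn L T)" for a using Syn_Ident that unfolding Ob Id by auto
  show "Cmp (Syn L T) g f \<in> hom_set (Syn L T) a c"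
    "\<forall>\<^sub>F w in Models T. arr_graph (Cmp (Syn L T) g f) w = arr_graph f w O arr_graph g w"
    if "f \<in> hom_set (Syn L T) a b" "g \<in> hom_set (Syn L T) b c" for f g a b c
    using Syn_Cmp[OF that] unfolding Cm by auto
  show "\<forall>\<^sub>F w in Models T. is_fun (ext a w) (ext b w) (arr_graph f w)"
    "arr_graph f \<in> definable L a b" if "f \<in> hom_set (Syn L T) a b" for f a b
    using arr_graph_fun[OF that] definable_arr_graph[OF that] .
  show "f = g" if "f \<in> hom_set (Syn L T) a b" "g \<in> hom_set (Syn L T) a b"
    "\<forall>\<^sub>F w in Models T. arr_graph f w = arr_graph g w" for f g a b
    using arr_graph_faithful[OF that] .
  show "\<exists>f\<in>hom_set (Syn L T) a b. \<forall>\<^sub>F w in Models T. arr_graph f w = R w"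
    if "a \<in> Ob (Syn L T)" "b \<in> Ob (Syn L T)" "R \<in> definable L a b"
      "\<forall>\<^sub>F w in Models T. is_fun (ext a w) (ext b w) (R w)" for a b R
    using arr_graph_full that unfolding Ob by blast
  show "(\<lambda>w. (R w)\<inverse>) \<in> definable L b a" if R: "R \<in> definable L a b" for R a b
  proof -
    obtain \<theta> where \<theta>: "\<theta> \<in> formulas L" "fv \<theta> \<subseteq> hom_vars (nfv a) (nfv b)" "R = gr (nfv a) (nfv b) \<theta>"
      using R by (rule definableE)
    have "uminus ` hom_vars (nfv a) (nfv b) \<subseteq> hom_vars (nfv b) (nfv a)" by (auto simp: set_vars)
    then show ?thesis
      using \<theta> gr_converse[OF \<theta>(2)] by (intro definableI[of "subst uminus \<theta>"]) (auto simp: fv_subst)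
  qed
  show "(\<lambda>w. R w O R' w) \<in> definable L a c" if R: "R \<in> definable L a b" and R': "R' \<in> definable L b c" for R R' a b c
  proof -
    obtain \<theta> where \<theta>: "\<theta> \<in> formulas L" "fv \<theta> \<subseteq> hom_vars (nfv a) (nfv b)" "R = gr (nfv a) (nfv b) \<theta>"
      using R by (rule definableE)
    obtain \<theta>' where \<theta>': "\<theta>' \<in> formulas L" "fv \<theta>' \<subseteq> hom_vars (nfv b) (nfv c)" "R' = gr (nfv b) (nfv c) \<theta>'"
      using R' by (rule definableE)
    show ?thesis unfolding \<theta>(3) \<theta>'(3)
      by (rule definableI[OF premor_comp_formula[OF \<theta>(1) \<theta>'(1)] fv_premor_comp[OF \<theta>(2) \<theta>'(2)]
            gr_comp[OF refl refl \<theta>(1) \<theta>'(1) \<theta>(2) \<theta>'(2)]])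
  qed
  show "(\<lambda>w. R w \<inter> R' w) \<in> definable L a b" "(\<lambda>w. R w \<union> R' w) \<in> definable L a b"
    if R: "R \<in> definable L a b" and R': "R' \<in> definable L a b" for R R' a b
  proof -
    obtain \<theta> where \<theta>: "\<theta> \<in> formulas L" "fv \<theta> \<subseteq> hom_vars (nfv a) (nfv b)" "R = gr (nfv a) (nfv b) \<theta>"
      using R by (rule definableE)
    obtain \<theta>' where \<theta>': "\<theta>' \<in> formulas L" "fv \<theta>' \<subseteq> hom_vars (nfv a) (nfv b)" "R' = gr (nfv a) (nfv b) \<theta>'"
      using R' by (rule definableE)
    show "(\<lambda>w. R w \<inter> R' w) \<in> definable L a b" unfolding \<theta>(3) \<theta>'(3)
      by (rule definableI[of "And \<theta> \<theta>'"]) (use \<theta>(1,2) \<theta>'(1,2) in \<open>simp_all add: gr_And\<close>)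
    show "(\<lambda>w. R w \<union> R' w) \<in> definable L a b" unfolding \<theta>(3) \<theta>'(3)
      by (rule definableI[of "Or \<theta> \<theta>'"]) (use \<theta>(1,2) \<theta>'(1,2) in \<open>simp_all add: gr_Or\<close>)
  qed
  show "(\<lambda>w. {}) \<in> definable L a b" for a b
    by (rule definableI[of "And Emp (Neg Emp)"]) (simp_all add: gr_def)
  show "(\<lambda>w. ext a w \<times> ext b w) \<in> definable L a b" if "a \<in> Ob (Syn L T)" "b \<in> Ob (Syn L T)" for a b
    using definable_top that unfolding Ob by blast
  show "\<exists>t p q. p \<in> hom_set (Syn L T) t a \<and> q \<in> hom_set (Syn L T) t b \<and>
      (\<forall>\<^sub>F w in Models T. tabulates (arr_graph p w) (arr_graph q w) (R w))"
    if "a \<in> Ob (Syn L T)" "b \<in> Ob (Syn L T)" "R \<in> definable L a b"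
      "\<forall>\<^sub>F w in Models T. R w \<subseteq> ext a w \<times> ext b w" for a b R
    using Syn_tabulation that unfolding Ob by blast
  show "\<exists>t\<in>Ob (Syn L T). \<forall>\<^sub>F w in Models T. \<exists>x. ext t w = {x}"
  proof (rule bexI[of _ "Ands []"])
    have "ext (Ands []) w = {[]}" for w :: "'r model" using ext_sentence[of "Ands []" w undefined] by simp
    then show "\<forall>\<^sub>F w in Models T. \<exists>x. ext (Ands []) w = {x}" by simp
    show "Ands [] \<in> Ob (Syn L T)" unfolding Ob by simp
  qed
qed

end

theorem mainTheorem1:
  fixes L :: "'r signature" and T :: "'r fm set"
  assumes "is_theory L T" and "consistent_theory L T"
  shows "small_category (Syn L T) \<and> coherent_category (Syn L T) \<and> consistent_category (Syn L T)"
proof -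
  have T: "T \<subseteq> sentences L" using assms(1) by (simp add: is_theory_def)
  interpret relational_category "Syn L T" "Models T" ext arr_graph "definable L"
    by (rule Syn_relational_category[OF T])
  show ?thesis
    using is_small_category coherent consistent[OF consistent_Models[OF T assms(2)]] by blast
qed

end
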